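(* Let $(K_n,d_n)_n$ be a sequence of compact metrizable groups with compatible bi-invariant metrics. Let $N_n\to\infty$ be a sequence of positive integers, and let $\varphi_n:K_n\to\mathrm{U}(N_n)$ be maps. Assume that there are numbers $\varepsilon_n\to0$ and $L_n\ge0$ such that $\varphi_n$ is an $\varepsilon_n$-representation and is $(L_n,\varepsilon_n)$-quasi-Lipschitz. Then, after discarding finitely many indices, there exist integers $m_n\ge N_n$, continuous homomorphisms $\rho_n:K_n\to\mathrm{U}(m_n)$, and isometries $V_n:\mathbb C^{N_n}\to\mathbb C^{m_n}$ such that $m_n/N_n\to1$ and $$\sup_{g\in K_n}\|\varphi_n(g)-V_n^*\rho_n(g)V_n\|_{2,N_n}\to0.$$
   Context: For $x\in\mathrm{M}_N(\mathbb C)$, $\|x\|_{2,N}=(\frac1N\mathrm{tr}(x^*x))^{1/2}$, and $d^{\mathrm{HS}}_N(x,y)=\|x-y\|_{2,N}$ on the unitary group $\mathrm{U}(N)$. For a group $K$ with metric $d_K$, a map (not assumed measurable) $\varphi:K\to\mathrm{U}(N)$ is an $\varepsilon$-representation if $d^{\mathrm{HS}}_N(\varphi(gh),\varphi(g)\varphi(h))\le\varepsilon$ for all $g,h\in K$. It is $(L,\varepsilon)$-quasi-Lipschitz if $d^{\mathrm{HS}}_N(\varphi(g),\varphi(h))\le L\,d_K(g,h)+\varepsilon$ for all $g,h\in K$. *)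

theory Defs
  imports
    "HOL-Analysis.Abstract_Metric_Spaces"
    "HOL-Analysis.L2_Norm"
    "Jordan_Normal_Form.Schur_Decomposition"
begin

locale topological_group = group G for G (structure) and T :: "'a topology" +
  assumes topspace_carrier: "topspace T = carrier G"
    and continuous_mult: "continuous_map (prod_topology T T) T (\<lambda>(x, y). x \<otimes> y)"
    and continuous_inv: "continuous_map T T (\<lambda>x. inv x)"

locale compact_metrizable_group = topological_group +
  assumes compact: "compact_space T"
    and metrizable: "metrizable_space T"

definition compatible_metric :: "'a topology \<Rightarrow> ('a \<Rightarrow> 'a \<Rightarrow> real) \<Rightarrow> bool" where
  "compatible_metric T d \<longleftrightarrow>
     Metric_space (topspace T) d \<and> Metric_space.mtopology (topspace T) d = T"

definition bi_invariant :: "('a, 'b) monoid_scheme \<Rightarrow> ('a \<Rightarrow> 'a \<Rightarrow> real) \<Rightarrow> bool" where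
  "bi_invariant G d \<longleftrightarrow>
     (\<forall>g\<in>carrier G. \<forall>x\<in>carrier G. \<forall>y\<in>carrier G.
        d (g \<otimes>\<^bsub>G\<^esub> x) (g \<otimes>\<^bsub>G\<^esub> y) = d x y \<and> d (x \<otimes>\<^bsub>G\<^esub> g) (y \<otimes>\<^bsub>G\<^esub> g) = d x y)"

definition mat_trace :: "'a::comm_monoid_add mat \<Rightarrow> 'a" where
  "mat_trace A = (\<Sum>i<dim_row A. A $$ (i, i))"

(* The trace of x* x is a nonnegative real number, so Re only changes its type. *)
definition hs_norm :: "nat \<Rightarrow> complex mat \<Rightarrow> real" where
  "hs_norm N x = sqrt (1 / real N * Re (mat_trace (mat_adjoint x * x)))"

(* The locale Metric_space asks for symmetry on the whole type. Subtraction of matrices of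
   different dimensions is not symmetric, hence the value 0 outside M_N(C). *)
definition hs_dist :: "nat \<Rightarrow> complex mat \<Rightarrow> complex mat \<Rightarrow> real" where
  "hs_dist N x y =
     (if x \<in> carrier_mat N N \<and> y \<in> carrier_mat N N then hs_norm N (x - y) else 0)"

definition unitary_group :: "nat \<Rightarrow> complex mat monoid" where
  "unitary_group N =
     \<lparr>carrier = {U \<in> carrier_mat N N. mat_adjoint U * U = 1\<^sub>m N \<and> U * mat_adjoint U = 1\<^sub>m N},
      monoid.mult = (*), one = 1\<^sub>m N\<rparr>"

definition unitary_topology :: "nat \<Rightarrow> complex mat topology" where
  "unitary_topology N = Metric_space.mtopology (carrier (unitary_group N)) (hs_dist N)"

definition eps_representation ::
    "('a, 'b) monoid_scheme \<Rightarrow> nat \<Rightarrow> real \<Rightarrow> ('a \<Rightarrow> complex mat) \<Rightarrow> bool" where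
  "eps_representation G N \<epsilon> \<phi> \<longleftrightarrow>
     (\<forall>g\<in>carrier G. \<forall>h\<in>carrier G. hs_dist N (\<phi> (g \<otimes>\<^bsub>G\<^esub> h)) (\<phi> g * \<phi> h) \<le> \<epsilon>)"

definition quasi_Lipschitz ::
    "('a, 'b) monoid_scheme \<Rightarrow> ('a \<Rightarrow> 'a \<Rightarrow> real) \<Rightarrow> nat \<Rightarrow> real \<Rightarrow> real \<Rightarrow> ('a \<Rightarrow> complex mat) \<Rightarrow> bool"
  where
  "quasi_Lipschitz G d N L \<epsilon> \<phi> \<longleftrightarrow>
     (\<forall>g\<in>carrier G. \<forall>h\<in>carrier G. hs_dist N (\<phi> g) (\<phi> h) \<le> L * d g h + \<epsilon>)"

definition euclidean_norm :: "complex vec \<Rightarrow> real" where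
  "euclidean_norm v = sqrt (Re (v \<bullet>c v))"

(* V acts as a linear map from C^N to C^m. *)
definition isometry_mat :: "nat \<Rightarrow> nat \<Rightarrow> complex mat \<Rightarrow> bool" where
  "isometry_mat N m V \<longleftrightarrow>
     V \<in> carrier_mat m N \<and>
     (\<forall>v\<in>carrier_vec N. euclidean_norm (V *\<^sub>v v) = euclidean_norm v)"

lemma mat_adjoint_dim [simp]:
  "dim_row (mat_adjoint A) = dim_col A" "dim_col (mat_adjoint A) = dim_row A"
  by (auto simp: mat_adjoint_def)

lemma mat_adjoint_index:
  "i < dim_col A \<Longrightarrow> j < dim_row A \<Longrightarrow> mat_adjoint A $$ (i, j) = conjugate (A $$ (j, i))"
  by (auto simp: mat_adjoint_def mat_of_rows_def)

lemma mat_adjoint_mult: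
  assumes "(A :: complex mat) \<in> carrier_mat l m" "B \<in> carrier_mat m n"
  shows "mat_adjoint (A * B) = mat_adjoint B * mat_adjoint A"
  using assms
  by (intro eq_matI) (auto simp: mat_adjoint_index scalar_prod_def mult.commute intro!: sum.cong)

lemma mat_adjoint_adjoint: "mat_adjoint (mat_adjoint (A :: complex mat)) = A"
  by (intro eq_matI) (auto simp: mat_adjoint_index)

lemma hs_norm_entries:
  "hs_norm N x =
     sqrt (1 / real N * (\<Sum>j<dim_col x. \<Sum>i<dim_row x. (cmod (x $$ (i, j)))\<^sup>2))"
proof -
  have "Re (mat_trace (mat_adjoint x * x))
      = (\<Sum>j<dim_col x. \<Sum>i<dim_row x. (cmod (x $$ (i, j)))\<^sup>2)"
    unfolding cmod_power2
    by (auto simp: mat_trace_def scalar_prod_def mat_adjoint_index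
        atLeast0LessThan power2_eq_square sum.distrib intro!: sum.cong)
  thus ?thesis by (simp add: hs_norm_def)
qed

lemma hs_dist_L2:
  assumes "x \<in> carrier_mat N N" "y \<in> carrier_mat N N"
  shows "hs_dist N x y =
    sqrt (1 / real N) * L2_set (\<lambda>p. cmod (x $$ p - y $$ p)) ({..<N} \<times> {..<N})"
proof -
  have "(\<Sum>j<N. \<Sum>i<N. (cmod ((x - y) $$ (i, j)))\<^sup>2)
      = (\<Sum>i<N. \<Sum>j<N. (cmod (x $$ (i, j) - y $$ (i, j)))\<^sup>2)"
    using assms by (subst sum.swap) (auto intro!: sum.cong)
  also have "\<dots> = (\<Sum>p\<in>{..<N} \<times> {..<N}. (cmod (x $$ p - y $$ p))\<^sup>2)"
    by (simp add: sum.cartesian_product case_prod_unfold)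
  finally show ?thesis
    using assms by (simp add: hs_dist_def hs_norm_entries L2_set_def real_sqrt_divide)
qed

lemma Metric_space_hs_dist: "Metric_space (carrier_mat N N) (hs_dist N)"
proof
  show "0 \<le> hs_dist N x y" for x y
    by (auto simp: hs_dist_def hs_norm_entries intro!: divide_nonneg_nonneg sum_nonneg)
  show "hs_dist N x y = hs_dist N y x" for x y
  proof (cases "x \<in> carrier_mat N N \<and> y \<in> carrier_mat N N")
    case True
    thus ?thesis by (simp add: hs_dist_L2 norm_minus_commute)
  next
    case False
    thus ?thesis unfolding hs_dist_def by auto
  qed
  show "hs_dist N x y = 0 \<longleftrightarrow> x = y"
    if "x \<in> carrier_mat N N" "y \<in> carrier_mat N N" for x y
  proof -
    have "hs_dist N x y = 0 \<longleftrightarrow> (\<forall>i<N. \<forall>j<N. x $$ (i, j) = y $$ (i, j))"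
      by (cases "N = 0") (use that in \<open>auto simp: hs_dist_L2 L2_set_eq_0_iff\<close>)
    also have "\<dots> \<longleftrightarrow> x = y"
      using that by (auto intro: eq_matI)
    finally show ?thesis .
  qed
  show "hs_dist N x z \<le> hs_dist N x y + hs_dist N y z"
    if "x \<in> carrier_mat N N" "y \<in> carrier_mat N N" "z \<in> carrier_mat N N" for x y z
  proof -
    let ?S = "{..<N} \<times> {..<N}"
    have tri: "cmod (x $$ p - z $$ p) \<le> cmod (x $$ p - y $$ p) + cmod (y $$ p - z $$ p)" for p
      using norm_triangle_ineq[of "x $$ p - y $$ p" "y $$ p - z $$ p"] by simp
    have "L2_set (\<lambda>p. cmod (x $$ p - z $$ p)) ?S
        \<le> L2_set (\<lambda>p. cmod (x $$ p - y $$ p) + cmod (y $$ p - z $$ p)) ?S"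
      by (rule L2_set_mono) (use tri in auto)
    also have "\<dots> \<le> L2_set (\<lambda>p. cmod (x $$ p - y $$ p)) ?S + L2_set (\<lambda>p. cmod (y $$ p - z $$ p)) ?S"
      by (rule L2_set_triangle_ineq)
    finally show ?thesis
      unfolding hs_dist_L2[OF that(1,3)] hs_dist_L2[OF that(1,2)] hs_dist_L2[OF that(2,3)]
        distrib_left[symmetric]
      by (rule mult_left_mono) simp
  qed
qed

lemma Metric_space_unitary: "Metric_space (carrier (unitary_group N)) (hs_dist N)"
  by (rule Metric_space.subspace[OF Metric_space_hs_dist]) (auto simp: unitary_group_def)

lemma group_unitary_group: "group (unitary_group N)"
proof (rule groupI)
  fix x y assume "x \<in> carrier (unitary_group N)" "y \<in> carrier (unitary_group N)"
  hence c: "x \<in> carrier_mat N N" "y \<in> carrier_mat N N" "mat_adjoint x \<in> carrier_mat N N"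
      "mat_adjoint y \<in> carrier_mat N N"
    and u: "mat_adjoint x * x = 1\<^sub>m N" "mat_adjoint y * y = 1\<^sub>m N"
      "x * mat_adjoint x = 1\<^sub>m N" "y * mat_adjoint y = 1\<^sub>m N"
    by (auto simp: unitary_group_def)
  have "a * b * (c * e) = a * (b * c) * e"
    if "a \<in> carrier_mat N N" "b \<in> carrier_mat N N" "c \<in> carrier_mat N N" "e \<in> carrier_mat N N"
    for a b c e :: "complex mat"
    using that by (simp add: assoc_mult_mat[of _ N N _ N _ N])
  note * = this[OF c(4,3,1,2)] this[OF c(1,2,4,3)]
  show "x \<otimes>\<^bsub>unitary_group N\<^esub> y \<in> carrier (unitary_group N)"
    using c u * by (simp add: unitary_group_def mat_adjoint_mult[OF c(1,2)])
next
  have "mat_adjoint (1\<^sub>m N :: complex mat) = 1\<^sub>m N"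
    by (intro eq_matI) (auto simp: mat_adjoint_index)
  thus "\<one>\<^bsub>unitary_group N\<^esub> \<in> carrier (unitary_group N)"
    by (simp add: unitary_group_def)
next
  fix x assume x: "x \<in> carrier (unitary_group N)"
  show "\<exists>y\<in>carrier (unitary_group N). y \<otimes>\<^bsub>unitary_group N\<^esub> x = \<one>\<^bsub>unitary_group N\<^esub>"
    using x by (intro bexI[of _ "mat_adjoint x"]) (auto simp: unitary_group_def mat_adjoint_adjoint)
qed (auto simp: unitary_group_def assoc_mult_mat[of _ N N _ N _ N])

end

theory Submission
  imports Defs "HOL-Analysis.Function_Topology"
begin

text \<open>Replace \<open>\<phi>\<close> by Lipschitz averages \<open>v\<close> of itself and put
  \<open>\<psi> z = (v z + (v (z\<inverse>))\<^sup>*) / 2\<close>. Since \<open>\<psi> (x y\<inverse>)\<close> is close to \<open>\<phi> x (\<phi> y)\<^sup>*\<close>,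
  convolution by \<open>\<psi>\<close> is a self-adjoint operator on \<open>L\<^sup>2(K, \<complex>\<^sup>N)\<close> that commutes with right
  translations and is close in Hilbert--Schmidt norm to the projection of rank \<open>N\<close> onto the functions
  \<open>x \<mapsto> \<phi> x w\<close>. Hence its spectral projection for eigenvalues near \<open>1\<close> has rank close to \<open>N\<close>, and
  right translation on the range of that projection is the representation sought; replacing small
  singular values by extra trivial summands turns the almost isometric map into an isometry.

  Neither Haar measure nor the Peter--Weyl theorem is used. The group is replaced by a minimal
  \<open>\<delta>\<close>-net, which by the marriage theorem is almost invariant under translations. All matrices are
  then finite, a gap in the spectrum that does not depend on \<open>\<delta>\<close> makes translation on the spectral
  subspace a representation up to an error that vanishes with \<open>\<delta>\<close>, and compactness of a product of discs
  yields an exact representation in the limit. The eigenvectors extend to Lipschitz functions on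
  the group, so the representation obtained is continuous.\<close>

section \<open>Almost invariant nets\<close>

text \<open>The obstacle is the order in which constants are fixed. \<open>\<phi>\<close> may be
  discontinuous, so its sums over a net and over a translate of the net cannot be compared directly;
  the averages \<open>v\<close> can, but their Lipschitz constant comes from a partition of unity
  and has no bound in terms of \<open>\<epsilon>\<close> and \<open>N\<close>. In the estimates it
  occurs only multiplied by \<open>\<delta>\<close>, which is chosen after everything else; apart
  from that it only enters the Lipschitz constant of the representation, where any finite value will
  do. The gap must be known before \<open>\<delta>\<close>: a translated eigenvector satisfies the
  eigenvalue equation only approximately, and the part leaking across the cut is the residual
  divided by the gap. Closeness to a projection of rank \<open>N\<close> bounds the number of
  eigenvalues above \<open>1/4\<close> for all nets at once, and pigeonhole does the rest. In units
  of \<open>\<epsilon> * sqrt N\<close>, the operator is within 3 + 2 = 5 of the projection (3 for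
  quotients, 2 for smoothing). Cutting at distance at least 1/4 from both 0 and 1 multiplies this by
  4, so K = 20. The dimension is at most N + 3 K^2, and the compression error is 8 * 5 + 2 * 2 + 1 +
  4 * 20 = 125.\<close>

lemma hall_marriage:
  fixes A :: "'a set" and R :: "'a \<Rightarrow> 'b set"
  assumes "finite A" "\<forall>a\<in>A. finite (R a)" "\<forall>X\<subseteq>A. card X \<le> card (\<Union>(R ` X))"
  shows "\<exists>f. inj_on f A \<and> (\<forall>a\<in>A. f a \<in> R a)"
  using assms
proof (induction "card A" arbitrary: A R rule: less_induct)
  case less
  have IH: "\<exists>f. inj_on f B \<and> (\<forall>a\<in>B. f a \<in> Q a)"
    if "card B < card A" "finite B" "\<And>a. a \<in> B \<Longrightarrow> finite (Q a)"
      "\<And>Y. Y \<subseteq> B \<Longrightarrow> card Y \<le> card (\<Union>(Q ` Y))" for B and Q :: "'a \<Rightarrow> 'b set"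
    using that by (intro less.hyps) simp_all
  note prems2 = less.prems(2)[rule_format] and prems3 = less.prems(3)[rule_format]
  show ?case
  \<comment> \<open>Either some proper nonempty subset is tight: it is matched on its own, and the
    rest still satisfies Hall's condition once all candidates of \<open>X\<close> are removed. Or
    every proper nonempty subset has a candidate to spare, and one arbitrary assignment does no
    harm.\<close>
  proof (cases "\<exists>X. X \<subset> A \<and> X \<noteq> {} \<and> card (\<Union>(R ` X)) = card X")
    case True
    then obtain X where X: "X \<subset> A" "X \<noteq> {}" "card (\<Union>(R ` X)) = card X" by blast
    have finX: "finite X" using X(1) less.prems(1) finite_subset by blast
    define R' where "R' a = R a - \<Union>(R ` X)" for a
    have "card X < card A" using X(1) less.prems(1) by (simp add: psubset_card_mono)
    hence "\<exists>f. inj_on f X \<and> (\<forall>a\<in>X. f a \<in> R a)"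
      using X(1) finX by (intro IH prems2 prems3) auto
    then obtain f where f: "inj_on f X" "\<forall>a\<in>X. f a \<in> R a" by blast
    have "card (A - X) < card A"
      using X less.prems(1) by (intro psubset_card_mono) auto
    moreover have "card Y \<le> card (\<Union>(R' ` Y))" if Y: "Y \<subseteq> A - X" for Y
    proof -
      have finY: "finite Y" using Y less.prems(1) by (meson finite_Diff finite_subset)
      have fU: "finite (\<Union>(R ` Z))" if "Z \<subseteq> A" for Z
        using that less.prems(1) prems2 by (intro finite_UN_I) (auto intro: finite_subset)
      \<comment> \<open>Hall's condition for \<open>X \<union> Y\<close>, from which the equality
        for the tight set \<open>X\<close> is subtracted.\<close>
      have "card X + card Y = card (X \<union> Y)"
        using Y finX finY by (subst card_Un_disjoint) auto
      also have "\<dots> \<le> card (\<Union>(R ` (X \<union> Y)))" using Y X(1) by (intro prems3) auto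
      also have "\<Union>(R ` (X \<union> Y)) = \<Union>(R ` X) \<union> \<Union>(R' ` Y)" by (auto simp: R'_def)
      also have "card \<dots> \<le> card (\<Union>(R ` X)) + card (\<Union>(R' ` Y))" by (rule card_Un_le)
      finally show ?thesis using X(3) by simp
    qed
    moreover have "finite (R' a)" if "a \<in> A - X" for a using that prems2 by (auto simp: R'_def)
    ultimately have "\<exists>g. inj_on g (A - X) \<and> (\<forall>a\<in>A - X. g a \<in> R' a)"
      using less.prems(1) by (intro IH) auto
    then obtain g where g: "inj_on g (A - X)" "\<forall>a\<in>A - X. g a \<in> R' a" by blast
    define h where "h a = (if a \<in> X then f a else g a)" for a
    have "inj_on h A"
    proof (rule inj_onI)
      fix a b assume ab: "a \<in> A" "b \<in> A" "h a = h b"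
      show "a = b"
      proof (cases "a \<in> X"; cases "b \<in> X")
        assume "a \<in> X" "b \<in> X" thus ?thesis using ab f(1) by (auto simp: h_def inj_on_def)
      next
        assume "a \<in> X" "b \<notin> X"
        moreover from this have "f a = g b" using ab(3) by (simp add: h_def)
        moreover have "g b \<in> R' b" "f a \<in> R a" using f(2) g(2) ab(2) calculation(1,2) by blast+
        ultimately have False by (auto simp: R'_def)
        thus ?thesis by simp
      next
        assume "a \<notin> X" "b \<in> X"
        moreover from this have "g a = f b" using ab(3) by (simp add: h_def)
        moreover have "g a \<in> R' a" "f b \<in> R b" using f(2) g(2) ab(1) calculation(1,2) by blast+
        ultimately have False by (auto simp: R'_def)
        thus ?thesis by simp
      next
        assume "a \<notin> X" "b \<notin> X" thus ?thesis using ab g(1) by (auto simp: h_def inj_on_def)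
      qed
    qed
    moreover have "\<forall>a\<in>A. h a \<in> R a" using f(2) g(2) by (auto simp: h_def R'_def)
    ultimately show ?thesis by blast
  next
    case False
    show ?thesis
    proof (cases "A = {}")
      case True thus ?thesis by auto
    next
      case False2: False
      then obtain a where a: "a \<in> A" by blast
      have "card {a} \<le> card (\<Union>(R ` {a}))" using a by (intro prems3) auto
      hence "R a \<noteq> {}" by auto
      then obtain b where b: "b \<in> R a" by blast
      define R' where "R' x = R x - {b}" for x
      have 1: "card Y \<le> card (\<Union>(R' ` Y))" if Y: "Y \<subseteq> A - {a}" for Y
      proof (cases "Y = {}")
        case ne: False
        have "Y \<subset> A" using Y a by auto
        hence "card (\<Union>(R ` Y)) \<noteq> card Y" using False ne by blast
        moreover have "card Y \<le> card (\<Union>(R ` Y))" using Y by (intro prems3) auto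
        ultimately have "card Y < card (\<Union>(R ` Y))" by simp
        moreover have "card U - 1 \<le> card (U - {b})" for U
          by (cases "b \<in> U") (simp_all add: card_Diff_singleton)
        note this[of "\<Union>(R ` Y)"]
        moreover have "\<Union>(R' ` Y) = \<Union>(R ` Y) - {b}" by (auto simp: R'_def)
        ultimately show ?thesis by simp
      qed simp
      have 2: "card (A - {a}) < card A" using a less.prems(1) by (intro psubset_card_mono) auto
      have 3: "finite (R' x)" if "x \<in> A - {a}" for x using that prems2 by (auto simp: R'_def)
      have "\<exists>g. inj_on g (A - {a}) \<and> (\<forall>x\<in>A - {a}. g x \<in> R' x)"
        using less.prems(1) by (intro IH 1 2 3 finite_Diff)
      then obtain g where g: "inj_on g (A - {a})" "\<forall>x\<in>A - {a}. g x \<in> R' x" by blast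
      have "inj_on (g(a := b)) A" using g by (auto simp: inj_on_def R'_def)
      moreover have "\<forall>x\<in>A. (g(a := b)) x \<in> R x" using g(2) b by (auto simp: R'_def)
      ultimately show ?thesis by blast
    qed
  qed
qed

text \<open>The topology is that of \<open>d\<close> itself; the given topology is identified with
  it once, when the final theorem interprets this locale.\<close>

locale bi_invariant_group = group G + Metric_space "carrier G" d
  for G (structure) and d :: "'a \<Rightarrow> 'a \<Rightarrow> real" +
  assumes left_invariant:
      "\<lbrakk>g \<in> carrier G; x \<in> carrier G; y \<in> carrier G\<rbrakk> \<Longrightarrow> d (g \<otimes> x) (g \<otimes> y) = d x y"
    and right_invariant:
      "\<lbrakk>g \<in> carrier G; x \<in> carrier G; y \<in> carrier G\<rbrakk> \<Longrightarrow> d (x \<otimes> g) (y \<otimes> g) = d x y"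
    and compact: "compact_space mtopology"
begin

text \<open>Multiplying both arguments by \<open>x\<close> on the left and by \<open>y\<close> on
  the right turns the pair of inverses into \<open>y\<close>, \<open>x\<close>.\<close>

lemma inv_invariant:
  assumes "x \<in> carrier G" "y \<in> carrier G"
  shows "d (inv x) (inv y) = d x y"
proof -
  have "d (inv x) (inv y) = d (x \<otimes> inv x) (x \<otimes> inv y)"
    using assms left_invariant[of x "inv x" "inv y"] by (simp del: r_inv Units_r_inv)
  also have "\<dots> = d (\<one> \<otimes> y) (x \<otimes> inv y \<otimes> y)"
    using assms right_invariant[of y "\<one>" "x \<otimes> inv y"] by simp
  also have "\<dots> = d y x" using assms by (simp add: m_assoc[of x "inv y" y])
  finally show ?thesis using assms by (simp add: commute)
qed

lemma finite_net:
  assumes "\<delta> > 0"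
  shows "\<exists>F. finite F \<and> F \<subseteq> carrier G \<and> (\<forall>x\<in>carrier G. \<exists>y\<in>F. d y x < \<delta>)"
proof -
  have "compactin mtopology (carrier G)" using compact by (simp add: compact_space_def)
  hence "mtotally_bounded (carrier G)" by (rule compactin_imp_mtotally_bounded)
  hence "\<exists>F. finite F \<and> F \<subseteq> carrier G \<and> carrier G \<subseteq> (\<Union>x\<in>F. mball x \<delta>)"
    using assms unfolding mtotally_bounded_def by simp
  then obtain F where F: "finite F" "F \<subseteq> carrier G" "carrier G \<subseteq> (\<Union>x\<in>F. mball x \<delta>)" by auto
  have "\<exists>y\<in>F. d y x < \<delta>" if "x \<in> carrier G" for x
  proof -
    have "x \<in> (\<Union>x\<in>F. mball x \<delta>)" using F(3) that by (rule subsetD)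
    thus ?thesis by auto
  qed
  thus ?thesis using F(1,2) by blast
qed

text \<open>A net of minimal cardinality satisfies the marriage condition against each of its
  translates, so that averages over it are nearly translation invariant.\<close>
lemma nearly_invariant_net:
  assumes "\<delta> > 0"
  shows "\<exists>F. finite F \<and> F \<noteq> {} \<and> F \<subseteq> carrier G \<and>
    (\<forall>g\<in>carrier G. \<exists>\<pi>. bij_betw \<pi> F F \<and> (\<forall>x\<in>F. d (x \<otimes> g) (\<pi> x) \<le> \<delta>))"
proof -
  \<comment> \<open>Half of \<open>\<delta>\<close>, because two points close to a common third
    point must come within \<open>\<delta>\<close> of each other.\<close>
  define net where
    "net F \<longleftrightarrow> finite F \<and> F \<subseteq> carrier G \<and> (\<forall>x\<in>carrier G. \<exists>y\<in>F. d y x < \<delta> / 2)" for F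
  have "\<exists>F. net F" using finite_net[of "\<delta> / 2"] assms by (auto simp: net_def)
  then obtain F where F: "net F" and Fmin: "\<And>F'. net F' \<Longrightarrow> card F \<le> card F'"
    using ex_has_least_nat[of net _ card] by blast
  have fin: "finite F" and sub: "F \<subseteq> carrier G"
    and cov: "\<And>x. x \<in> carrier G \<Longrightarrow> \<exists>y\<in>F. d y x < \<delta> / 2" using F by (auto simp: net_def)
  have "\<exists>\<pi>. bij_betw \<pi> F F \<and> (\<forall>x\<in>F. d (x \<otimes> g) (\<pi> x) \<le> \<delta>)" if g: "g \<in> carrier G" for g
  proof -
    define R where "R x = {y \<in> F. d (x \<otimes> g) y \<le> \<delta>}" for x
    have "card X \<le> card (\<Union>(R ` X))" if X: "X \<subseteq> F" for X
    proof -
      \<comment> \<open>The translated net, with the translates of \<open>X\<close> exchanged for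
        all their admissible partners in \<open>F\<close>. It is again a net, so fewer than
        \<open>card X\<close> partners would contradict the minimality of \<open>F\<close>.\<close>
      define Z where "Z = (\<lambda>x. x \<otimes> g) ` (F - X) \<union> \<Union>(R ` X)"
      have finX: "finite X" using X fin finite_subset by blast
      have "net Z"
        unfolding net_def
      proof (intro conjI ballI)
        show "finite Z" using fin finX by (auto simp: Z_def R_def)
        show "Z \<subseteq> carrier G" using sub g by (auto simp: Z_def R_def)
        fix z assume z: "z \<in> carrier G"
        obtain x where x: "x \<in> F" "d x (z \<otimes> inv g) < \<delta> / 2" using cov[of "z \<otimes> inv g"] z g by auto
        have "d (x \<otimes> g) (z \<otimes> inv g \<otimes> g) < \<delta> / 2"
          using x z g sub right_invariant[of g x "z \<otimes> inv g"] by auto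
        hence xz: "d (x \<otimes> g) z < \<delta> / 2" using z g by (simp add: m_assoc)
        show "\<exists>y\<in>Z. d y z < \<delta> / 2"
        proof (cases "x \<in> X")
          case True
          obtain y where y: "y \<in> F" "d y z < \<delta> / 2" using cov z by blast
          have "d (x \<otimes> g) y \<le> d (x \<otimes> g) z + d z y"
            using x y z g sub by (intro triangle) auto
          hence "y \<in> R x" using xz y by (auto simp: R_def commute)
          thus ?thesis using True y by (auto simp: Z_def)
        next
          case False thus ?thesis using x xz by (auto simp: Z_def)
        qed
      qed
      hence "card F \<le> card Z" by (rule Fmin)
      also have "\<dots> \<le> card ((\<lambda>x. x \<otimes> g) ` (F - X)) + card (\<Union>(R ` X))"
        unfolding Z_def by (rule card_Un_le)
      also have "card ((\<lambda>x. x \<otimes> g) ` (F - X)) \<le> card (F - X)" using fin by (intro card_image_le) auto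
      also have "card (F - X) = card F - card X" using X finX by (simp add: card_Diff_subset)
      finally show ?thesis using card_mono[OF fin X] by linarith
    qed
    moreover have "finite (R x)" for x using fin by (auto simp: R_def)
    ultimately have "\<exists>f. inj_on f F \<and> (\<forall>a\<in>F. f a \<in> R a)"
      using fin by (intro hall_marriage) simp_all
    then obtain f where f: "inj_on f F" "\<forall>a\<in>F. f a \<in> R a" by blast
    note f(1)
    moreover have "f ` F \<subseteq> F" using f(2) by (auto simp: R_def)
    ultimately have "bij_betw f F F"
      using endo_inj_surj[OF fin] by (auto simp: bij_betw_def)
    thus ?thesis using f(2) by (auto simp: R_def)
  qed
  moreover have "F \<noteq> {}" using cov[of "\<one>"] by auto
  ultimately show ?thesis using fin sub by (intro exI[of _ F] conjI ballI) simp_all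
qed

end

section \<open>The spectral theorem for finite Hermitian matrices\<close>

text \<open>Vectors are functions whose values off the index set are ignored: the index set
  \<open>F \<times> {..<N}\<close> of the discrete model varies with the net, and eigenvectors are
  later evaluated by pairs. The product is conjugate linear in the first argument.\<close>

definition ip :: "'j set \<Rightarrow> ('j \<Rightarrow> complex) \<Rightarrow> ('j \<Rightarrow> complex) \<Rightarrow> complex" where
  "ip J f g = (\<Sum>j\<in>J. cnj (f j) * g j)"

definition nrm :: "'j set \<Rightarrow> ('j \<Rightarrow> complex) \<Rightarrow> real" where
  "nrm J f = L2_set (\<lambda>j. cmod (f j)) J"

definition orthonormal :: "'j set \<Rightarrow> 'i set \<Rightarrow> ('i \<Rightarrow> 'j \<Rightarrow> complex) \<Rightarrow> bool" where
  "orthonormal J I e \<longleftrightarrow> (\<forall>i\<in>I. \<forall>k\<in>I. ip J (e i) (e k) = of_bool (i = k))"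

text \<open>Completeness is the resolution of the identity, the sum of all e e^* being the unit
  matrix on \<open>J\<close>. This yields expansions and Parseval directly, without a notion of
  span.\<close>

definition orthonormal_basis :: "'j set \<Rightarrow> ('j \<Rightarrow> complex) set \<Rightarrow> bool" where
  "orthonormal_basis J E \<longleftrightarrow> finite E \<and> orthonormal J E (\<lambda>e. e) \<and>
     (\<forall>j\<in>J. \<forall>k\<in>J. (\<Sum>e\<in>E. e j * cnj (e k)) = of_bool (j = k))"

lemma cnj_mult_self: "cnj z * z = (complex_of_real (cmod z))\<^sup>2" "z * cnj z = (complex_of_real (cmod z))\<^sup>2"
  using complex_norm_square[of z] by (simp_all add: mult.commute)

lemma nrm_nonneg [simp]: "nrm J f \<ge> 0"
  by (simp add: nrm_def)

lemma nrm_power2: "(nrm J f)\<^sup>2 = (\<Sum>j\<in>J. (cmod (f j))\<^sup>2)"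
  by (simp add: nrm_def L2_set_def sum_nonneg)

lemma ip_self: "ip J f f = complex_of_real ((nrm J f)\<^sup>2)"
  by (simp add: ip_def nrm_power2 cnj_mult_self)

lemma cnj_ip: "cnj (ip J f g) = ip J g f"
  by (simp add: ip_def mult.commute)

lemma ip_cong: "(\<And>j. j \<in> J \<Longrightarrow> f j = f' j) \<Longrightarrow> (\<And>j. j \<in> J \<Longrightarrow> g j = g' j) \<Longrightarrow> ip J f g = ip J f' g'"
  unfolding ip_def by (intro sum.cong) auto

lemma nrm_cong: "(\<And>j. j \<in> J \<Longrightarrow> f j = f' j) \<Longrightarrow> nrm J f = nrm J f'"
  unfolding nrm_def by (intro L2_set_cong) auto

lemma ip_add_right: "ip J f (\<lambda>j. g j + h j) = ip J f g + ip J f h"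
  by (simp add: ip_def sum.distrib ring_distribs)

lemma ip_diff_right: "ip J f (\<lambda>j. g j - h j) = ip J f g - ip J f h"
  by (simp add: ip_def sum_subtractf ring_distribs)

lemma ip_scale_right: "ip J f (\<lambda>j. c * g j) = c * ip J f g"
  by (simp add: ip_def sum_distrib_left mult_ac)

lemma ip_sum_right: "ip J f (\<lambda>j. \<Sum>i\<in>I. g i j) = (\<Sum>i\<in>I. ip J f (g i))"
  unfolding ip_def by (simp add: sum_distrib_left) (rule sum.swap)

lemma ip_add_left: "ip J (\<lambda>j. g j + h j) f = ip J g f + ip J h f"
  by (simp add: ip_def sum.distrib ring_distribs)

lemma ip_diff_left: "ip J (\<lambda>j. g j - h j) f = ip J g f - ip J h f"
  by (simp add: ip_def sum_subtractf ring_distribs)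

lemma ip_scale_left: "ip J (\<lambda>j. c * g j) f = cnj c * ip J g f"
  by (simp add: ip_def sum_distrib_left mult_ac)

lemma ip_sum_left: "ip J (\<lambda>j. \<Sum>i\<in>I. g i j) f = (\<Sum>i\<in>I. ip J (g i) f)"
  unfolding ip_def by (simp add: sum_distrib_right) (rule sum.swap)

lemma nrm_scale: "nrm J (\<lambda>j. c * f j) = cmod c * nrm J f"
  by (simp add: nrm_def norm_mult L2_set_right_distrib)

lemma nrm_triangle: "nrm J (\<lambda>j. f j + g j) \<le> nrm J f + nrm J g"
proof -
  have "nrm J (\<lambda>j. f j + g j) \<le> L2_set (\<lambda>j. cmod (f j) + cmod (g j)) J"
    unfolding nrm_def by (intro L2_set_mono) (auto intro: norm_triangle_ineq)
  also have "\<dots> \<le> nrm J f + nrm J g" unfolding nrm_def by (rule L2_set_triangle_ineq)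
  finally show ?thesis .
qed

lemma nrm_diff_commute: "nrm J (\<lambda>j. f j - g j) = nrm J (\<lambda>j. g j - f j)"
  by (simp add: nrm_def norm_minus_commute)

lemma nrm_diff_triangle: "nrm J (\<lambda>j. f j - h j) \<le> nrm J (\<lambda>j. f j - g j) + nrm J (\<lambda>j. g j - h j)"
  using nrm_triangle[of J "\<lambda>j. f j - g j" "\<lambda>j. g j - h j"] by simp

lemma nrm_sum: "nrm J (\<lambda>j. \<Sum>i\<in>I. f i j) \<le> (\<Sum>i\<in>I. nrm J (f i))"
proof (induction I rule: infinite_finite_induct)
  case (insert i I)
  thus ?case using nrm_triangle[of J "f i" "\<lambda>j. \<Sum>i\<in>I. f i j"] by simp
qed (simp_all add: nrm_def L2_set_0')

lemma cauchy_schwarz: "cmod (ip J f g) \<le> nrm J f * nrm J g"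
proof -
  have "cmod (ip J f g) \<le> (\<Sum>j\<in>J. \<bar>cmod (f j)\<bar> * \<bar>cmod (g j)\<bar>)"
    unfolding ip_def by (rule sum_norm_le) (simp add: norm_mult)
  also have "\<dots> \<le> nrm J f * nrm J g" unfolding nrm_def by (rule L2_set_mult_ineq)
  finally show ?thesis .
qed

lemma nrm_eq_0: "finite J \<Longrightarrow> nrm J f = 0 \<longleftrightarrow> (\<forall>j\<in>J. f j = 0)"
  by (simp add: nrm_def L2_set_eq_0_iff)

text \<open>With P the projection onto the span of \<open>e\<close>, both <P f, f> and <P f, P f>
  equal |P f|^2. The case c = 1 gives Bessel's inequality and the norm of a remainder; c an
  eigenvalue is what \<open>spectral_comparison\<close> needs.\<close>

lemma bessel_identity:
  assumes "finite I" "orthonormal J I e"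
  shows "(nrm J (\<lambda>j. complex_of_real c * f j - (\<Sum>i\<in>I. ip J (e i) f * e i j)))\<^sup>2
    = c\<^sup>2 * (nrm J f)\<^sup>2 + (1 - 2 * c) * (\<Sum>i\<in>I. (cmod (ip J (e i) f))\<^sup>2)"
proof -
  define t where "t = (\<Sum>i\<in>I. (cmod (ip J (e i) f))\<^sup>2)"
  define p where "p j = (\<Sum>i\<in>I. ip J (e i) f * e i j)" for j
  have 1: "ip J (e k) p = ip J (e k) f" if "k \<in> I" for k
    using assms that
    by (simp add: p_def[abs_def] ip_sum_right ip_scale_right orthonormal_def of_bool_def
        if_distrib[of "\<lambda>x. _ * x"] sum.delta' cong: if_cong)
  have 2: "ip J p f = t"
    by (simp add: p_def[abs_def] t_def ip_sum_left ip_scale_left cnj_mult_self)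
  have "ip J p p = (\<Sum>i\<in>I. cnj (ip J (e i) f) * ip J (e i) p)"
    by (subst (1) p_def[abs_def]) (simp add: ip_sum_left ip_scale_left)
  also have "\<dots> = t"
    by (simp add: t_def 1 cnj_mult_self)
  finally have 3: "ip J p p = t" .
  have 4: "ip J f p = t"
    using arg_cong[OF 2, of cnj] by (simp add: cnj_ip)
  have "complex_of_real ((nrm J (\<lambda>j. of_real c * f j - p j))\<^sup>2) =
      complex_of_real (c\<^sup>2 * (nrm J f)\<^sup>2 + (1 - 2 * c) * t)"
    unfolding ip_self[symmetric] ip_diff_right ip_diff_left ip_scale_left ip_scale_right
    by (simp add: 2 3 4) (simp add: ip_self power2_eq_square algebra_simps)
  thus ?thesis unfolding p_def t_def of_real_eq_iff .
qed

lemma bessel_inequality: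
  assumes "finite I" "orthonormal J I e"
  shows "(\<Sum>i\<in>I. (cmod (ip J (e i) f))\<^sup>2) \<le> (nrm J f)\<^sup>2"
proof -
  have "0 \<le> (nrm J (\<lambda>j. complex_of_real 1 * f j - (\<Sum>i\<in>I. ip J (e i) f * e i j)))\<^sup>2"
    by (rule zero_le_power2)
  thus ?thesis unfolding bessel_identity[OF assms] by simp
qed

lemma basis_expand:
  assumes "finite J" "orthonormal_basis J E" "j \<in> J"
  shows "(\<Sum>e\<in>E. ip J e f * e j) = f j"
proof -
  have "(\<Sum>e\<in>E. ip J e f * e j) = (\<Sum>e\<in>E. \<Sum>k\<in>J. f k * (e j * cnj (e k)))"
    by (simp add: ip_def sum_distrib_right sum_distrib_left mult_ac)
  also have "\<dots> = (\<Sum>k\<in>J. f k * (\<Sum>e\<in>E. e j * cnj (e k)))"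
    by (subst sum.swap) (simp add: sum_distrib_left)
  also have "\<dots> = (\<Sum>k\<in>J. f k * of_bool (j = k))"
    using assms by (intro sum.cong) (auto simp: orthonormal_basis_def)
  also have "\<dots> = f j" using assms by (simp add: of_bool_def if_distrib[of "\<lambda>x. _ * x"] cong: if_cong)
  finally show ?thesis .
qed

lemma parseval_ip:
  assumes "finite J" "orthonormal_basis J E"
  shows "ip J f g = (\<Sum>e\<in>E. cnj (ip J e f) * ip J e g)"
proof -
  have "ip J f g = ip J (\<lambda>j. \<Sum>e\<in>E. ip J e f * e j) g"
    using basis_expand[OF assms] by (intro ip_cong) auto
  thus ?thesis by (simp add: ip_sum_left ip_scale_left)
qed

lemma parseval:
  assumes "finite J" "orthonormal_basis J E"
  shows "(nrm J f)\<^sup>2 = (\<Sum>e\<in>E. (cmod (ip J e f))\<^sup>2)"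
proof -
  have "complex_of_real ((nrm J f)\<^sup>2) = complex_of_real (\<Sum>e\<in>E. (cmod (ip J e f))\<^sup>2)"
    unfolding ip_self[symmetric] parseval_ip[OF assms, of f f]
    by (simp add: cnj_mult_self)
  thus ?thesis unfolding of_real_eq_iff .
qed

definition mv :: "'j set \<Rightarrow> ('j \<Rightarrow> 'j \<Rightarrow> complex) \<Rightarrow> ('j \<Rightarrow> complex) \<Rightarrow> 'j \<Rightarrow> complex" where
  "mv J A f j = (\<Sum>k\<in>J. A j k * f k)"

definition hermitian_on :: "'j set \<Rightarrow> ('j \<Rightarrow> 'j \<Rightarrow> complex) \<Rightarrow> bool" where
  "hermitian_on J A \<longleftrightarrow> (\<forall>j\<in>J. \<forall>k\<in>J. A k j = cnj (A j k))"

lemma ip_mv: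
  assumes "hermitian_on J A"
  shows "ip J (mv J A f) g = ip J f (mv J A g)"
proof -
  have "ip J (mv J A f) g = (\<Sum>j\<in>J. \<Sum>k\<in>J. cnj (A j k) * cnj (f k) * g j)"
    by (simp add: ip_def mv_def sum_distrib_right)
  also have "\<dots> = (\<Sum>k\<in>J. \<Sum>j\<in>J. cnj (A j k) * cnj (f k) * g j)" by (rule sum.swap)
  also have "\<dots> = (\<Sum>k\<in>J. \<Sum>j\<in>J. cnj (f k) * (A k j * g j))"
  proof (intro sum.cong refl)
    fix k j assume "k \<in> J" "j \<in> J"
    hence "cnj (A j k) = A k j" using assms unfolding hermitian_on_def by metis
    thus "cnj (A j k) * cnj (f k) * g j = cnj (f k) * (A k j * g j)" by (simp only: mult_ac)
  qed
  also have "\<dots> = ip J f (mv J A g)" by (simp add: ip_def mv_def sum_distrib_left)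
  finally show ?thesis .
qed

lemma mv_add_scale: "mv J A (\<lambda>j. f j + c * g j) = (\<lambda>j. mv J A f j + c * mv J A g j)"
  by (simp add: mv_def fun_eq_iff ring_distribs sum.distrib sum_distrib_left mult_ac)

text \<open>Vanishing off \<open>J\<close> places the set inside a product of discs and points,
  compact by Tychonoff. Each constraint involves only finitely many coordinates, so it is closed in
  the product topology.\<close>

lemma compact_sphere_fun:
  assumes "finite J"
  shows "compact {v :: 'j \<Rightarrow> complex. (\<forall>j. j \<notin> J \<longrightarrow> v j = 0) \<and> nrm J v = 1 \<and> (\<forall>f\<in>E. ip J f v = 0)}"
    (is "compact ?S")
proof -
  define B :: "'j \<Rightarrow> complex set" where "B j = (if j \<in> J then cball 0 1 else {0})" for j
  have "compactin (product_topology (\<lambda>_. euclidean) UNIV) (PiE UNIV B)"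
    by (subst compactin_PiE) (auto simp: B_def)
  hence "compact (PiE UNIV B)" by (simp add: euclidean_product_topology)
  moreover have "closed ?S"
  proof -
    have "closed {v :: 'j \<Rightarrow> complex. v j = 0}" for j
      by (intro closed_Collect_eq continuous_intros continuous_on_product_coordinates)
    hence "closed {v :: 'j \<Rightarrow> complex. j \<notin> J \<longrightarrow> v j = 0}" for j by (cases "j \<in> J") auto
    hence "closed {v :: 'j \<Rightarrow> complex. \<forall>j. j \<notin> J \<longrightarrow> v j = 0}" by (rule closed_Collect_all)
    moreover have "closed {v :: 'j \<Rightarrow> complex. nrm J v = 1}"
      unfolding nrm_def L2_set_def
      by (intro closed_Collect_eq continuous_intros continuous_on_product_coordinates)
    moreover have "closed {v :: 'j \<Rightarrow> complex. ip J f v = 0}" for f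
      unfolding ip_def
      by (intro closed_Collect_eq continuous_intros continuous_on_product_coordinates)
    hence "closed {v :: 'j \<Rightarrow> complex. f \<in> E \<longrightarrow> ip J f v = 0}" for f by (cases "f \<in> E") auto
    hence "closed {v :: 'j \<Rightarrow> complex. \<forall>f. f \<in> E \<longrightarrow> ip J f v = 0}" by (rule closed_Collect_all)
    ultimately show ?thesis unfolding Ball_def by (intro closed_Collect_conj)
  qed
  moreover have "?S \<subseteq> PiE UNIV B"
  proof
    fix v assume v: "v \<in> ?S"
    have "v j \<in> B j" for j
    proof (cases "j \<in> J")
      case True
      hence "cmod (v j) \<le> nrm J v" unfolding nrm_def using assms by (intro member_le_L2_set)
      thus ?thesis using True v by (simp add: B_def)
    qed (use v in \<open>auto simp: B_def\<close>)
    thus "v \<in> PiE UNIV B" by (simp add: PiE_def extensional_def)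
  qed
  ultimately have "compact (PiE UNIV B \<inter> ?S)" by (intro compact_Int_closed)
  also have "PiE UNIV B \<inter> ?S = ?S" using \<open>?S \<subseteq> PiE UNIV B\<close> by (rule inf_absorb2)
  finally show ?thesis .
qed

text \<open>A maximiser of the Rayleigh quotient on the orthogonal complement of eigenvectors
  already found is a further eigenvector.\<close>
lemma hermitian_eigenvector:
  assumes fin: "finite J" and herm: "hermitian_on J A"
    and E: "\<And>f. f \<in> E \<Longrightarrow> \<exists>l::real. \<forall>j\<in>J. mv J A f j = l * f j"
    and u: "\<And>f. f \<in> E \<Longrightarrow> ip J f u = 0" "nrm J u \<noteq> 0"
  shows "\<exists>v (l::real). (\<forall>f\<in>E. ip J f v = 0) \<and> nrm J v = 1 \<and> (\<forall>j\<in>J. mv J A v j = l * v j)"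
proof -
  define S where
    "S = {v :: 'a \<Rightarrow> complex. (\<forall>j. j \<notin> J \<longrightarrow> v j = 0) \<and> nrm J v = 1 \<and> (\<forall>f\<in>E. ip J f v = 0)}"
  define q where "q v = Re (ip J v (mv J A v))" for v
  \<comment> \<open>Besides scaling, this clears the values off \<open>J\<close> to reach the
    compact set \<open>S\<close>; \<open>q\<close> does not see those values.\<close>
  define normalise where "normalise w = (\<lambda>j. of_real (1 / nrm J w) * (if j \<in> J then w j else 0))" for w
  have norm_S: "normalise w \<in> S" if "\<And>f. f \<in> E \<Longrightarrow> ip J f w = 0" "nrm J w \<noteq> 0" for w
  proof -
    have "nrm J (normalise w) = cmod (of_real (1 / nrm J w)) * nrm J (\<lambda>j. if j \<in> J then w j else 0)"
      unfolding normalise_def by (rule nrm_scale)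
    also have "nrm J (\<lambda>j. if j \<in> J then w j else 0) = nrm J w" by (rule nrm_cong) simp
    finally have 1: "nrm J (normalise w) = 1" using that(2) by (simp add: norm_divide)
    have "ip J f (normalise w) = 0" if "f \<in> E" for f
    proof -
      have "ip J f (\<lambda>j. if j \<in> J then w j else 0) = ip J f w" by (rule ip_cong) simp_all
      thus ?thesis
        unfolding normalise_def ip_scale_right using that \<open>\<And>f. f \<in> E \<Longrightarrow> ip J f w = 0\<close> by simp
    qed
    thus ?thesis using 1 by (auto simp: S_def normalise_def)
  qed
  have q_norm: "q w = (nrm J w)\<^sup>2 * q (normalise w)" if "nrm J w \<noteq> 0" for w
  proof -
    have "q w = q (\<lambda>j. of_real (nrm J w) * normalise w j)"
      unfolding q_def using that
      by (intro arg_cong[of _ _ Re] ip_cong) (auto simp: normalise_def mv_def intro!: sum.cong)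
    also have "mv J A (\<lambda>j. of_real (nrm J w) * normalise w j) = (\<lambda>j. of_real (nrm J w) * mv J A (normalise w) j)"
      by (simp add: mv_def fun_eq_iff sum_distrib_left mult_ac)
    hence "q (\<lambda>j. of_real (nrm J w) * normalise w j) = (nrm J w)\<^sup>2 * q (normalise w)"
      unfolding q_def by (simp add: ip_scale_left ip_scale_right power2_eq_square)
    finally show ?thesis .
  qed
  have "compact S" unfolding S_def using fin by (rule compact_sphere_fun)
  moreover have "S \<noteq> {}" using norm_S u by blast
  moreover have "continuous_on S q"
    unfolding q_def ip_def mv_def
    by (intro continuous_intros continuous_on_subset[OF continuous_on_product_coordinates subset_UNIV])
  ultimately obtain v where v: "v \<in> S" and max: "\<And>w. w \<in> S \<Longrightarrow> q w \<le> q v"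
    using continuous_attains_sup by metis
  define l where "l = q v"
  have qle: "q w \<le> l * (nrm J w)\<^sup>2" if "\<And>f. f \<in> E \<Longrightarrow> ip J f w = 0" for w
  proof (cases "nrm J w = 0")
    case True
    hence "\<forall>j\<in>J. w j = 0" using fin by (simp add: nrm_eq_0)
    hence "q w = 0" by (simp add: q_def ip_def)
    thus ?thesis using True by simp
  next
    case False
    have "q (normalise w) \<le> l" unfolding l_def using that False by (intro max norm_S)
    thus ?thesis using q_norm[OF False] mult_right_mono[of _ l "(nrm J w)\<^sup>2"] by (simp add: mult.commute)
  qed
  define w where "w j = mv J A v j - of_real l * v j" for j
  have vE: "ip J f v = 0" if "f \<in> E" for f using v that by (simp add: S_def)
  have vv: "ip J v v = 1" using v by (simp add: ip_self S_def)
  have wE: "ip J f w = 0" if "f \<in> E" for f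
  proof -
    obtain a :: real where a: "\<forall>j\<in>J. mv J A f j = a * f j" using E \<open>f \<in> E\<close> by blast
    have "ip J f (mv J A v) = ip J (mv J A f) v" by (simp add: ip_mv[OF herm])
    also have "\<dots> = ip J (\<lambda>j. a * f j) v" using a by (intro ip_cong) auto
    also have "\<dots> = 0" using vE that by (simp add: ip_scale_left)
    finally show ?thesis using vE that by (simp add: w_def[abs_def] ip_diff_right ip_scale_right)
  qed
  have "cnj (ip J v (mv J A v)) = ip J v (mv J A v)" by (simp add: cnj_ip ip_mv[OF herm])
  hence "ip J v (mv J A v) = of_real l" by (simp add: l_def q_def complex_eq_iff)
  hence vw: "ip J v w = 0" by (simp add: w_def[abs_def] ip_diff_right ip_scale_right vv)
  hence wv: "ip J w v = 0" using cnj_ip[of J v w] by simp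
  have "mv J A v = (\<lambda>j. w j + of_real l * v j)" by (simp add: w_def)
  hence wAv: "ip J w (mv J A v) = ip J w w" by (simp add: ip_add_right ip_scale_right wv)
  have vAw: "ip J v (mv J A w) = ip J w w"
    using arg_cong[OF wAv, of cnj] by (simp add: cnj_ip ip_mv[OF herm])
  \<comment> \<open>The Rayleigh quotient is tested at \<open>v + t w\<close>, where
    \<open>w\<close> is the residual of the eigenvalue equation. Since <w, A v> = |w|^2, it gains 2
    t |w|^2 to first order, and maximality leaves only terms in t^2 to compensate.\<close>
  have key: "2 * t * (nrm J w)\<^sup>2 + t\<^sup>2 * q w \<le> l * t\<^sup>2 * (nrm J w)\<^sup>2" for t :: real
  proof -
    have "q (\<lambda>j. v j + of_real t * w j) \<le> l * (nrm J (\<lambda>j. v j + of_real t * w j))\<^sup>2"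
      using vE wE by (intro qle) (simp add: ip_add_right ip_scale_right)
    moreover have "q (\<lambda>j. v j + of_real t * w j) = l + 2 * t * (nrm J w)\<^sup>2 + t\<^sup>2 * q w"
      unfolding q_def mv_add_scale
      by (simp add: ip_add_right ip_add_left ip_scale_right ip_scale_left wAv vAw ip_self l_def q_def
          algebra_simps power2_eq_square)
    moreover have "complex_of_real ((nrm J (\<lambda>j. v j + of_real t * w j))\<^sup>2) = of_real (1 + t\<^sup>2 * (nrm J w)\<^sup>2)"
      unfolding ip_self[symmetric]
      by (simp add: ip_add_right ip_add_left ip_scale_right ip_scale_left wv vw vv ip_self[of J w] power2_eq_square)
    hence "(nrm J (\<lambda>j. v j + of_real t * w j))\<^sup>2 = 1 + t\<^sup>2 * (nrm J w)\<^sup>2" unfolding of_real_eq_iff .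
    ultimately show ?thesis by (simp add: algebra_simps)
  qed
  have "nrm J w = 0"
  proof (rule ccontr)
    assume "nrm J w \<noteq> 0"
    hence s: "(nrm J w)\<^sup>2 > 0" by simp
    \<comment> \<open>Any positive bound for the coefficient of t^2 would do; the summand 1 makes it
      positive. With t = |w|^2 / c the inequality becomes 2 |w|^2 <= |w|^2.\<close>
    define c where "c = \<bar>l * (nrm J w)\<^sup>2 - q w\<bar> + 1"
    define t where "t = (nrm J w)\<^sup>2 / c"
    have c: "c > 0" "l * (nrm J w)\<^sup>2 - q w \<le> c" by (auto simp: c_def)
    have t: "t > 0" using s c by (simp add: t_def)
    have "t * (2 * (nrm J w)\<^sup>2) \<le> t * (t * (l * (nrm J w)\<^sup>2 - q w))"
      using key[of t] by (simp add: algebra_simps power2_eq_square)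
    hence "2 * (nrm J w)\<^sup>2 \<le> t * (l * (nrm J w)\<^sup>2 - q w)" using t by simp
    also have "\<dots> \<le> t * c" using t c by (intro mult_left_mono) auto
    also have "\<dots> = (nrm J w)\<^sup>2" using c by (simp add: t_def)
    finally show False using s by simp
  qed
  hence "\<forall>j\<in>J. mv J A v j = l * v j" using fin by (simp add: nrm_eq_0 w_def)
  thus ?thesis using v by (auto simp: S_def)
qed

text \<open>Double counting of the squared entries: Bessel against a coordinate vector bounds each
  coordinate's contribution by 1, while each vector contributes exactly 1.\<close>

lemma orthonormal_card_le:
  assumes "finite J" "finite I" "orthonormal J I e"
  shows "card I \<le> card J"
proof -
  have "(\<Sum>i\<in>I. (cmod (e i k))\<^sup>2) \<le> 1" if k: "k \<in> J" for k
  proof -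
    define f where "f j = (of_bool (j = k) :: complex)" for j
    have "ip J (e i) f = cnj (e i k)" for i
      using assms(1) k by (simp add: ip_def f_def of_bool_def if_distrib[of "\<lambda>x. _ * x"] cong: if_cong)
    moreover have "(nrm J f)\<^sup>2 = 1"
      using assms(1) k by (simp add: nrm_power2 f_def of_bool_def if_distrib[of "\<lambda>x. x^2"] if_distrib[of cmod] cong: if_cong)
    ultimately show ?thesis using bessel_inequality[OF assms(2,3), of f] by simp
  qed
  hence "(\<Sum>k\<in>J. \<Sum>i\<in>I. (cmod (e i k))\<^sup>2) \<le> (\<Sum>k\<in>J. 1)" by (rule sum_mono)
  moreover have "(\<Sum>k\<in>J. \<Sum>i\<in>I. (cmod (e i k))\<^sup>2) = (\<Sum>i\<in>I. (nrm J (e i))\<^sup>2)"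
    by (subst sum.swap) (simp add: nrm_power2)
  moreover have "(nrm J (e i))\<^sup>2 = 1" if "i \<in> I" for i
  proof -
    have "complex_of_real ((nrm J (e i))\<^sup>2) = of_real 1"
      unfolding ip_self[symmetric] using assms(3) that by (simp add: orthonormal_def)
    thus ?thesis unfolding of_real_eq_iff .
  qed
  ultimately show ?thesis by simp
qed

text \<open>An orthonormal set of eigenvectors of largest cardinality is complete: a coordinate
  vector with nonzero remainder \<open>u\<close> would let \<open>hermitian_eigenvector\<close>
  enlarge the set. Vanishing of all these remainders is the resolution of the identity.\<close>

lemma hermitian_eigenbasis:
  fixes J :: "'j set"
  assumes fin: "finite J" and herm: "hermitian_on J A"
  shows "\<exists>E (l :: ('j \<Rightarrow> complex) \<Rightarrow> real). orthonormal_basis J E \<and> (\<forall>e\<in>E. \<forall>j\<in>J. mv J A e j = l e * e j)"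
proof -
  define P where "P E \<longleftrightarrow> finite E \<and> orthonormal J E (\<lambda>e. e) \<and>
    (\<forall>e\<in>E. \<exists>l::real. \<forall>j\<in>J. mv J A e j = l * e j)" for E
  have "P {}" by (simp add: P_def orthonormal_def)
  moreover have "\<forall>E. P E \<longrightarrow> card E < Suc (card J)"
    using orthonormal_card_le[OF fin] by (auto simp: P_def less_Suc_eq_le)
  ultimately have "\<exists>E. P E \<and> (\<forall>E'. P E' \<longrightarrow> card E' \<le> card E)"
    by (rule ex_has_greatest_nat)
  then obtain E where E: "P E" and max: "\<And>E'. P E' \<Longrightarrow> card E' \<le> card E" by blast
  have fE: "finite E" and oE: "orthonormal J E (\<lambda>e. e)"
    and eE: "\<And>e. e \<in> E \<Longrightarrow> \<exists>l::real. \<forall>j\<in>J. mv J A e j = l * e j" using E by (auto simp: P_def)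
  have complete: "(\<Sum>e\<in>E. e j * cnj (e k)) = of_bool (j = k)" if j: "j \<in> J" and k: "k \<in> J" for j k
  proof -
    define f where "f j = (of_bool (j = k) :: complex)" for j
    have ipf: "ip J e f = cnj (e k)" for e
      using fin k by (simp add: ip_def f_def of_bool_def if_distrib[of "\<lambda>x. _ * x"] cong: if_cong)
    define u where "u j = f j - (\<Sum>e\<in>E. ip J e f * e j)" for j
    have uE: "ip J e u = 0" if "e \<in> E" for e
      using that oE fE
      by (simp add: u_def[abs_def] ip_diff_right ip_sum_right ip_scale_right orthonormal_def of_bool_def
          if_distrib[of "\<lambda>x. _ * x"] cong: if_cong)
    have "nrm J u = 0"
    proof (rule ccontr)
      assume "nrm J u \<noteq> 0"
      hence "\<exists>v (l::real). (\<forall>f\<in>E. ip J f v = 0) \<and> nrm J v = 1 \<and> (\<forall>j\<in>J. mv J A v j = l * v j)"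
        using eE uE by (intro hermitian_eigenvector[OF fin herm]) simp_all
      then obtain v :: "'j \<Rightarrow> complex" and l :: real
        where v: "\<forall>f\<in>E. ip J f v = 0" "nrm J v = 1" "\<forall>j\<in>J. mv J A v j = l * v j" by auto
      have vE: "v \<notin> E" using v oE by (auto simp: orthonormal_def)
      have "ip J v e = 0" if "e \<in> E" for e using v(1) that cnj_ip[of J e v] by simp
      hence "P (insert v E)"
        unfolding P_def using fE oE eE v vE by (auto simp: orthonormal_def ip_self)
      thus False using max[of "insert v E"] fE vE by simp
    qed
    hence "u j = 0" using fin j by (simp add: nrm_eq_0)
    thus ?thesis by (simp add: u_def f_def ipf mult.commute)
  qed
  obtain l :: "('j \<Rightarrow> complex) \<Rightarrow> real" where "\<forall>e\<in>E. \<forall>j\<in>J. mv J A e j = l e * e j" using eE by metis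
  moreover have "orthonormal_basis J E" unfolding orthonormal_basis_def using fE oE complete by blast
  ultimately show ?thesis by blast
qed

section \<open>Spectral projections and nearby isometries\<close>

lemma nrm_orthonormal_sum:
  assumes "finite I" "orthonormal J I e"
  shows "(nrm J (\<lambda>j. \<Sum>i\<in>I. a i * e i j))\<^sup>2 = (\<Sum>i\<in>I. (cmod (a i))\<^sup>2)"
proof -
  have "ip J (\<lambda>j. \<Sum>i\<in>I. a i * e i j) (\<lambda>j. \<Sum>i\<in>I. a i * e i j)
      = (\<Sum>i\<in>I. cnj (a i) * (\<Sum>k\<in>I. a k * of_bool (i = k)))"
    unfolding ip_sum_left ip_sum_right ip_scale_left ip_scale_right using assms(2)
    by (auto simp: orthonormal_def sum_distrib_left intro!: sum.cong)
  also have "\<dots> = (\<Sum>i\<in>I. cnj (a i) * a i)"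
    using assms(1) by (simp add: of_bool_def if_distrib[of "\<lambda>x. _ * x"] cong: if_cong)
  finally have "complex_of_real ((nrm J (\<lambda>j. \<Sum>i\<in>I. a i * e i j))\<^sup>2)
      = complex_of_real (\<Sum>i\<in>I. (cmod (a i))\<^sup>2)"
    unfolding ip_self by (simp add: cnj_mult_self)
  thus ?thesis unfolding of_real_eq_iff .
qed

lemma orthonormal_nrm: "orthonormal J I e \<Longrightarrow> i \<in> I \<Longrightarrow> nrm J (e i) = 1"
proof -
  assume "orthonormal J I e" "i \<in> I"
  hence "complex_of_real ((nrm J (e i))\<^sup>2) = of_real 1"
    unfolding ip_self[symmetric] by (simp add: orthonormal_def)
  hence "(nrm J (e i))\<^sup>2 = 1" unfolding of_real_eq_iff .
  thus ?thesis by (simp add: power2_eq_1_iff) (metis nrm_nonneg not_one_le_zero le_minus_one_simps(3))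
qed

lemma cmod_ip_commute: "cmod (ip J f g) = cmod (ip J g f)"
  by (subst cnj_ip[symmetric]) simp

text \<open>Parseval for each row of \<open>D\<close>: the Hilbert--Schmidt norm can be computed in
  any orthonormal basis of the domain.\<close>

lemma hilbert_schmidt_basis:
  assumes "finite J" "orthonormal_basis J E"
  shows "(\<Sum>e\<in>E. \<Sum>i\<in>I. (cmod (\<Sum>k\<in>J. D i k * e k))\<^sup>2) = (\<Sum>i\<in>I. \<Sum>k\<in>J. (cmod (D i k))\<^sup>2)"
proof -
  have "(\<Sum>e\<in>E. (cmod (\<Sum>k\<in>J. D i k * e k))\<^sup>2) = (\<Sum>k\<in>J. (cmod (D i k))\<^sup>2)" for i
  proof -
    have "(\<Sum>k\<in>J. D i k * e k) = ip J (\<lambda>k. cnj (D i k)) e" for e by (simp add: ip_def)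
    hence "(\<Sum>e\<in>E. (cmod (\<Sum>k\<in>J. D i k * e k))\<^sup>2) = (nrm J (\<lambda>k. cnj (D i k)))\<^sup>2"
      unfolding parseval[OF assms] by (simp add: cmod_ip_commute)
    thus ?thesis by (simp add: nrm_power2)
  qed
  thus ?thesis by (subst sum.swap) simp
qed

text \<open>Both numbers are the squared Hilbert--Schmidt norm of the identity, computed in
  \<open>E\<close> and in coordinates.\<close>

lemma orthonormal_basis_card:
  assumes "finite J" "orthonormal_basis J E"
  shows "card E = card J"
proof -
  have "(\<Sum>e\<in>E. \<Sum>i\<in>J. (cmod (\<Sum>k\<in>J. of_bool (i = k) * e k))\<^sup>2)
      = (\<Sum>i\<in>J. \<Sum>k\<in>J. (cmod (of_bool (i = k) :: complex))\<^sup>2)"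
    by (rule hilbert_schmidt_basis[OF assms])
  also have "(\<Sum>e\<in>E. \<Sum>i\<in>J. (cmod (\<Sum>k\<in>J. of_bool (i = k) * e k))\<^sup>2) = (\<Sum>e\<in>E. (nrm J e)\<^sup>2)"
    using assms(1)
    by (intro sum.cong refl) (simp add: nrm_power2 of_bool_def if_distrib[of "\<lambda>x. x * _"] cong: if_cong)
  also have "\<dots> = (\<Sum>e\<in>E. 1)"
    using assms(2) orthonormal_nrm[of J E "\<lambda>e. e"] by (intro sum.cong) (auto simp: orthonormal_basis_def)
  also have "(\<Sum>i\<in>J. \<Sum>k\<in>J. (cmod (of_bool (i = k) :: complex))\<^sup>2) = (\<Sum>i\<in>J. 1)"
    using assms(1)
    by (intro sum.cong refl) (simp add: of_bool_def if_distrib[of cmod] if_distrib[of "\<lambda>x. x\<^sup>2"] cong: if_cong)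
  finally have "real (card E) = real (card J)" by simp
  thus ?thesis by simp
qed

text \<open>This is the trace of the projection onto the span of \<open>w\<close>, computed in the
  basis \<open>E\<close>.\<close>

lemma spectral_mass:
  assumes "finite J" "orthonormal_basis J E" "orthonormal J I w"
  shows "(\<Sum>e\<in>E. \<Sum>b\<in>I. (cmod (ip J (w b) e))\<^sup>2) = real (card I)"
proof -
  have "(\<Sum>e\<in>E. \<Sum>b\<in>I. (cmod (ip J (w b) e))\<^sup>2) = (\<Sum>b\<in>I. (nrm J (w b))\<^sup>2)"
    unfolding parseval[OF assms(1,2)] by (subst sum.swap) (simp add: cmod_ip_commute)
  also have "\<dots> = (\<Sum>b\<in>I. 1)" using orthonormal_nrm[OF assms(3)] by (intro sum.cong) auto
  finally show ?thesis by simp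
qed

text \<open>For an eigenvector \<open>e\<close> with eigenvalue \<open>l\<close> and a projection \<open>P\<close>,
  \<open>\<parallel>(A - P) e\<parallel>\<^sup>2 = l\<^sup>2 \<parallel>(1 - P) e\<parallel>\<^sup>2 + (1 - l)\<^sup>2 \<parallel>P e\<parallel>\<^sup>2\<close>.\<close>
lemma spectral_comparison:
  fixes l :: "('j \<Rightarrow> complex) \<Rightarrow> real"
  assumes fin: "finite J" and E: "orthonormal_basis J E"
    and eig: "\<And>e j. e \<in> E \<Longrightarrow> j \<in> J \<Longrightarrow> mv J A e j = complex_of_real (l e) * e j"
    and I: "finite I" and w: "orthonormal J I w"
    and \<kappa>: "(\<Sum>j\<in>J. \<Sum>k\<in>J. (cmod (A j k - (\<Sum>b\<in>I. w b j * cnj (w b k))))\<^sup>2) \<le> \<kappa>"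
    and \<theta>: "1/4 \<le> \<theta>" "\<theta> \<le> 3/4"
  shows "(\<Sum>e\<in>{e\<in>E. l e > \<theta>}. 1 - (\<Sum>b\<in>I. (cmod (ip J (w b) e))\<^sup>2)) +
    (\<Sum>e\<in>{e\<in>E. \<not> l e > \<theta>}. \<Sum>b\<in>I. (cmod (ip J (w b) e))\<^sup>2) \<le> 16 * \<kappa>"
proof -
  define t where "t e = (\<Sum>b\<in>I. (cmod (ip J (w b) e))\<^sup>2)" for e
  \<comment> \<open>\<open>r e\<close> is |(Q - P) e|^2, where Q is the spectral projection above
    \<open>\<theta>\<close> and P the projection onto the span of \<open>w\<close>. The conclusion
    therefore bounds the squared Hilbert--Schmidt norm of Q - P.\<close>
  define r where "r e = (if l e > \<theta> then 1 - t e else t e)" for e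
  have finE: "finite E" and oE: "orthonormal J E (\<lambda>e. e)" using E by (auto simp: orthonormal_basis_def)
  have r: "r e \<le> 16 * (\<Sum>j\<in>J. (cmod (\<Sum>k\<in>J. (A j k - (\<Sum>b\<in>I. w b j * cnj (w b k))) * e k))\<^sup>2)"
    if e: "e \<in> E" for e
  proof -
    have n1: "nrm J e = 1" using orthonormal_nrm[OF oE e] .
    have t01: "0 \<le> t e" "t e \<le> 1"
      using bessel_inequality[OF I w, of e] by (auto simp: t_def n1 intro!: sum_nonneg)
    have "(\<Sum>k\<in>J. (A j k - (\<Sum>b\<in>I. w b j * cnj (w b k))) * e k)
        = complex_of_real (l e) * e j - (\<Sum>b\<in>I. ip J (w b) e * w b j)" if "j \<in> J" for j
    proof -
      have "(\<Sum>k\<in>J. (A j k - (\<Sum>b\<in>I. w b j * cnj (w b k))) * e k)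
          = mv J A e j - (\<Sum>k\<in>J. \<Sum>b\<in>I. w b j * cnj (w b k) * e k)"
        by (simp add: mv_def algebra_simps sum_subtractf sum_distrib_left)
      also have "(\<Sum>k\<in>J. \<Sum>b\<in>I. w b j * cnj (w b k) * e k) = (\<Sum>b\<in>I. ip J (w b) e * w b j)"
        by (subst sum.swap) (simp add: ip_def sum_distrib_left sum_distrib_right mult_ac)
      finally show ?thesis using eig[OF e that] by simp
    qed
    hence "(\<Sum>j\<in>J. (cmod (\<Sum>k\<in>J. (A j k - (\<Sum>b\<in>I. w b j * cnj (w b k))) * e k))\<^sup>2)
        = (nrm J (\<lambda>j. complex_of_real (l e) * e j - (\<Sum>b\<in>I. ip J (w b) e * w b j)))\<^sup>2"
      by (simp add: nrm_power2)
    also have "\<dots> = (l e)\<^sup>2 * (1 - t e) + (1 - l e)\<^sup>2 * t e"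
      unfolding bessel_identity[OF I w] t_def[symmetric] n1 by (simp add: power2_eq_square algebra_simps)
    \<comment> \<open>16 is the inverse square of 1/4, the least distance of \<open>\<theta>\<close>
      from 0 and from 1: above the cut l^2 is at least 1/16, below it (1 - l)^2 is.\<close>
    also have "16 * \<dots> \<ge> r e"
    proof (cases "l e > \<theta>")
      case True
      have "(1/4)\<^sup>2 \<le> (l e)\<^sup>2" using True \<theta> by (intro power_mono) auto
      hence "(1/4)\<^sup>2 * (1 - t e) \<le> (l e)\<^sup>2 * (1 - t e)" using t01 by (intro mult_right_mono) auto
      moreover have "0 \<le> (1 - l e)\<^sup>2 * t e" using t01 by simp
      ultimately show ?thesis using True by (simp add: r_def power2_eq_square)
    next
      case False
      have "(1/4)\<^sup>2 \<le> (1 - l e)\<^sup>2" using False \<theta> by (intro power_mono) auto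
      hence "(1/4)\<^sup>2 * t e \<le> (1 - l e)\<^sup>2 * t e" using t01 by (intro mult_right_mono) auto
      moreover have "0 \<le> (l e)\<^sup>2 * (1 - t e)" using t01 by simp
      ultimately show ?thesis using False by (simp add: r_def power2_eq_square)
    qed
    finally show ?thesis .
  qed
  have "(\<Sum>e\<in>{e\<in>E. l e > \<theta>}. 1 - t e) + (\<Sum>e\<in>{e\<in>E. \<not> l e > \<theta>}. t e) = (\<Sum>e\<in>E. r e)"
    unfolding r_def using finE by (simp add: sum.If_cases Int_def conj_commute Collect_neg_eq[symmetric])
  also have "\<dots> \<le> (\<Sum>e\<in>E. 16 * (\<Sum>j\<in>J. (cmod (\<Sum>k\<in>J. (A j k - (\<Sum>b\<in>I. w b j * cnj (w b k))) * e k))\<^sup>2))"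
    by (intro sum_mono r)
  also have "\<dots> \<le> 16 * \<kappa>"
    using \<kappa> unfolding sum_distrib_left[symmetric] hilbert_schmidt_basis[OF fin E] by simp
  finally show ?thesis by (simp add: t_def)
qed

text \<open>The masses \<open>t e\<close> over all of \<open>E\<close> add up to
  \<open>card I\<close>, and each is at most 1. By \<open>spectral_comparison\<close> only
  \<open>16 * \<kappa>\<close> of the total can lie below the cut or be missing above it, which
  controls the rank as well as the overlap.\<close>

lemma spectral_projection_bounds:
  fixes l :: "('j \<Rightarrow> complex) \<Rightarrow> real" and \<kappa> :: real
  assumes fin: "finite J" and E: "orthonormal_basis J E"
    and eig: "\<And>e j. e \<in> E \<Longrightarrow> j \<in> J \<Longrightarrow> mv J A e j = complex_of_real (l e) * e j"
    and I: "finite I" and w: "orthonormal J I w"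
    and \<kappa>: "(\<Sum>j\<in>J. \<Sum>k\<in>J. (cmod (A j k - (\<Sum>b\<in>I. w b j * cnj (w b k))))\<^sup>2) \<le> \<kappa>"
    and \<theta>: "1/4 \<le> \<theta>" "\<theta> \<le> 3/4"
  shows "real (card {e\<in>E. l e > \<theta>}) \<le> real (card I) + 16 * \<kappa>"
    and "real (card {e\<in>E. l e > \<theta>}) \<ge> real (card I) - 16 * \<kappa>"
    and "(\<Sum>e\<in>{e\<in>E. l e > \<theta>}. \<Sum>b\<in>I. (cmod (ip J (w b) e))\<^sup>2) \<ge> real (card I) - 16 * \<kappa>"
    and "(\<Sum>e\<in>{e\<in>E. \<not> l e > \<theta>}. \<Sum>b\<in>I. (cmod (ip J (w b) e))\<^sup>2) \<le> 16 * \<kappa>"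
proof -
  define t where "t e = (\<Sum>b\<in>I. (cmod (ip J (w b) e))\<^sup>2)" for e
  define S where "S = {e\<in>E. l e > \<theta>}"
  define S' where "S' = {e\<in>E. \<not> l e > \<theta>}"
  have finE: "finite E" and oE: "orthonormal J E (\<lambda>e. e)" using E by (auto simp: orthonormal_basis_def)
  have t1: "t e \<le> 1" if "e \<in> E" for e
    using bessel_inequality[OF I w, of e] orthonormal_nrm[OF oE that] by (simp add: t_def)
  have t0: "t e \<ge> 0" for e by (simp add: t_def sum_nonneg)
  have 1: "(\<Sum>e\<in>S. 1 - t e) + (\<Sum>e\<in>S'. t e) \<le> 16 * \<kappa>"
    using spectral_comparison[OF assms] by (simp add: t_def S_def S'_def)
  have "(\<Sum>e\<in>E. t e) = real (card I)" unfolding t_def by (rule spectral_mass[OF fin E w])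
  moreover have "E = S \<union> S'" "S \<inter> S' = {}" by (auto simp: S_def S'_def)
  hence "(\<Sum>e\<in>E. t e) = (\<Sum>e\<in>S. t e) + (\<Sum>e\<in>S'. t e)" using finE by (metis finite_Un sum.union_disjoint)
  ultimately have 2: "(\<Sum>e\<in>S. t e) + (\<Sum>e\<in>S'. t e) = real (card I)" by simp
  have 3: "(\<Sum>e\<in>S. 1 - t e) = real (card S) - (\<Sum>e\<in>S. t e)" by (simp add: sum_subtractf)
  have 4: "(\<Sum>e\<in>S'. t e) \<ge> 0" by (simp add: sum_nonneg t0)
  have 5: "(\<Sum>e\<in>S. 1 - t e) \<ge> 0" using t1 by (intro sum_nonneg) (auto simp: S_def)
  show "real (card {e\<in>E. l e > \<theta>}) \<le> real (card I) + 16 * \<kappa>"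
    using 1 2 3 4 unfolding S_def[symmetric] by linarith
  show "real (card {e\<in>E. l e > \<theta>}) \<ge> real (card I) - 16 * \<kappa>"
    using 1 2 3 5 unfolding S_def[symmetric] by linarith
  show "(\<Sum>e\<in>{e\<in>E. l e > \<theta>}. \<Sum>b\<in>I. (cmod (ip J (w b) e))\<^sup>2) \<ge> real (card I) - 16 * \<kappa>"
    using 1 2 5 unfolding S_def[symmetric] t_def[symmetric] by linarith
  show "(\<Sum>e\<in>{e\<in>E. \<not> l e > \<theta>}. \<Sum>b\<in>I. (cmod (ip J (w b) e))\<^sup>2) \<le> 16 * \<kappa>"
    using 1 5 unfolding S'_def[symmetric] t_def[symmetric] by linarith
qed

text \<open>Pigeonhole: the interval from 1/4 to 3/4 is cut into \<open>Q + 1\<close> half-open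
  slots of width \<open>\<gamma>\<close>, and \<open>\<theta>\<close> is the left end of an empty
  one. The width depends on the bound \<open>Q\<close> alone, not on the size of
  \<open>E\<close>.\<close>

lemma spectral_gap:
  fixes l :: "'e \<Rightarrow> real"
  assumes "finite E" "card {e\<in>E. l e > 1/4} \<le> Q" and \<gamma>: "\<gamma> = 1 / (2 * (real Q + 1))"
  shows "\<exists>\<theta>. 1/4 \<le> \<theta> \<and> \<theta> \<le> 3/4 \<and> (\<forall>e\<in>E. l e \<le> \<theta> \<or> l e > \<theta> + \<gamma>)"
proof (rule ccontr)
  assume neg: "\<not> ?thesis"
  have \<gamma>0: "\<gamma> > 0" by (simp add: \<gamma>)
  have "\<exists>e\<in>E. 1/4 + real k * \<gamma> < l e \<and> l e \<le> 1/4 + (real k + 1) * \<gamma>" if "k \<le> Q" for k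
  proof -
    have "real k * \<gamma> \<le> (real Q + 1) * \<gamma>" using that \<gamma>0 by (intro mult_right_mono) auto
    also have "\<dots> = 1/2" by (simp add: \<gamma> field_simps)
    finally have "real k * \<gamma> \<le> 1/2" .
    moreover have "0 \<le> real k * \<gamma>" using \<gamma>0 by simp
    ultimately have "1/4 \<le> 1/4 + real k * \<gamma>" "1/4 + real k * \<gamma> \<le> 3/4" by linarith+
    hence "\<not> (\<forall>e\<in>E. l e \<le> 1/4 + real k * \<gamma> \<or> l e > 1/4 + real k * \<gamma> + \<gamma>)" using neg by blast
    thus ?thesis by (auto simp: not_le not_less algebra_simps)
  qed
  then obtain e where e: "\<And>k. k \<le> Q \<Longrightarrow> e k \<in> E" "\<And>k. k \<le> Q \<Longrightarrow> 1/4 + real k * \<gamma> < l (e k)"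
      "\<And>k. k \<le> Q \<Longrightarrow> l (e k) \<le> 1/4 + (real k + 1) * \<gamma>" by metis
  have lt: "l (e k) < l (e k')" if "k < k'" "k' \<le> Q" for k k'
  proof -
    have "(real k + 1) * \<gamma> \<le> real k' * \<gamma>" using that \<gamma>0 by (intro mult_right_mono) auto
    thus ?thesis using e(3)[of k] e(2)[of k'] that by simp
  qed
  have "inj_on e {..Q}"
    by (rule linorder_inj_onI) (use lt in \<open>force+\<close>)
  moreover have "e ` {..Q} \<subseteq> {e\<in>E. l e > 1/4}"
  proof
    fix x assume "x \<in> e ` {..Q}"
    then obtain k where k: "k \<le> Q" "x = e k" by auto
    have "0 \<le> real k * \<gamma>" using \<gamma>0 by simp
    thus "x \<in> {e\<in>E. l e > 1/4}" using e(1,2)[of k] k by auto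
  qed
  ultimately have "card {..Q} \<le> card {e\<in>E. l e > 1/4}"
    using assms(1) by (intro card_inj_on_le) auto
  thus False using assms(2) by simp
qed

text \<open>The singular values of a contraction \<open>T\<close> below \<open>1/\<surd>2\<close> are replaced by new orthonormal
  directions; the others are set to \<open>1\<close>.\<close>
lemma nearby_isometry:
  fixes T :: "nat \<Rightarrow> nat \<Rightarrow> complex"
  assumes contr: "\<And>v. (\<Sum>i<m. (cmod (\<Sum>b<N. T i b * v b))\<^sup>2) \<le> (\<Sum>b<N. (cmod (v b))\<^sup>2)"
    and \<kappa>: "(\<Sum>i<m. \<Sum>b<N. (cmod (T i b))\<^sup>2) \<ge> real N - \<kappa>"
  shows "\<exists>m' V. m \<le> m' \<and> N \<le> m' \<and> real m' \<le> m + 2 * \<kappa> \<and>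
    orthonormal {..<m'} {..<N} (\<lambda>b i. V i b) \<and>
    (\<Sum>b<N. (nrm {..<m'} (\<lambda>i. V i b - (if i < m then T i b else 0)))\<^sup>2) \<le> 3 * \<kappa>"
proof -
  \<comment> \<open>H = T^* T, so that its eigenvalues \<open>\<mu>\<close> are the squared singular
    values of \<open>T\<close>.\<close>
  define H where "H b c = (\<Sum>i<m. cnj (T i b) * T i c)" for b c
  have "hermitian_on {..<N} H" by (simp add: hermitian_on_def H_def mult.commute)
  then obtain E and \<mu> :: "(nat \<Rightarrow> complex) \<Rightarrow> real" where E: "orthonormal_basis {..<N} E"
    and eig: "\<forall>e\<in>E. \<forall>j\<in>{..<N}. mv {..<N} H e j = complex_of_real (\<mu> e) * e j"
    using hermitian_eigenbasis[of "{..<N}" H] by auto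
  have finE: "finite E" and oE: "orthonormal {..<N} E (\<lambda>e. e)"
    and cE: "\<And>j k. j < N \<Longrightarrow> k < N \<Longrightarrow> (\<Sum>e\<in>E. e j * cnj (e k)) = of_bool (j = k)"
    using E by (auto simp: orthonormal_basis_def)
  define Tv where "Tv e i = (\<Sum>b<N. T i b * e b)" for e i
  have ipT: "ip {..<m} (Tv e) (Tv f) = of_real (\<mu> f) * of_bool (e = f)" if "e \<in> E" "f \<in> E" for e f
  proof -
    have "ip {..<m} (Tv e) (Tv f) = (\<Sum>i<m. \<Sum>b<N. \<Sum>c<N. cnj (e b) * (cnj (T i b) * T i c * f c))"
      by (simp add: ip_def Tv_def sum_distrib_left sum_distrib_right mult_ac)
    also have "\<dots> = (\<Sum>b<N. \<Sum>c<N. \<Sum>i<m. cnj (e b) * (cnj (T i b) * T i c * f c))"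
      by (subst sum.swap, rule sum.cong[OF refl], rule sum.swap)
    also have "\<dots> = ip {..<N} e (mv {..<N} H f)"
      by (simp add: ip_def mv_def H_def sum_distrib_left sum_distrib_right mult_ac)
    also have "\<dots> = ip {..<N} e (\<lambda>j. of_real (\<mu> f) * f j)" using eig that by (intro ip_cong) auto
    also have "\<dots> = of_real (\<mu> f) * of_bool (e = f)"
      using oE that by (simp add: ip_scale_right orthonormal_def)
    finally show ?thesis .
  qed
  have nT: "(nrm {..<m} (Tv e))\<^sup>2 = \<mu> e" if "e \<in> E" for e
  proof -
    have "complex_of_real ((nrm {..<m} (Tv e))\<^sup>2) = of_real (\<mu> e)"
      unfolding ip_self[symmetric] using ipT[OF that that] by simp
    thus ?thesis unfolding of_real_eq_iff .
  qed
  have \<mu>0: "\<mu> e \<ge> 0" if "e \<in> E" for e using nT[OF that] by (metis zero_le_power2)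
  have \<mu>1: "\<mu> e \<le> 1" if "e \<in> E" for e
  proof -
    have "\<mu> e \<le> (nrm {..<N} e)\<^sup>2"
      using contr[of e] nT[OF that] by (simp add: nrm_power2 Tv_def)
    thus ?thesis using orthonormal_nrm[OF oE that] by simp
  qed
  have "(\<Sum>e\<in>E. \<mu> e) = (\<Sum>e\<in>E. (nrm {..<m} (Tv e))\<^sup>2)" using nT by simp
  also have "\<dots> = (\<Sum>i<m. \<Sum>b<N. (cmod (T i b))\<^sup>2)"
    unfolding nrm_power2 Tv_def by (rule hilbert_schmidt_basis[OF finite_lessThan E])
  finally have "(\<Sum>e\<in>E. 1 - \<mu> e) = real N - (\<Sum>i<m. \<Sum>b<N. (cmod (T i b))\<^sup>2)"
    using orthonormal_basis_card[OF finite_lessThan E] by (simp add: sum_subtractf)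
  hence defect: "(\<Sum>e\<in>E. 1 - \<mu> e) \<le> \<kappa>" using \<kappa> by linarith
  \<comment> \<open>The threshold 1/2 serves twice. Each bad vector uses up more than 1/2 of the
    defect, so there are at most 2 * \<open>\<kappa>\<close> of them; and \<open>\<mu> < 1/2\<close>
    makes the error 1 + \<open>\<mu>\<close> of a bad vector at most 3 * (1 -
    \<open>\<mu>\<close>).\<close>
  define Bad where "Bad = {e\<in>E. \<mu> e < 1/2}"
  have finB: "finite Bad" using finE by (simp add: Bad_def)
  define r where "r = card Bad"
  have "\<exists>\<beta>. bij_betw \<beta> Bad {m..<m + r}"
    using finB by (intro finite_same_card_bij) (simp_all add: r_def)
  then obtain \<beta> where \<beta>: "bij_betw \<beta> Bad {m..<m + r}" by blast
  have \<beta>m: "m \<le> \<beta> e" "\<beta> e < m + r" if "e \<in> Bad" for e using \<beta> that by (auto simp: bij_betw_def)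
  have \<beta>inj: "\<beta> e = \<beta> f \<longleftrightarrow> e = f" if "e \<in> Bad" "f \<in> Bad" for e f
    using \<beta> that by (auto simp: bij_betw_def inj_on_def)
  define T' where "T' i b = (if i < m then T i b else 0)" for i b
  \<comment> \<open>Left singular vectors: normalised images for the good vectors, and for each bad
    one a fresh coordinate beyond \<open>m\<close>, orthogonal to everything in the range of
    \<open>T\<close>.\<close>
  define W where "W e i = (if e \<in> Bad then of_bool (i = \<beta> e) else
      if i < m then Tv e i / of_real (sqrt (\<mu> e)) else 0)" for e i
  have sub: "{..<m} \<subseteq> {..<m + r}" by auto
  have oW: "orthonormal {..<m + r} E W"
    unfolding orthonormal_def
  proof (intro ballI)
    fix e f assume ef: "e \<in> E" "f \<in> E"
    consider "e \<in> Bad" "f \<in> Bad" | "e \<in> Bad" "f \<notin> Bad" | "e \<notin> Bad" "f \<in> Bad" | "e \<notin> Bad" "f \<notin> Bad"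
      by blast
    thus "ip {..<m + r} (W e) (W f) = of_bool (e = f)"
    proof cases
      case 1
      have "ip {..<m + r} (W e) (W f) = (\<Sum>i<m + r. if i = \<beta> e then of_bool (e = f) else 0)"
        unfolding ip_def using 1 \<beta>inj by (intro sum.cong) (auto simp: W_def)
      thus ?thesis using \<beta>m[OF 1(1)] by simp
    next
      case 2
      show ?thesis unfolding ip_def using 2 \<beta>m[OF 2(1)] by (intro sum.neutral[THEN trans]) (auto simp: W_def)
    next
      case 3
      show ?thesis unfolding ip_def using 3 \<beta>m[OF 3(2)] by (intro sum.neutral[THEN trans]) (auto simp: W_def)
    next
      case 4
      have pos: "\<mu> e > 0" "\<mu> f > 0" using 4 ef by (auto simp: Bad_def)
      have "ip {..<m + r} (W e) (W f) = ip {..<m} (W e) (W f)"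
        unfolding ip_def using 4 by (intro sum.mono_neutral_right sub) (auto simp: W_def)
      also have "\<dots> = ip {..<m} (\<lambda>i. of_real (1 / sqrt (\<mu> e)) * Tv e i) (\<lambda>i. of_real (1 / sqrt (\<mu> f)) * Tv f i)"
        using 4 by (intro ip_cong) (auto simp: W_def)
      also have "\<dots> = of_real (1 / sqrt (\<mu> e) * (1 / sqrt (\<mu> f)) * \<mu> f) * of_bool (e = f)"
        unfolding ip_scale_left ip_scale_right ipT[OF ef] by simp
      also have "\<dots> = of_bool (e = f)" using pos by (auto simp flip: of_real_mult)
      finally show ?thesis .
    qed
  qed
  define V where "V i b = (\<Sum>e\<in>E. W e i * cnj (e b))" for i b
  have "orthonormal {..<m + r} {..<N} (\<lambda>b i. V i b)"
    unfolding orthonormal_def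
  proof (intro ballI)
    fix b c assume bc: "b \<in> {..<N}" "c \<in> {..<N}"
    have "ip {..<m + r} (\<lambda>i. V i b) (\<lambda>i. V i c) = (\<Sum>e\<in>E. \<Sum>f\<in>E. e b * (cnj (f c) * ip {..<m + r} (W e) (W f)))"
    proof -
      have "(\<lambda>i. V i b) = (\<lambda>i. \<Sum>e\<in>E. cnj (e b) * W e i)" for b by (simp add: V_def mult.commute)
      thus ?thesis by (simp add: ip_sum_left ip_sum_right ip_scale_left ip_scale_right sum_distrib_left)
    qed
    also have "\<dots> = (\<Sum>e\<in>E. \<Sum>f\<in>E. if e = f then e b * cnj (f c) else 0)"
      using oW by (intro sum.cong refl) (auto simp: orthonormal_def)
    also have "\<dots> = (\<Sum>e\<in>E. e b * cnj (e c))" using finE by simp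
    finally show "ip {..<m + r} (\<lambda>i. V i b) (\<lambda>i. V i c) = of_bool (b = c)" using cE bc by simp
  qed
  moreover have "(\<Sum>b<N. (nrm {..<m + r} (\<lambda>i. V i b - T' i b))\<^sup>2) \<le> 3 * \<kappa>"
  proof -
    \<comment> \<open>The image of \<open>e\<close> under \<open>V\<close> minus \<open>T'\<close>,
      as \<open>V\<close> sends each \<open>e\<close> to \<open>W e\<close>. The error can thus be
      summed over the singular basis instead of the columns.\<close>
    define X where "X e i = W e i - (if i < m then Tv e i else 0)" for e i
    have VT: "V i b - T' i b = (\<Sum>e\<in>E. X e i * cnj (e b))" if b: "b < N" for i b
    proof -
      have "(\<Sum>e\<in>E. Tv e i * cnj (e b)) = (\<Sum>c<N. T i c * (\<Sum>e\<in>E. e c * cnj (e b)))"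
        unfolding Tv_def sum_distrib_left sum_distrib_right by (subst sum.swap) (simp add: mult_ac)
      also have "\<dots> = T i b"
        using b by (simp add: cE of_bool_def if_distrib[of "\<lambda>x. _ * x"] cong: if_cong)
      finally have "(\<Sum>e\<in>E. (if i < m then Tv e i else 0) * cnj (e b)) = T' i b"
        by (simp add: T'_def)
      thus ?thesis by (simp add: V_def X_def algebra_simps sum_subtractf)
    qed
    have "(\<Sum>b<N. (nrm {..<m + r} (\<lambda>i. V i b - T' i b))\<^sup>2)
        = (\<Sum>i<m + r. \<Sum>b<N. (cmod (\<Sum>e\<in>E. cnj (X e i) * e b))\<^sup>2)"
    proof -
      have "cmod (\<Sum>e\<in>E. X e i * cnj (e b)) = cmod (\<Sum>e\<in>E. cnj (X e i) * e b)" for i b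
        by (subst complex_mod_cnj[symmetric]) simp
      thus ?thesis unfolding nrm_power2 by (subst sum.swap) (simp add: VT)
    qed
    also have "\<dots> = (\<Sum>i<m + r. \<Sum>e\<in>E. (cmod (X e i))\<^sup>2)"
      using nrm_orthonormal_sum[OF finE oE, of "\<lambda>e. cnj (X e _)"] by (simp add: nrm_power2)
    also have "\<dots> = (\<Sum>e\<in>E. (nrm {..<m + r} (X e))\<^sup>2)"
      unfolding nrm_power2 by (rule sum.swap)
    also have "\<dots> \<le> (\<Sum>e\<in>E. 3 * (1 - \<mu> e))"
    proof (rule sum_mono)
      fix e assume e: "e \<in> E"
      have n: "nrm {..<m + r} (\<lambda>i. if i < m then Tv e i else 0) = sqrt (\<mu> e)"
      proof -
        have "(nrm {..<m + r} (\<lambda>i. if i < m then Tv e i else 0))\<^sup>2 = (nrm {..<m} (Tv e))\<^sup>2"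
          unfolding nrm_power2 by (intro sum.mono_neutral_cong_right sub) auto
        thus ?thesis using nT[OF e] by (simp add: real_sqrt_unique)
      qed
      show "(nrm {..<m + r} (X e))\<^sup>2 \<le> 3 * (1 - \<mu> e)"
      proof (cases "e \<in> Bad")
        case True
        have "complex_of_real ((nrm {..<m + r} (X e))\<^sup>2) = of_real (1 + \<mu> e)"
        proof -
          have 1: "ip {..<m + r} (W e) (\<lambda>i. if i < m then Tv e i else 0) = 0"
            unfolding ip_def using True \<beta>m[OF True] by (intro sum.neutral) (auto simp: W_def)
          have 2: "ip {..<m + r} (\<lambda>i. if i < m then Tv e i else 0) (W e) = 0"
            using arg_cong[OF 1, of cnj] by (simp add: cnj_ip)
          show ?thesis
            unfolding ip_self[symmetric] X_def ip_diff_left ip_diff_right 1 2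
            unfolding ip_self n orthonormal_nrm[OF oW e] using \<mu>0[OF e] by simp
        qed
        hence "(nrm {..<m + r} (X e))\<^sup>2 = 1 + \<mu> e" unfolding of_real_eq_iff .
        thus ?thesis using True by (simp add: Bad_def)
      next
        case False
        have pos: "\<mu> e > 0" using False e by (auto simp: Bad_def)
        have "X e i = of_real (1 / sqrt (\<mu> e) - 1) * (if i < m then Tv e i else 0)" for i
          using False by (simp add: X_def W_def algebra_simps)
        hence "nrm {..<m + r} (X e) = \<bar>1 / sqrt (\<mu> e) - 1\<bar> * sqrt (\<mu> e)"
          using n nrm_scale[of _ "of_real (1 / sqrt (\<mu> e) - 1)"] by (metis (no_types, lifting) nrm_cong norm_of_real)
        also have "\<dots> = \<bar>(1 / sqrt (\<mu> e) - 1) * sqrt (\<mu> e)\<bar>" using pos by (simp add: abs_mult)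
        also have "(1 / sqrt (\<mu> e) - 1) * sqrt (\<mu> e) = 1 - sqrt (\<mu> e)" using pos by (simp add: field_simps)
        finally have "(nrm {..<m + r} (X e))\<^sup>2 = (1 - sqrt (\<mu> e)) * (1 - sqrt (\<mu> e))"
          by (simp add: power2_eq_square)
        \<comment> \<open>As \<open>\<mu>\<close> is at most 1, one factor 1 - sqrt
          \<open>\<mu>\<close> may be enlarged to 1 + sqrt \<open>\<mu>\<close>, so a good vector
          costs at most its own share of the defect.\<close>
        also have "\<dots> \<le> (1 - sqrt (\<mu> e)) * (1 + sqrt (\<mu> e))"
          using \<mu>1[OF e] pos by (intro mult_left_mono) auto
        also have "\<dots> = 1 - \<mu> e" using pos by (simp add: algebra_simps)
        finally show ?thesis using \<mu>1[OF e] by simp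
      qed
    qed
    also have "\<dots> \<le> 3 * \<kappa>" unfolding sum_distrib_left[symmetric] using defect by simp
    finally show ?thesis .
  qed
  moreover have "real (m + r) \<le> m + 2 * \<kappa>"
  proof -
    have "real r / 2 = (\<Sum>e\<in>Bad. 1/2)" by (simp add: r_def)
    also have "\<dots> \<le> (\<Sum>e\<in>Bad. 1 - \<mu> e)" by (intro sum_mono) (auto simp: Bad_def)
    also have "\<dots> \<le> (\<Sum>e\<in>E. 1 - \<mu> e)" using finE \<mu>1 by (intro sum_mono2) (auto simp: Bad_def)
    finally show ?thesis using defect by simp
  qed
  moreover have "N \<le> m + r"
    using orthonormal_card_le[OF _ _ \<open>orthonormal {..<m + r} {..<N} (\<lambda>b i. V i b)\<close>] by simp
  ultimately show ?thesis unfolding T'_def by (intro exI[of _ "m + r"] exI[of _ V]) simp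
qed

section \<open>The discrete model\<close>

text \<open>The columns are the functions sending x to u x applied to a basis vector. Division by
  the root of \<open>card F\<close> replaces the counting measure on the net by a probability
  measure.\<close>

lemma orthonormal_columns:
  assumes "finite F" "F \<noteq> {}"
    and u: "\<And>x b c. x \<in> F \<Longrightarrow> b < N \<Longrightarrow> c < N \<Longrightarrow> (\<Sum>a<N. cnj (u x a b) * u x a c) = of_bool (b = c)"
  shows "orthonormal (F \<times> {..<N}) {..<N} (\<lambda>b j. u (fst j) (snd j) b / of_real (sqrt (real (card F))))"
  unfolding orthonormal_def
proof (intro ballI)
  fix b c assume bc: "b \<in> {..<N}" "c \<in> {..<N}"
  define M where "M = real (card F)"
  have M: "M > 0" using assms by (simp add: M_def card_gt_0_iff)
  have MM: "of_real (sqrt M) * of_real (sqrt M) = (of_real M :: complex)"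
    using M by (simp flip: of_real_mult)
  have "ip (F \<times> {..<N}) (\<lambda>j. u (fst j) (snd j) b / of_real (sqrt M)) (\<lambda>j. u (fst j) (snd j) c / of_real (sqrt M))
      = (\<Sum>j\<in>F \<times> {..<N}. cnj (u (fst j) (snd j) b) * u (fst j) (snd j) c) / of_real M"
    by (simp add: ip_def MM flip: sum_divide_distrib)
  also have "(\<Sum>j\<in>F \<times> {..<N}. cnj (u (fst j) (snd j) b) * u (fst j) (snd j) c)
      = (\<Sum>x\<in>F. \<Sum>a<N. cnj (u x a b) * u x a c)"
    by (simp add: sum.cartesian_product case_prod_unfold)
  also have "\<dots> = (\<Sum>x\<in>F. of_bool (b = c))" using bc by (intro sum.cong refl u) auto
  also have "\<dots> / of_real M = of_bool (b = c)" using M by (simp add: M_def)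
  finally show "ip (F \<times> {..<N}) (\<lambda>j. u (fst j) (snd j) b / of_real (sqrt (real (card F))))
    (\<lambda>j. u (fst j) (snd j) c / of_real (sqrt (real (card F)))) = of_bool (b = c)"
    unfolding M_def .
qed

section \<open>Lipschitz functions on the group and their sums over almost invariant nets\<close>

context bi_invariant_group
begin

definition lipschitz :: "real \<Rightarrow> ('a \<Rightarrow> complex) \<Rightarrow> bool" where
  "lipschitz C h \<longleftrightarrow> (\<forall>x\<in>carrier G. \<forall>y\<in>carrier G. cmod (h x - h y) \<le> C * d x y)"

definition bounded_by :: "real \<Rightarrow> ('a \<Rightarrow> complex) \<Rightarrow> bool" where
  "bounded_by B h \<longleftrightarrow> (\<forall>x\<in>carrier G. cmod (h x) \<le> B)"

definition nearly_invariant :: "real \<Rightarrow> 'a set \<Rightarrow> bool" where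
  "nearly_invariant \<delta> F \<longleftrightarrow> finite F \<and> F \<noteq> {} \<and> F \<subseteq> carrier G \<and>
    (\<forall>g\<in>carrier G. \<exists>\<pi>. bij_betw \<pi> F F \<and> (\<forall>x\<in>F. d (x \<otimes> g) (\<pi> x) \<le> \<delta>))"

lemma lipschitz_add:
  assumes "lipschitz C h" "lipschitz C' h'"
  shows "lipschitz (C + C') (\<lambda>x. h x + h' x)"
  unfolding lipschitz_def
proof (intro ballI)
  fix x y assume xy: "x \<in> carrier G" "y \<in> carrier G"
  have "cmod (h x + h' x - (h y + h' y)) \<le> cmod (h x - h y) + cmod (h' x - h' y)"
    using norm_triangle_ineq[of "h x - h y" "h' x - h' y"] by (simp add: algebra_simps)
  also have "\<dots> \<le> C * d x y + C' * d x y" using assms xy by (intro add_mono) (auto simp: lipschitz_def)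
  finally show "cmod (h x + h' x - (h y + h' y)) \<le> (C + C') * d x y" by (simp add: algebra_simps)
qed

lemma lipschitz_scale:
  assumes "lipschitz C h" "cmod c \<le> B" "C \<ge> 0"
  shows "lipschitz (B * C) (\<lambda>x. c * h x)"
  unfolding lipschitz_def
proof (intro ballI)
  fix x y assume xy: "x \<in> carrier G" "y \<in> carrier G"
  have "cmod (c * h x - c * h y) = cmod c * cmod (h x - h y)"
    by (simp add: norm_mult flip: right_diff_distrib)
  also have "\<dots> \<le> B * (C * d x y)"
    using assms xy by (intro mult_mono) (auto simp: lipschitz_def intro: order_trans[OF norm_ge_zero])
  finally show "cmod (c * h x - c * h y) \<le> B * C * d x y" by simp
qed

lemma lipschitz_uminus: "lipschitz C h \<Longrightarrow> lipschitz C (\<lambda>x. - h x)"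
  by (simp add: lipschitz_def norm_minus_commute)

lemma lipschitz_diff:
  "lipschitz C h \<Longrightarrow> lipschitz C' h' \<Longrightarrow> lipschitz (C + C') (\<lambda>x. h x - h' x)"
  using lipschitz_add[OF _ lipschitz_uminus] by fastforce

lemma lipschitz_cnj: "lipschitz C h \<Longrightarrow> lipschitz C (\<lambda>x. cnj (h x))"
  unfolding lipschitz_def by (metis complex_cnj_diff complex_mod_cnj)

lemma lipschitz_mult:
  assumes "lipschitz C h" "lipschitz C' h'" "bounded_by B h" "bounded_by B' h'"
  shows "lipschitz (B * C' + C * B') (\<lambda>x. h x * h' x)"
  unfolding lipschitz_def
proof (intro ballI)
  fix x y assume xy: "x \<in> carrier G" "y \<in> carrier G"
  have B: "B \<ge> 0" using assms(3) xy(1) unfolding bounded_by_def by (meson norm_ge_zero order_trans)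
  have "h x * h' x - h y * h' y = h x * (h' x - h' y) + (h x - h y) * h' y" by (simp add: algebra_simps)
  hence "cmod (h x * h' x - h y * h' y) \<le> cmod (h x) * cmod (h' x - h' y) + cmod (h x - h y) * cmod (h' y)"
    using norm_triangle_ineq[of "h x * (h' x - h' y)" "(h x - h y) * h' y"] by (simp add: norm_mult)
  also have "\<dots> \<le> B * (C' * d x y) + (C * d x y) * B'"
  proof (intro add_mono mult_mono)
    show "0 \<le> C * d x y" using assms(1) xy order_trans[OF norm_ge_zero] by (fastforce simp: lipschitz_def)
  qed (use assms xy B in \<open>auto simp: lipschitz_def bounded_by_def\<close>)
  finally show "cmod (h x * h' x - h y * h' y) \<le> (B * C' + C * B') * d x y" by (simp add: algebra_simps)
qed

lemma lipschitz_sum: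
  assumes "\<And>i. i \<in> I \<Longrightarrow> lipschitz C (h i)"
  shows "lipschitz (real (card I) * C) (\<lambda>x. \<Sum>i\<in>I. h i x)"
  unfolding lipschitz_def
proof (intro ballI)
  fix x y assume xy: "x \<in> carrier G" "y \<in> carrier G"
  have "cmod ((\<Sum>i\<in>I. h i x) - (\<Sum>i\<in>I. h i y)) \<le> (\<Sum>i\<in>I. C * d x y)"
    unfolding sum_subtractf[symmetric] using assms xy by (intro sum_norm_le) (auto simp: lipschitz_def)
  thus "cmod ((\<Sum>i\<in>I. h i x) - (\<Sum>i\<in>I. h i y)) \<le> real (card I) * C * d x y" by simp
qed

lemma lipschitz_mono: "lipschitz C h \<Longrightarrow> C \<le> C' \<Longrightarrow> lipschitz C' h"
  unfolding lipschitz_def by (meson mult_right_mono nonneg order_trans)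

lemma lipschitz_translate:
  assumes "lipschitz C h" "g \<in> carrier G"
  shows "lipschitz C (\<lambda>x. h (x \<otimes> g))"
  unfolding lipschitz_def
proof (intro ballI)
  fix x y assume xy: "x \<in> carrier G" "y \<in> carrier G"
  have "cmod (h (x \<otimes> g) - h (y \<otimes> g)) \<le> C * d (x \<otimes> g) (y \<otimes> g)"
    using assms xy by (simp add: lipschitz_def)
  thus "cmod (h (x \<otimes> g) - h (y \<otimes> g)) \<le> C * d x y"
    using assms xy by (simp add: right_invariant)
qed

lemma lipschitz_inv_translate:
  assumes "lipschitz C h" "z \<in> carrier G"
  shows "lipschitz C (\<lambda>x. h (z \<otimes> inv x))"
  unfolding lipschitz_def
proof (intro ballI)
  fix x y assume xy: "x \<in> carrier G" "y \<in> carrier G"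
  have "cmod (h (z \<otimes> inv x) - h (z \<otimes> inv y)) \<le> C * d (z \<otimes> inv x) (z \<otimes> inv y)"
    using assms xy by (simp add: lipschitz_def)
  thus "cmod (h (z \<otimes> inv x) - h (z \<otimes> inv y)) \<le> C * d x y"
    using assms xy by (simp add: left_invariant inv_invariant)
qed

lemma bounded_by_sum:
  assumes "\<And>i. i \<in> I \<Longrightarrow> bounded_by B (h i)"
  shows "bounded_by (real (card I) * B) (\<lambda>x. \<Sum>i\<in>I. h i x)"
  unfolding bounded_by_def
proof
  fix x assume "x \<in> carrier G"
  hence "cmod (\<Sum>i\<in>I. h i x) \<le> (\<Sum>i\<in>I. B)"
    using assms by (intro sum_norm_le) (auto simp: bounded_by_def)
  thus "cmod (\<Sum>i\<in>I. h i x) \<le> real (card I) * B" by simp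
qed

lemma bounded_by_diff:
  "bounded_by B h \<Longrightarrow> bounded_by B' h' \<Longrightarrow> bounded_by (B + B') (\<lambda>x. h x - h' x)"
  unfolding bounded_by_def by (meson add_mono norm_triangle_ineq4 order_trans)

lemma bounded_by_scale:
  assumes "bounded_by B h" "cmod c \<le> D" "D \<ge> 0"
  shows "bounded_by (D * B) (\<lambda>x. c * h x)"
  using assms by (auto simp: bounded_by_def norm_mult intro!: mult_mono)

lemma bounded_by_mono: "bounded_by B h \<Longrightarrow> B \<le> B' \<Longrightarrow> bounded_by B' h"
  unfolding bounded_by_def by (meson order_trans)

lemma bounded_by_cnj: "bounded_by B h \<Longrightarrow> bounded_by B (\<lambda>x. cnj (h x))"
  by (simp add: bounded_by_def)

lemma bounded_by_translate: "bounded_by B h \<Longrightarrow> g \<in> carrier G \<Longrightarrow> bounded_by B (\<lambda>x. h (x \<otimes> g))"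
  by (simp add: bounded_by_def)

lemma hermitian_convolution:
  assumes "F \<subseteq> carrier G"
    and \<psi>: "\<And>x a b. x \<in> carrier G \<Longrightarrow> a < N \<Longrightarrow> b < N \<Longrightarrow> \<psi> (inv x) b a = cnj (\<psi> x a b)"
  shows "hermitian_on (F \<times> {..<N}) (\<lambda>j k. \<psi> (fst j \<otimes> inv (fst k)) (snd j) (snd k) / of_nat n)"
  unfolding hermitian_on_def
proof (intro ballI)
  fix j k assume jk: "j \<in> F \<times> {..<N}" "k \<in> F \<times> {..<N}"
  have c: "fst j \<in> carrier G" "fst k \<in> carrier G" "snd j < N" "snd k < N" using jk assms(1) by auto
  have "fst k \<otimes> inv (fst j) = inv (fst j \<otimes> inv (fst k))"
    using c by (simp add: inv_mult_group)
  hence "\<psi> (fst k \<otimes> inv (fst j)) (snd k) (snd j) = cnj (\<psi> (fst j \<otimes> inv (fst k)) (snd j) (snd k))"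
    using \<psi>[of "fst j \<otimes> inv (fst k)" "snd j" "snd k"] c by simp
  thus "\<psi> (fst k \<otimes> inv (fst j)) (snd k) (snd j) / of_nat n
      = cnj (\<psi> (fst j \<otimes> inv (fst k)) (snd j) (snd k) / of_nat n)" by simp
qed

text \<open>The substitute for invariance of Haar measure. The sum of \<open>h\<close> over
  \<open>F\<close> is rearranged along the matching \<open>\<pi>\<close>, and corresponding terms
  are compared by the Lipschitz bound.\<close>

lemma sum_translate:
  assumes F: "nearly_invariant \<delta> F" and h: "lipschitz C h" "C \<ge> 0" and g: "g \<in> carrier G"
  shows "cmod ((\<Sum>x\<in>F. h (x \<otimes> g)) - (\<Sum>x\<in>F. h x)) \<le> real (card F) * (C * \<delta>)"
proof -
  have "\<exists>\<pi>. bij_betw \<pi> F F \<and> (\<forall>x\<in>F. d (x \<otimes> g) (\<pi> x) \<le> \<delta>)"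
    using F g by (simp add: nearly_invariant_def)
  then obtain \<pi> where \<pi>: "bij_betw \<pi> F F" "\<forall>x\<in>F. d (x \<otimes> g) (\<pi> x) \<le> \<delta>" by blast
  have sub: "F \<subseteq> carrier G" using F by (simp add: nearly_invariant_def)
  have "(\<Sum>x\<in>F. h x) = (\<Sum>x\<in>F. h (\<pi> x))"
    using \<pi>(1) by (rule sum.reindex_bij_betw[symmetric])
  hence "(\<Sum>x\<in>F. h (x \<otimes> g)) - (\<Sum>x\<in>F. h x) = (\<Sum>x\<in>F. h (x \<otimes> g) - h (\<pi> x))"
    by (simp add: sum_subtractf)
  also have "cmod \<dots> \<le> (\<Sum>x\<in>F. C * \<delta>)"
  proof (rule sum_norm_le)
    fix x assume x: "x \<in> F"
    have "\<pi> x \<in> F" using \<pi>(1) x by (auto simp: bij_betw_def)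
    hence "cmod (h (x \<otimes> g) - h (\<pi> x)) \<le> C * d (x \<otimes> g) (\<pi> x)"
      using h(1) x sub g by (auto simp: lipschitz_def subset_iff)
    also have "\<dots> \<le> C * \<delta>" using \<pi>(2) x h(2) by (intro mult_left_mono) auto
    finally show "cmod (h (x \<otimes> g) - h (\<pi> x)) \<le> C * \<delta>" .
  qed
  finally show ?thesis by simp
qed

text \<open>Right translation is nearly isometric: \<open>sum_translate\<close> is applied to the
  pointwise inner product, a Lipschitz function on the group. The functions must be given on the
  whole group, since a translate of the net leaves the net.\<close>

lemma ip_translate:
  fixes N :: nat
  assumes F: "nearly_invariant \<delta> F" and g: "g \<in> carrier G"
    and u: "\<And>a. a < N \<Longrightarrow> lipschitz L (u a)" "\<And>a. a < N \<Longrightarrow> bounded_by B (u a)"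
    and v: "\<And>a. a < N \<Longrightarrow> lipschitz L (v a)" "\<And>a. a < N \<Longrightarrow> bounded_by B (v a)"
    and nn: "L \<ge> 0" "B \<ge> 0"
  shows "cmod (ip (F \<times> {..<N}) (\<lambda>j. u (snd j) (fst j \<otimes> g)) (\<lambda>j. v (snd j) (fst j \<otimes> g))
    - ip (F \<times> {..<N}) (\<lambda>j. u (snd j) (fst j)) (\<lambda>j. v (snd j) (fst j)))
    \<le> real (card F) * (2 * real N * B * L * \<delta>)"
proof -
  define h where "h x = (\<Sum>a<N. cnj (u a x) * v a x)" for x
  have "lipschitz (real (card {..<N}) * (B * L + L * B)) h"
    unfolding h_def[abs_def] using u v
    by (intro lipschitz_sum lipschitz_mult lipschitz_cnj bounded_by_cnj) auto
  hence "lipschitz (2 * real N * B * L) h" by (rule lipschitz_mono) (simp add: algebra_simps)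
  hence "cmod ((\<Sum>x\<in>F. h (x \<otimes> g)) - (\<Sum>x\<in>F. h x)) \<le> real (card F) * (2 * real N * B * L * \<delta>)"
    using nn g by (intro sum_translate F) auto
  thus ?thesis by (simp add: h_def ip_def sum.cartesian_product case_prod_unfold)
qed

lemma nrm_translate:
  fixes N :: nat
  assumes F: "nearly_invariant \<delta> F" and g: "g \<in> carrier G"
    and u: "\<And>a. a < N \<Longrightarrow> lipschitz L (u a)" "\<And>a. a < N \<Longrightarrow> bounded_by B (u a)"
    and nn: "L \<ge> 0" "B \<ge> 0"
  shows "(nrm (F \<times> {..<N}) (\<lambda>j. u (snd j) (fst j \<otimes> g)))\<^sup>2
    \<le> (nrm (F \<times> {..<N}) (\<lambda>j. u (snd j) (fst j)))\<^sup>2 + real (card F) * (2 * real N * B * L * \<delta>)"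
  using ip_translate[of \<delta> F g N L u B u, OF F g u u nn] unfolding ip_self of_real_diff[symmetric] norm_of_real by linarith

end

text \<open>Convolution by \<open>\<psi>\<close> on one net, with its eigenbasis and a gap of width
  \<open>\<gamma>\<close> above the cut \<open>\<theta>\<close>. \<open>Q\<close> bounds the rank
  uniformly over nets, so that the error bounds below involve \<open>N\<close>, \<open>C\<close>,
  \<open>Q\<close>, \<open>\<gamma>\<close> and \<open>\<delta>\<close> but not the size of
  \<open>F\<close>.\<close>

locale discrete_model = bi_invariant_group G d for G (structure) and d :: "'a \<Rightarrow> 'a \<Rightarrow> real" +
  fixes N :: nat and \<psi> :: "'a \<Rightarrow> nat \<Rightarrow> nat \<Rightarrow> complex" and C :: real
    and F :: "'a set" and \<delta> :: real
    and E :: "('a \<times> nat \<Rightarrow> complex) set" and l :: "('a \<times> nat \<Rightarrow> complex) \<Rightarrow> real"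
    and \<theta> \<gamma> Q :: real
  assumes N: "N > 0"
    and \<psi>_bounded: "\<And>a b. a < N \<Longrightarrow> b < N \<Longrightarrow> bounded_by 1 (\<lambda>x. \<psi> x a b)"
    and \<psi>_lipschitz: "\<And>a b. a < N \<Longrightarrow> b < N \<Longrightarrow> lipschitz C (\<lambda>x. \<psi> x a b)"
    and \<psi>_hermitian: "\<And>x a b. x \<in> carrier G \<Longrightarrow> a < N \<Longrightarrow> b < N \<Longrightarrow> \<psi> (inv x) b a = cnj (\<psi> x a b)"
    and C: "C \<ge> 0"
    and F: "nearly_invariant \<delta> F" and \<delta>: "\<delta> > 0"
    and E: "orthonormal_basis (F \<times> {..<N}) E"
    and eigen: "\<And>e j. e \<in> E \<Longrightarrow> j \<in> F \<times> {..<N} \<Longrightarrow>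
      mv (F \<times> {..<N}) (\<lambda>j k. \<psi> (fst j \<otimes> inv (fst k)) (snd j) (snd k) / of_nat (card F)) e j
        = complex_of_real (l e) * e j"
    and \<theta>: "\<theta> \<ge> 1/4" and \<gamma>: "\<gamma> > 0" and gap: "\<And>e. e \<in> E \<Longrightarrow> l e \<le> \<theta> \<or> l e > \<theta> + \<gamma>"
    and Q: "real (card {e\<in>E. l e > \<theta>}) \<le> Q"
begin

abbreviation J :: "('a \<times> nat) set" where "J \<equiv> F \<times> {..<N}"

definition M :: real where "M = real (card F)"

abbreviation A :: "'a \<times> nat \<Rightarrow> 'a \<times> nat \<Rightarrow> complex" where
  "A \<equiv> \<lambda>j k. \<psi> (fst j \<otimes> inv (fst k)) (snd j) (snd k) / of_nat (card F)"

definition S :: "('a \<times> nat \<Rightarrow> complex) set" where "S = {e\<in>E. l e > \<theta>}"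

text \<open>The eigenvector \<open>e\<close>, rescaled and extended from the finite set \<open>F\<close> to the whole group
  through the eigenvalue equation.\<close>
definition f :: "('a \<times> nat \<Rightarrow> complex) \<Rightarrow> nat \<Rightarrow> 'a \<Rightarrow> complex" where
  "f e a x = of_real (1 / (l e * sqrt M)) * (\<Sum>j\<in>J. \<psi> (x \<otimes> inv (fst j)) a (snd j) * e j)"

definition tr :: "'a \<Rightarrow> ('a \<times> nat \<Rightarrow> complex) \<Rightarrow> 'a \<times> nat \<Rightarrow> complex" where
  "tr g e j = of_real (1 / sqrt M) * f e (snd j) (fst j \<otimes> g)"

text \<open>The matrix of right translation by \<open>g\<close>, compressed to the span of
  \<open>S\<close>. Translating first by \<open>g\<close> and then by \<open>h\<close> evaluates at
  x h g, hence \<open>\<sigma>\<close> approximates a homomorphism rather than an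
  antihomomorphism.\<close>

definition \<sigma> :: "'a \<Rightarrow> ('a \<times> nat \<Rightarrow> complex) \<Rightarrow> ('a \<times> nat \<Rightarrow> complex) \<Rightarrow> complex" where
  "\<sigma> g e' e = ip J e' (tr g e)"

text \<open>A bound for \<open>f\<close> on the group: eigenvalues above 1/4 give the factor 4, and
  Cauchy--Schwarz over the \<open>M * N\<close> entries leaves sqrt N after the normalisation by
  sqrt M.\<close>

definition B :: real where "B = 4 * sqrt (real N)"

text \<open>The residual in \<open>tr_nearly_eigen\<close> divided by the gap: the norm that a
  translated eigenvector can have outside the span of \<open>S\<close>.\<close>

definition \<tau> :: real where "\<tau> = sqrt (real N) * (2 * real N * B * (B * C)) * \<delta> / \<gamma>"

lemma finF: "finite F" and F_sub: "F \<subseteq> carrier G" and F_ne: "F \<noteq> {}"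
  using F by (auto simp: nearly_invariant_def)

lemma F_carrier [simp]: "x \<in> F \<Longrightarrow> x \<in> carrier G"
  using F_sub by blast

lemma finJ: "finite J" using finF by simp

lemma M_pos: "M > 0" using finF F_ne by (simp add: M_def card_gt_0_iff)

lemma card_J: "real (card J) = M * real N" by (simp add: M_def card_cartesian_product)

lemma finE: "finite E" and oE: "orthonormal J E (\<lambda>e. e)"
  using E by (auto simp: orthonormal_basis_def)

lemma finS: "finite S" and S_E: "e \<in> S \<Longrightarrow> e \<in> E" and S_l: "e \<in> S \<Longrightarrow> l e > 1/4"
  using finE \<theta> by (auto simp: S_def)

lemma oS: "orthonormal J S (\<lambda>e. e)"
  using oE by (auto simp: orthonormal_def S_def)

lemma B_ge: "B \<ge> 0" by (simp add: B_def)

lemma \<tau>_ge: "\<tau> \<ge> 0" using \<delta> \<gamma> C B_ge by (simp add: \<tau>_def)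

lemma nrm_e: "e \<in> S \<Longrightarrow> nrm J e = 1" using orthonormal_nrm[OF oS] by simp

lemma nrm_le_const:
  assumes "\<And>j. j \<in> J \<Longrightarrow> cmod (h j) \<le> c / sqrt M" "c \<ge> 0"
  shows "nrm J h \<le> sqrt (real N) * c"
proof -
  have "nrm J h \<le> L2_set (\<lambda>j. c / sqrt M) J"
    unfolding nrm_def using assms by (intro L2_set_mono) auto
  also have "\<dots> = sqrt (M * real N) * (c / sqrt M)"
    using card_J assms(2) M_pos by (simp add: L2_set_constant abs_div)
  also have "\<dots> = sqrt (real N) * c" using M_pos by (simp add: real_sqrt_mult)
  finally show ?thesis .
qed

lemma sum_J_le:
  assumes "\<And>j. j \<in> J \<Longrightarrow> cmod (h j) \<le> K" "K \<ge> 0" "e \<in> S"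
  shows "cmod (\<Sum>j\<in>J. h j * e j) \<le> K * sqrt (M * real N)"
proof -
  have "cmod (\<Sum>j\<in>J. h j * e j) = cmod (ip J (\<lambda>j. cnj (h j)) e)" by (simp add: ip_def)
  also have "\<dots> \<le> nrm J (\<lambda>j. cnj (h j)) * nrm J e" by (rule cauchy_schwarz)
  also have "nrm J (\<lambda>j. cnj (h j)) \<le> L2_set (\<lambda>j. K) J"
    unfolding nrm_def using assms by (intro L2_set_mono) auto
  also have "L2_set (\<lambda>j. K) J = K * sqrt (M * real N)"
    using card_J assms(2) by (simp add: L2_set_constant)
  finally show ?thesis using nrm_e[OF assms(3)] by simp
qed

lemma f_factor:
  assumes "e \<in> S" "K \<ge> 0"
  shows "1 / (l e * sqrt M) * (K * sqrt (M * real N)) \<le> B * K"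
proof -
  have "1 / (l e * sqrt M) * (K * sqrt (M * real N)) = (1 / l e) * (sqrt (real N) * K)"
    using M_pos by (simp add: real_sqrt_mult)
  also have "\<dots> \<le> 4 * (sqrt (real N) * K)"
    using S_l[OF assms(1)] assms(2) by (intro mult_right_mono) (auto simp: field_simps)
  finally show ?thesis by (simp add: B_def)
qed

lemma f_bounded:
  assumes "e \<in> S" "a < N"
  shows "bounded_by B (f e a)"
  unfolding bounded_by_def
proof
  fix x assume x: "x \<in> carrier G"
  have l: "l e > 0" using S_l[OF assms(1)] by simp
  have "cmod (f e a x) = 1 / (l e * sqrt M) * cmod (\<Sum>j\<in>J. \<psi> (x \<otimes> inv (fst j)) a (snd j) * e j)"
    unfolding f_def norm_mult norm_of_real using l M_pos by simp
  also have "\<dots> \<le> 1 / (l e * sqrt M) * (1 * sqrt (M * real N))"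
    using \<psi>_bounded assms x l M_pos
    by (intro mult_left_mono sum_J_le) (auto simp: bounded_by_def)
  also have "\<dots> \<le> B * 1" using assms by (intro f_factor) auto
  finally show "cmod (f e a x) \<le> B" by simp
qed

lemma f_lipschitz:
  assumes "e \<in> S" "a < N"
  shows "lipschitz (B * C) (f e a)"
  unfolding lipschitz_def
proof (intro ballI)
  fix x y assume x: "x \<in> carrier G" and y: "y \<in> carrier G"
  have l: "l e > 0" using S_l[OF assms(1)] by simp
  have "f e a x - f e a y = of_real (1 / (l e * sqrt M)) *
      (\<Sum>j\<in>J. (\<psi> (x \<otimes> inv (fst j)) a (snd j) - \<psi> (y \<otimes> inv (fst j)) a (snd j)) * e j)"
    by (simp add: f_def left_diff_distrib sum_subtractf right_diff_distrib)
  hence "cmod (f e a x - f e a y) = 1 / (l e * sqrt M) *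
      cmod (\<Sum>j\<in>J. (\<psi> (x \<otimes> inv (fst j)) a (snd j) - \<psi> (y \<otimes> inv (fst j)) a (snd j)) * e j)"
    using l M_pos by (simp add: norm_mult norm_divide)
  also have "\<dots> \<le> 1 / (l e * sqrt M) * ((C * d x y) * sqrt (M * real N))"
  proof (intro mult_left_mono sum_J_le)
    fix j assume j: "j \<in> J"
    have "lipschitz C (\<lambda>x. \<psi> (x \<otimes> inv (fst j)) a (snd j))"
      using j assms by (intro lipschitz_translate[of C "\<lambda>x. \<psi> x a (snd j)"] \<psi>_lipschitz) auto
    thus "cmod (\<psi> (x \<otimes> inv (fst j)) a (snd j) - \<psi> (y \<otimes> inv (fst j)) a (snd j)) \<le> C * d x y"
      using x y by (simp add: lipschitz_def)
  qed (use l M_pos C assms in auto)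
  also have "\<dots> \<le> B * (C * d x y)" using assms C by (intro f_factor) auto
  finally show "cmod (f e a x - f e a y) \<le> B * C * d x y" by simp
qed

lemma f_on_F:
  assumes "e \<in> S" "j \<in> J"
  shows "f e (snd j) (fst j) = of_real (sqrt M) * e j"
proof -
  have l: "l e > 0" using S_l[OF assms(1)] by simp
  have "of_real (l e) * e j = (\<Sum>k\<in>J. \<psi> (fst j \<otimes> inv (fst k)) (snd j) (snd k) * e k) / of_real M"
    using eigen[OF S_E[OF assms(1)] assms(2)] by (simp add: mv_def M_def sum_divide_distrib)
  hence "(\<Sum>k\<in>J. \<psi> (fst j \<otimes> inv (fst k)) (snd j) (snd k) * e k) = of_real (l e * M) * e j"
    using M_pos by (simp add: field_simps)
  hence "f e (snd j) (fst j) = of_real (1 / (l e * sqrt M) * (l e * M)) * e j"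
    unfolding f_def by (simp only: of_real_mult mult.assoc)
  also have "1 / (l e * sqrt M) * (l e * M) = sqrt M"
    using l M_pos by (simp add: field_simps)
  finally show ?thesis .
qed

lemma tr_one: "e \<in> S \<Longrightarrow> j \<in> J \<Longrightarrow> tr \<one> e j = e j"
  using f_on_F[of e j] M_pos by (auto simp: tr_def mult.assoc[symmetric] simp flip: of_real_mult)

lemma tr_bound:
  assumes "e \<in> S" "g \<in> carrier G" "j \<in> J"
  shows "cmod (tr g e j) \<le> B / sqrt M"
proof -
  have "cmod (f e (snd j) (fst j \<otimes> g)) \<le> B" using f_bounded[of e "snd j"] assms by (auto simp: bounded_by_def)
  hence "cmod (f e (snd j) (fst j \<otimes> g)) / sqrt M \<le> B / sqrt M" using M_pos by (intro divide_right_mono) auto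
  thus ?thesis using M_pos unfolding tr_def norm_mult norm_of_real by simp
qed

lemma nrm_tr: "e \<in> S \<Longrightarrow> g \<in> carrier G \<Longrightarrow> nrm J (tr g e) \<le> sqrt (real N) * B"
  by (intro nrm_le_const tr_bound B_ge)

lemma \<sigma>_bound:
  assumes "e' \<in> S" "e \<in> S" "g \<in> carrier G"
  shows "cmod (\<sigma> g e' e) \<le> sqrt (real N) * B"
  using cauchy_schwarz[of J e' "tr g e"] nrm_e[OF assms(1)] nrm_tr[OF assms(2,3)]
  unfolding \<sigma>_def by simp

lemma \<sigma>_one: "e' \<in> S \<Longrightarrow> e \<in> S \<Longrightarrow> \<sigma> \<one> e' e = of_bool (e' = e)"
  using oS ip_cong[of J e' e' "tr \<one> e" e] tr_one by (simp add: \<sigma>_def orthonormal_def)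

lemma \<sigma>_lipschitz:
  assumes "e' \<in> S" "e \<in> S"
  shows "lipschitz (sqrt (real N) * (B * C)) (\<lambda>g. \<sigma> g e' e)"
  unfolding lipschitz_def
proof (intro ballI)
  fix g h assume g: "g \<in> carrier G" and h: "h \<in> carrier G"
  have "\<sigma> g e' e - \<sigma> h e' e = ip J e' (\<lambda>j. tr g e j - tr h e j)" by (simp add: \<sigma>_def ip_diff_right)
  also have "cmod \<dots> \<le> nrm J (\<lambda>j. tr g e j - tr h e j)"
    using cauchy_schwarz[of J e' "\<lambda>j. tr g e j - tr h e j"] nrm_e[OF assms(1)] by simp
  also have "\<dots> \<le> sqrt (real N) * (B * C * d g h)"
  proof (rule nrm_le_const)
    fix j assume j: "j \<in> J"
    have "cmod (f e (snd j) (fst j \<otimes> g) - f e (snd j) (fst j \<otimes> h)) \<le> B * C * d (fst j \<otimes> g) (fst j \<otimes> h)"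
      using f_lipschitz[of e "snd j"] j assms g h by (auto simp: lipschitz_def)
    also have "d (fst j \<otimes> g) (fst j \<otimes> h) = d g h" using j g h by (auto simp: left_invariant)
    finally have "cmod (f e (snd j) (fst j \<otimes> g) - f e (snd j) (fst j \<otimes> h)) / sqrt M \<le> B * C * d g h / sqrt M"
      using M_pos by (intro divide_right_mono) auto
    moreover have "tr g e j - tr h e j
        = of_real (1 / sqrt M) * (f e (snd j) (fst j \<otimes> g) - f e (snd j) (fst j \<otimes> h))"
      by (simp add: tr_def right_diff_distrib)
    ultimately show "cmod (tr g e j - tr h e j) \<le> B * C * d g h / sqrt M"
      using M_pos by (simp add: norm_mult norm_divide)
  qed (use B_ge C in simp)
  finally show "cmod (\<sigma> g e' e - \<sigma> h e' e) \<le> sqrt (real N) * (B * C) * d g h" by (simp add: mult.assoc)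
qed

text \<open>Convolution commutes with right translation. Replacing y by y g^-1 in the average of
  psi(x y^-1) f(y g) would give the average of psi(x g y^-1) f(y), which is l f(x g); on the net
  this substitution is \<open>sum_translate\<close> for \<open>h\<close>.\<close>

lemma tr_nearly_eigen:
  assumes e: "e \<in> S" and g: "g \<in> carrier G"
  shows "nrm J (\<lambda>j. mv J A (tr g e) j - of_real (l e) * tr g e j)
    \<le> sqrt (real N) * (2 * real N * B * (B * C) * \<delta>)"
proof (rule nrm_le_const)
  fix j assume j: "j \<in> J"
  define x a where "x = fst j" and "a = snd j"
  have x: "x \<in> carrier G" and a: "a < N" using j by (auto simp: x_def a_def)
  define h where "h y = (\<Sum>b<N. \<psi> (x \<otimes> g \<otimes> inv y) a b * f e b y)" for y
  have l: "l e > 0" using S_l[OF e] by simp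
  have hl: "lipschitz (2 * real N * B * (B * C)) h"
  proof -
    have 1: "lipschitz C (\<lambda>y. \<psi> (x \<otimes> g \<otimes> inv y) a b)" "bounded_by 1 (\<lambda>y. \<psi> (x \<otimes> g \<otimes> inv y) a b)" if "b < N" for b
    proof -
      show "lipschitz C (\<lambda>y. \<psi> (x \<otimes> g \<otimes> inv y) a b)"
        using that a x g by (intro lipschitz_inv_translate[of C "\<lambda>z. \<psi> z a b"] \<psi>_lipschitz) auto
      show "bounded_by 1 (\<lambda>y. \<psi> (x \<otimes> g \<otimes> inv y) a b)"
        using \<psi>_bounded[OF a that] x g by (simp add: bounded_by_def)
    qed
    have "lipschitz (real (card {..<N}) * (1 * (B * C) + C * B)) h"
      unfolding h_def[abs_def]
      by (intro lipschitz_sum lipschitz_mult 1 f_lipschitz f_bounded e) auto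
    \<comment> \<open>Coarsens the Lipschitz constant of \<open>h\<close> by a factor
      \<open>B\<close>, to the form that \<open>ip_translate\<close> produces with Lipschitz
      constant \<open>B * C\<close>.\<close>
    moreover have "B \<ge> 1"
    proof -
      have "sqrt (real N) \<ge> 1" using N by simp
      thus ?thesis unfolding B_def by linarith
    qed
    hence "1 * (B * C) \<le> B * (B * C)" using C B_ge by (intro mult_right_mono) auto
    hence "real N * (1 * (B * C) + C * B) \<le> real N * (2 * (B * (B * C)))"
      by (intro mult_left_mono) (auto simp: algebra_simps)
    ultimately show ?thesis by (elim lipschitz_mono) (simp add: algebra_simps)
  qed
  have 1: "mv J A (tr g e) j = of_real (1 / (M * sqrt M)) * (\<Sum>y\<in>F. h (y \<otimes> g))"
  proof -
    have "mv J A (tr g e) j = (\<Sum>k\<in>J. of_real (1 / (M * sqrt M)) *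
        (\<psi> (x \<otimes> inv (fst k)) a (snd k) * f e (snd k) (fst k \<otimes> g)))"
      by (simp add: mv_def tr_def x_def a_def M_def)
    also have "\<dots> = of_real (1 / (M * sqrt M)) *
        (\<Sum>y\<in>F. \<Sum>b<N. \<psi> (x \<otimes> inv y) a b * f e b (y \<otimes> g))"
      by (simp add: sum_distrib_left sum.cartesian_product case_prod_unfold)
    also have "(\<Sum>y\<in>F. \<Sum>b<N. \<psi> (x \<otimes> inv y) a b * f e b (y \<otimes> g)) = (\<Sum>y\<in>F. h (y \<otimes> g))"
    proof (rule sum.cong[OF refl])
      fix y assume "y \<in> F"
      hence y: "y \<in> carrier G" by simp
      have "x \<otimes> g \<otimes> inv (y \<otimes> g) = x \<otimes> inv y"
        using x y g by (simp add: inv_mult_group m_assoc) (simp flip: m_assoc)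
      thus "(\<Sum>b<N. \<psi> (x \<otimes> inv y) a b * f e b (y \<otimes> g)) = h (y \<otimes> g)" by (simp add: h_def)
    qed
    finally show ?thesis .
  qed
  have 2: "of_real (l e) * tr g e j = of_real (1 / (M * sqrt M)) * (\<Sum>y\<in>F. h y)"
  proof -
    have "of_real (l e) * tr g e j = of_real (l e * (1 / sqrt M) * (1 / (l e * sqrt M))) *
        (\<Sum>k\<in>J. \<psi> (x \<otimes> g \<otimes> inv (fst k)) a (snd k) * e k)"
      unfolding tr_def f_def x_def a_def by (simp only: of_real_mult mult.assoc)
    also have "l e * (1 / sqrt M) * (1 / (l e * sqrt M)) = 1 / (M * sqrt M) * sqrt M"
      using l M_pos by (simp add: field_simps)
    also have "of_real (1 / (M * sqrt M) * sqrt M) * (\<Sum>k\<in>J. \<psi> (x \<otimes> g \<otimes> inv (fst k)) a (snd k) * e k)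
       = of_real (1 / (M * sqrt M)) * (\<Sum>k\<in>J. \<psi> (x \<otimes> g \<otimes> inv (fst k)) a (snd k) * (of_real (sqrt M) * e k))"
      unfolding of_real_mult by (simp add: sum_distrib_left mult_ac)
    also have "(\<Sum>k\<in>J. \<psi> (x \<otimes> g \<otimes> inv (fst k)) a (snd k) * (of_real (sqrt M) * e k)) = (\<Sum>y\<in>F. h y)"
    proof -
      have "(\<Sum>k\<in>J. \<psi> (x \<otimes> g \<otimes> inv (fst k)) a (snd k) * (of_real (sqrt M) * e k))
          = (\<Sum>k\<in>J. \<psi> (x \<otimes> g \<otimes> inv (fst k)) a (snd k) * f e (snd k) (fst k))"
        using f_on_F[OF e] by (intro sum.cong) simp_all
      thus ?thesis by (simp add: h_def sum.cartesian_product case_prod_unfold)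
    qed
    finally show ?thesis .
  qed
  have "cmod (mv J A (tr g e) j - of_real (l e) * tr g e j)
      = 1 / (M * sqrt M) * cmod ((\<Sum>y\<in>F. h (y \<otimes> g)) - (\<Sum>y\<in>F. h y))"
    unfolding 1 2 right_diff_distrib[symmetric] norm_mult norm_of_real using M_pos by simp
  also have "\<dots> \<le> 1 / (M * sqrt M) * (real (card F) * (2 * real N * B * (B * C) * \<delta>))"
    using M_pos B_ge C by (intro mult_left_mono sum_translate F hl g) auto
  also have "\<dots> = 2 * real N * B * (B * C) * \<delta> / sqrt M"
    using M_pos by (simp add: M_def[symmetric])
  finally show "cmod (mv J A (tr g e) j - of_real (l e) * tr g e j) \<le> 2 * real N * B * (B * C) * \<delta> / sqrt M" .
qed (use B_ge C \<delta> in simp)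

end

lemma nrm_Times:
  "(nrm (I \<times> J) h)\<^sup>2 = (\<Sum>i\<in>I. (nrm J (\<lambda>j. h (i, j)))\<^sup>2)"
  unfolding nrm_power2 by (simp add: sum.cartesian_product)

lemma nrm_swap: "nrm (I \<times> J) h = nrm (J \<times> I) (\<lambda>p. h (snd p, fst p))"
proof -
  have "(nrm (I \<times> J) h)\<^sup>2 = (nrm (J \<times> I) (\<lambda>p. h (snd p, fst p)))\<^sup>2"
    unfolding nrm_Times unfolding nrm_power2 by (subst sum.swap) simp
  thus ?thesis by simp
qed

lemma sqrt_power2_add_le: "x \<ge> 0 \<Longrightarrow> y \<ge> 0 \<Longrightarrow> sqrt (x\<^sup>2 + y) \<le> x + sqrt y"
  using sqrt_add_le_add_sqrt[of "x\<^sup>2" y] by simp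

context discrete_model
begin

lemma hermitian_A: "hermitian_on J A"
  using F_sub \<psi>_hermitian by (intro hermitian_convolution) auto

lemma ip_eigen:
  assumes "e \<in> E"
  shows "ip J e (mv J A h) = of_real (l e) * ip J e h"
proof -
  have "ip J e (mv J A h) = ip J (mv J A e) h" by (simp add: ip_mv[OF hermitian_A])
  also have "\<dots> = ip J (\<lambda>j. of_real (l e) * e j) h" by (intro ip_cong eigen assms) auto
  finally show ?thesis by (simp add: ip_scale_left)
qed

definition S' :: "('a \<times> nat \<Rightarrow> complex) set" where "S' = {e\<in>E. \<not> l e > \<theta>}"

lemma sum_E_split: "(\<Sum>e\<in>E. h e) = (\<Sum>e\<in>S. h e) + (\<Sum>e\<in>S'. h e)" for h :: "_ \<Rightarrow> 'z :: comm_monoid_add"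
proof -
  have "E = S \<union> S'" "S \<inter> S' = {}" by (auto simp: S_def S'_def)
  moreover have "finite S" "finite S'" using finE by (auto simp: S_def S'_def)
  ultimately show ?thesis using sum.union_disjoint[of S S' h] by metis
qed

text \<open>The spectral gap turns near eigenfunctions into near elements of the span of \<open>S\<close>.\<close>
lemma tr_tail:
  assumes e: "e \<in> S" and g: "g \<in> carrier G"
  shows "(\<Sum>e'\<in>S'. (cmod (ip J e' (tr g e)))\<^sup>2) \<le> \<tau>\<^sup>2"
proof -
  define r where "r j = mv J A (tr g e) j - of_real (l e) * tr g e j" for j
  define c where "c = sqrt (real N) * (2 * real N * B * (B * C) * \<delta>)"
  have "\<gamma>\<^sup>2 * (\<Sum>e'\<in>S'. (cmod (ip J e' (tr g e)))\<^sup>2) \<le> (\<Sum>e'\<in>S'. (cmod (ip J e' r))\<^sup>2)"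
    unfolding sum_distrib_left
  proof (rule sum_mono)
    fix e' assume e': "e' \<in> S'"
    have e'E: "e' \<in> E" using e' by (simp add: S'_def)
    have "ip J e' r = of_real (l e' - l e) * ip J e' (tr g e)"
      unfolding r_def[abs_def] by (simp add: ip_diff_right ip_scale_right ip_eigen[OF e'E] left_diff_distrib)
    hence "cmod (ip J e' r) = \<bar>l e' - l e\<bar> * cmod (ip J e' (tr g e))" by (simp add: norm_mult flip: of_real_diff)
    \<comment> \<open>\<open>e\<close> is above the cut, hence above the gap, whereas
      \<open>e'\<close> is at or below the cut.\<close>
    moreover have "\<gamma> \<le> \<bar>l e' - l e\<bar>" using gap[OF S_E[OF e]] e e' by (auto simp: S_def S'_def)
    ultimately have "\<gamma> * cmod (ip J e' (tr g e)) \<le> cmod (ip J e' r)" by (simp add: mult_right_mono)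
    hence "(\<gamma> * cmod (ip J e' (tr g e)))\<^sup>2 \<le> (cmod (ip J e' r))\<^sup>2" using \<gamma> by (intro power_mono) auto
    thus "\<gamma>\<^sup>2 * (cmod (ip J e' (tr g e)))\<^sup>2 \<le> (cmod (ip J e' r))\<^sup>2" by (simp add: power_mult_distrib)
  qed
  also have "\<dots> \<le> (\<Sum>e'\<in>E. (cmod (ip J e' r))\<^sup>2)"
    using finE by (intro sum_mono2) (auto simp: S'_def)
  also have "\<dots> \<le> (nrm J r)\<^sup>2" using bessel_inequality[OF finE oE] by simp
  also have "\<dots> \<le> c\<^sup>2"
    using tr_nearly_eigen[OF e g] unfolding r_def[abs_def] c_def by (intro power_mono) auto
  finally have "(\<Sum>e'\<in>S'. (cmod (ip J e' (tr g e)))\<^sup>2) \<le> c\<^sup>2 / \<gamma>\<^sup>2"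
    using \<gamma> by (simp add: pos_le_divide_eq mult.commute)
  also have "c\<^sup>2 / \<gamma>\<^sup>2 = \<tau>\<^sup>2" by (simp add: c_def \<tau>_def power_divide mult.assoc)
  finally show ?thesis .
qed

lemma nrm_remainder:
  "(nrm J (\<lambda>j. h j - (\<Sum>e\<in>S. ip J e h * e j)))\<^sup>2 = (\<Sum>e\<in>S'. (cmod (ip J e h))\<^sup>2)"
proof -
  have "(nrm J (\<lambda>j. h j - (\<Sum>e\<in>S. ip J e h * e j)))\<^sup>2
      = (nrm J (\<lambda>j. complex_of_real 1 * h j - (\<Sum>e\<in>S. ip J e h * e j)))\<^sup>2" by simp
  also have "\<dots> = (nrm J h)\<^sup>2 - (\<Sum>e\<in>S. (cmod (ip J e h))\<^sup>2)"
    unfolding bessel_identity[OF finS oS] by simp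
  also have "\<dots> = (\<Sum>e\<in>S'. (cmod (ip J e h))\<^sup>2)"
    unfolding parseval[OF finJ E] sum_E_split by simp
  finally show ?thesis .
qed

lemma nrm_tr_remainder:
  assumes "e \<in> S" "g \<in> carrier G"
  shows "nrm J (\<lambda>j. tr g e j - (\<Sum>e'\<in>S. \<sigma> g e' e * e' j)) \<le> \<tau>"
proof -
  have "(nrm J (\<lambda>j. tr g e j - (\<Sum>e'\<in>S. \<sigma> g e' e * e' j)))\<^sup>2 \<le> \<tau>\<^sup>2"
    unfolding \<sigma>_def nrm_remainder by (rule tr_tail[OF assms])
  thus ?thesis using \<tau>_ge by (rule power2_le_imp_le)
qed

text \<open>A bound for the remainder \<open>u\<close> in \<open>\<sigma>_mult\<close>:
  \<open>B\<close> for the translated eigenfunction and at most \<open>Q\<close> further terms, each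
  a coefficient of size at most sqrt N * B times a function bounded by \<open>B\<close>. Its
  Lipschitz constant is \<open>D1 * C\<close>.\<close>

definition D1 :: real where "D1 = B + Q * (sqrt (real N) * B) * B"

lemma Q_ge: "Q \<ge> 0" using Q by linarith

lemma card_S: "real (card S) \<le> Q" using Q by (simp add: S_def)

lemma D1_ge: "D1 \<ge> 0" using Q_ge B_ge by (simp add: D1_def)

text \<open>The defect is the translate by \<open>h\<close> of the part of the
  \<open>g\<close>-translate of \<open>e\<close> outside the span of \<open>S\<close>. That part has
  norm at most \<open>\<tau>\<close> on the net; extended to the Lipschitz function
  \<open>u\<close>, it keeps this norm under translation up to \<open>nrm_translate\<close>.\<close>

lemma \<sigma>_mult:
  assumes e': "e' \<in> S" and e: "e \<in> S" and h: "h \<in> carrier G" and g: "g \<in> carrier G"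
  shows "cmod (\<sigma> (h \<otimes> g) e' e - (\<Sum>k\<in>S. \<sigma> h e' k * \<sigma> g k e)) \<le> \<tau> + sqrt (2 * real N * D1 * (D1 * C) * \<delta>)"
proof -
  define u where "u a x = f e a (x \<otimes> g) - (\<Sum>k\<in>S. \<sigma> g k e * f k a x)" for a x
  have sB: "sqrt (real N) * B \<ge> 0" using B_ge by simp
  have ul: "lipschitz (D1 * C) (u a)" if "a < N" for a
  proof -
    have "lipschitz (B * C + real (card S) * ((sqrt (real N) * B) * (B * C))) (u a)"
      unfolding u_def[abs_def] using that e g B_ge C
      by (intro lipschitz_diff lipschitz_translate[of _ "f e a"] lipschitz_sum lipschitz_scale \<sigma>_bound f_lipschitz)
        auto
    moreover have "real (card S) * ((sqrt (real N) * B) * (B * C)) \<le> Q * ((sqrt (real N) * B) * (B * C))"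
      using card_S sB B_ge C by (intro mult_right_mono) auto
    ultimately show ?thesis by (elim lipschitz_mono) (simp add: D1_def algebra_simps)
  qed
  have ub: "bounded_by D1 (u a)" if "a < N" for a
  proof -
    have "bounded_by (B + real (card S) * ((sqrt (real N) * B) * B)) (u a)"
      unfolding u_def[abs_def] using that e g B_ge sB
      by (intro bounded_by_diff bounded_by_translate[of _ "f e a"] bounded_by_sum bounded_by_scale \<sigma>_bound f_bounded)
        auto
    moreover have "real (card S) * ((sqrt (real N) * B) * B) \<le> Q * ((sqrt (real N) * B) * B)"
      using card_S sB B_ge by (intro mult_right_mono) auto
    ultimately show ?thesis by (elim bounded_by_mono) (simp add: D1_def algebra_simps)
  qed
  have "nrm J (\<lambda>j. u (snd j) (fst j)) = nrm J (\<lambda>j. of_real (sqrt M) * (tr g e j - (\<Sum>k\<in>S. \<sigma> g k e * k j)))"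
  proof (rule nrm_cong)
    fix j assume j: "j \<in> J"
    have "(\<Sum>k\<in>S. \<sigma> g k e * f k (snd j) (fst j)) = of_real (sqrt M) * (\<Sum>k\<in>S. \<sigma> g k e * k j)"
      using f_on_F j by (simp add: sum_distrib_left mult_ac)
    thus "u (snd j) (fst j) = of_real (sqrt M) * (tr g e j - (\<Sum>k\<in>S. \<sigma> g k e * k j))"
      using M_pos by (simp add: u_def tr_def right_diff_distrib)
  qed
  also have "\<dots> \<le> sqrt M * \<tau>"
    unfolding nrm_scale using nrm_tr_remainder[OF e g] M_pos by (simp add: mult_left_mono)
  finally have "(nrm J (\<lambda>j. u (snd j) (fst j)))\<^sup>2 \<le> (sqrt M * \<tau>)\<^sup>2" by (intro power_mono) auto
  also have "\<dots> = M * \<tau>\<^sup>2" using M_pos by (simp add: power_mult_distrib)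
  finally have n1: "(nrm J (\<lambda>j. u (snd j) (fst j \<otimes> h)))\<^sup>2 \<le> M * (\<tau>\<^sup>2 + 2 * real N * D1 * (D1 * C) * \<delta>)"
    using nrm_translate[of \<delta> F h N "D1 * C" u D1, OF F h ul ub] D1_ge C
    by (simp add: M_def distrib_left)
  have "\<sigma> (h \<otimes> g) e' e - (\<Sum>k\<in>S. \<sigma> h e' k * \<sigma> g k e)
      = ip J e' (\<lambda>j. tr (h \<otimes> g) e j - (\<Sum>k\<in>S. \<sigma> g k e * tr h k j))"
    unfolding \<sigma>_def ip_diff_right ip_sum_right ip_scale_right by (simp add: mult.commute)
  also have "\<dots> = ip J e' (\<lambda>j. of_real (1 / sqrt M) * u (snd j) (fst j \<otimes> h))"
  proof (rule ip_cong[OF refl])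
    fix j assume j: "j \<in> J"
    have "fst j \<otimes> (h \<otimes> g) = fst j \<otimes> h \<otimes> g" using j g h by (auto simp: m_assoc)
    thus "tr (h \<otimes> g) e j - (\<Sum>k\<in>S. \<sigma> g k e * tr h k j) = of_real (1 / sqrt M) * u (snd j) (fst j \<otimes> h)"
      by (simp add: tr_def u_def right_diff_distrib sum_distrib_left mult_ac)
  qed
  also have "cmod \<dots> \<le> nrm J e' * nrm J (\<lambda>j. of_real (1 / sqrt M) * u (snd j) (fst j \<otimes> h))"
    by (rule cauchy_schwarz)
  also have "\<dots> = nrm J (\<lambda>j. u (snd j) (fst j \<otimes> h)) / sqrt M"
    unfolding nrm_scale nrm_e[OF e'] using M_pos by (simp add: norm_divide)
  also have "\<dots> \<le> sqrt (M * (\<tau>\<^sup>2 + 2 * real N * D1 * (D1 * C) * \<delta>)) / sqrt M"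
    using real_le_rsqrt[OF n1] M_pos by (intro divide_right_mono) auto
  also have "\<dots> = sqrt (\<tau>\<^sup>2 + 2 * real N * D1 * (D1 * C) * \<delta>)"
    using M_pos by (simp add: real_sqrt_mult)
  also have "\<dots> \<le> \<tau> + sqrt (2 * real N * D1 * (D1 * C) * \<delta>)"
    using \<tau>_ge D1_ge C \<delta> by (intro sqrt_power2_add_le) auto
  finally show ?thesis .
qed

text \<open>By \<open>ip_translate\<close> the translated eigenvectors have nearly the identity as
  Gram matrix; passing to their components in \<open>S\<close> loses an inner product of two tails,
  each of norm at most \<open>\<tau>\<close>.\<close>

lemma \<sigma>_unitary:
  assumes e: "e \<in> S" and e': "e' \<in> S" and g: "g \<in> carrier G"
  shows "cmod ((\<Sum>k\<in>S. cnj (\<sigma> g k e) * \<sigma> g k e') - of_bool (e = e')) \<le> \<tau>\<^sup>2 + 2 * real N * B * (B * C) * \<delta>"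
proof -
  have scaled: "ip J (\<lambda>j. of_real (1 / sqrt M) * p j) (\<lambda>j. of_real (1 / sqrt M) * q j) = of_real (1 / M) * ip J p q" for p q
    unfolding ip_scale_left ip_scale_right using M_pos
    by (simp add: mult.assoc[symmetric] flip: of_real_mult)
  have "ip J (tr g e) (tr g e') = of_real (1 / M) * ip J (\<lambda>j. f e (snd j) (fst j \<otimes> g)) (\<lambda>j. f e' (snd j) (fst j \<otimes> g))"
    unfolding tr_def[abs_def] scaled ..
  moreover have "of_bool (e = e') = of_real (1 / M) * ip J (\<lambda>j. f e (snd j) (fst j)) (\<lambda>j. f e' (snd j) (fst j))"
  proof -
    have "of_bool (e = e') = ip J e e'" using oS e e' by (simp add: orthonormal_def)
    also have "\<dots> = ip J (\<lambda>j. of_real (1 / sqrt M) * f e (snd j) (fst j)) (\<lambda>j. of_real (1 / sqrt M) * f e' (snd j) (fst j))"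
    proof (rule ip_cong)
      fix j assume "j \<in> J"
      thus "e j = of_real (1 / sqrt M) * f e (snd j) (fst j)" "e' j = of_real (1 / sqrt M) * f e' (snd j) (fst j)"
        using f_on_F[OF e, of j] f_on_F[OF e', of j] M_pos by simp_all
    qed
    finally show ?thesis unfolding scaled .
  qed
  ultimately have "ip J (tr g e) (tr g e') - of_bool (e = e') = of_real (1 / M) *
     (ip J (\<lambda>j. f e (snd j) (fst j \<otimes> g)) (\<lambda>j. f e' (snd j) (fst j \<otimes> g))
       - ip J (\<lambda>j. f e (snd j) (fst j)) (\<lambda>j. f e' (snd j) (fst j)))" by (simp only: right_diff_distrib)
  hence "cmod (ip J (tr g e) (tr g e') - of_bool (e = e')) = 1 / M * cmod
     (ip J (\<lambda>j. f e (snd j) (fst j \<otimes> g)) (\<lambda>j. f e' (snd j) (fst j \<otimes> g))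
       - ip J (\<lambda>j. f e (snd j) (fst j)) (\<lambda>j. f e' (snd j) (fst j)))"
    using M_pos by (simp only: norm_mult norm_of_real) simp
  also have "\<dots> \<le> 1 / M * (real (card F) * (2 * real N * B * (B * C) * \<delta>))"
    using M_pos B_ge C e e'
    by (intro mult_left_mono ip_translate[OF F g] f_lipschitz f_bounded) auto
  also have "\<dots> = 2 * real N * B * (B * C) * \<delta>" using M_pos by (simp add: M_def[symmetric])
  finally have 1: "cmod (ip J (tr g e) (tr g e') - of_bool (e = e')) \<le> 2 * real N * B * (B * C) * \<delta>" .
  have 2: "(\<Sum>k\<in>S. cnj (\<sigma> g k e) * \<sigma> g k e') = ip J (tr g e) (tr g e')
      - ip S' (\<lambda>k. ip J k (tr g e)) (\<lambda>k. ip J k (tr g e'))"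
    using parseval_ip[OF finJ E, of "tr g e" "tr g e'"] unfolding sum_E_split \<sigma>_def ip_def[of S'] by simp
  have n: "nrm S' (\<lambda>k. ip J k (tr g e)) \<le> \<tau>" if "e \<in> S" for e
  proof -
    have "(nrm S' (\<lambda>k. ip J k (tr g e)))\<^sup>2 \<le> \<tau>\<^sup>2" unfolding nrm_power2 by (rule tr_tail[OF that g])
    thus ?thesis using \<tau>_ge by (rule power2_le_imp_le)
  qed
  have "cmod (ip S' (\<lambda>k. ip J k (tr g e)) (\<lambda>k. ip J k (tr g e'))) \<le>
      nrm S' (\<lambda>k. ip J k (tr g e)) * nrm S' (\<lambda>k. ip J k (tr g e'))" by (rule cauchy_schwarz)
  also have "\<dots> \<le> \<tau> * \<tau>" using n[OF e] n[OF e'] \<tau>_ge by (intro mult_mono) auto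
  finally have 3: "cmod (ip S' (\<lambda>k. ip J k (tr g e)) (\<lambda>k. ip J k (tr g e'))) \<le> \<tau>\<^sup>2" by (simp add: power2_eq_square)
  have comm: "a - b - c = a - c - b" for a b c :: complex by simp
  have 4: "(\<Sum>k\<in>S. cnj (\<sigma> g k e) * \<sigma> g k e') - of_bool (e = e')
     = (ip J (tr g e) (tr g e') - of_bool (e = e')) - ip S' (\<lambda>k. ip J k (tr g e)) (\<lambda>k. ip J k (tr g e'))"
    unfolding 2 by (rule comm)
  show ?thesis
    unfolding 4 add.commute[of "\<tau>\<^sup>2"]
    by (rule order_trans[OF norm_triangle_ineq4 add_mono[OF 1 3]])
qed

end

text \<open>\<open>u\<close> is the given map, possibly discontinuous, and \<open>v\<close> a
  Lipschitz approximation uniform over the group. \<open>\<kappa>2\<close> measures the failure of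
  multiplicativity, and \<open>K\<close> the part of the columns of \<open>u\<close> outside the
  spectral subspace, in Hilbert--Schmidt norm.\<close>

locale unitary_model = discrete_model +
  fixes u v :: "'a \<Rightarrow> nat \<Rightarrow> nat \<Rightarrow> complex" and Cv K \<kappa>1 \<kappa>2 :: real
  assumes u_unitary: "\<And>x b c. x \<in> carrier G \<Longrightarrow> b < N \<Longrightarrow> c < N \<Longrightarrow>
      (\<Sum>a<N. cnj (u x a b) * u x a c) = of_bool (b = c)"
    and v_bounded: "\<And>a b. a < N \<Longrightarrow> b < N \<Longrightarrow> bounded_by 1 (\<lambda>x. v x a b)"
    and v_lipschitz: "\<And>a b. a < N \<Longrightarrow> b < N \<Longrightarrow> lipschitz Cv (\<lambda>x. v x a b)"
    and v_close: "\<And>x. x \<in> carrier G \<Longrightarrow>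
      nrm ({..<N} \<times> {..<N}) (\<lambda>p. v x (fst p) (snd p) - u x (fst p) (snd p)) \<le> \<kappa>1"
    and u_mult: "\<And>x g. x \<in> carrier G \<Longrightarrow> g \<in> carrier G \<Longrightarrow>
      nrm ({..<N} \<times> {..<N}) (\<lambda>p. (\<Sum>c<N. cnj (u x c (fst p)) * u (x \<otimes> g) c (snd p)) - u g (fst p) (snd p)) \<le> \<kappa>2"
    and tail: "(\<Sum>e\<in>S'. \<Sum>b<N. (cmod (ip J (\<lambda>j. u (fst j) (snd j) b / of_real (sqrt M)) e))\<^sup>2) \<le> K\<^sup>2"
    and Cv: "Cv \<ge> 0" and K: "K \<ge> 0"
begin

definition w :: "nat \<Rightarrow> 'a \<times> nat \<Rightarrow> complex" where
  "w b j = u (fst j) (snd j) b / of_real (sqrt M)"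

definition Z :: "'a \<Rightarrow> nat \<Rightarrow> 'a \<times> nat \<Rightarrow> complex" where
  "Z g b j = u (fst j \<otimes> g) (snd j) b / of_real (sqrt M)"

text \<open>The isometric embedding \<open>w\<close> followed by the orthogonal projection onto the
  span of \<open>S\<close>, in coordinates; hence a contraction together with its adjoint.\<close>

definition T :: "('a \<times> nat \<Rightarrow> complex) \<Rightarrow> nat \<Rightarrow> complex" where
  "T e b = ip J e (w b)"

lemma ow: "orthonormal J {..<N} w"
  unfolding w_def[abs_def] M_def using u_unitary by (intro orthonormal_columns finF F_ne) simp

lemma oZ: "g \<in> carrier G \<Longrightarrow> orthonormal J {..<N} (Z g)"
  unfolding Z_def[abs_def] M_def using u_unitary
  by (intro orthonormal_columns[of F N "\<lambda>x. u (x \<otimes> g)"] finF F_ne) simp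

lemma tail_w: "(\<Sum>b<N. (nrm J (\<lambda>j. w b j - (\<Sum>e\<in>S. T e b * e j)))\<^sup>2) \<le> K\<^sup>2"
  using tail unfolding T_def nrm_remainder
  by (subst sum.swap) (simp add: w_def[abs_def] cmod_ip_commute)

lemma T_bound: "e \<in> S \<Longrightarrow> b < N \<Longrightarrow> cmod (T e b) \<le> 1"
  using cauchy_schwarz[of J e "w b"] orthonormal_nrm[OF ow, of b] nrm_e[of e] by (simp add: T_def)

lemma T_contraction: "(\<Sum>e\<in>S. (cmod (\<Sum>b<N. T e b * z b))\<^sup>2) \<le> (\<Sum>b<N. (cmod (z b))\<^sup>2)"
proof -
  have "(\<Sum>b<N. T e b * z b) = ip J e (\<lambda>j. \<Sum>b<N. z b * w b j)" for e
    by (simp add: T_def ip_sum_right ip_scale_right mult.commute)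
  hence "(\<Sum>e\<in>S. (cmod (\<Sum>b<N. T e b * z b))\<^sup>2) \<le> (nrm J (\<lambda>j. \<Sum>b<N. z b * w b j))\<^sup>2"
    using bessel_inequality[OF finS oS] by simp
  thus ?thesis using nrm_orthonormal_sum[OF _ ow] by simp
qed

lemma T_adjoint_contraction: "(\<Sum>a<N. (cmod (\<Sum>e\<in>S. cnj (T e a) * z e))\<^sup>2) \<le> (\<Sum>e\<in>S. (cmod (z e))\<^sup>2)"
proof -
  have "(\<Sum>e\<in>S. cnj (T e a) * z e) = ip J (w a) (\<lambda>j. \<Sum>e\<in>S. z e * e j)" for a
    unfolding T_def cnj_ip ip_sum_right ip_scale_right by (simp add: mult.commute)
  hence "(\<Sum>a<N. (cmod (\<Sum>e\<in>S. cnj (T e a) * z e))\<^sup>2) \<le> (nrm J (\<lambda>j. \<Sum>e\<in>S. z e * e j))\<^sup>2"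
    using bessel_inequality[OF _ ow] by simp
  thus ?thesis using nrm_orthonormal_sum[OF finS oS] by simp
qed

text \<open>On the net this is sqrt M times the projection of the column \<open>w b\<close> to the
  spectral subspace, so it approximates the entry (a, b) of \<open>u\<close>. Unlike
  \<open>u\<close> it is Lipschitz on the group.\<close>

definition U :: "nat \<Rightarrow> nat \<Rightarrow> 'a \<Rightarrow> complex" where
  "U b a x = (\<Sum>e\<in>S. T e b * f e a x)"

definition D2 :: real where "D2 = Q * B + 1"
definition L2 :: real where "L2 = Q * (B * C) + Cv"

lemma L2_ge: "L2 \<ge> 0" and D2_ge: "D2 \<ge> 0"
  using Q_ge B_ge C Cv by (simp_all add: L2_def D2_def)

lemma U_minus_v:
  assumes "a < N" "b < N"
  shows "lipschitz L2 (\<lambda>x. U b a x - v x a b)" "bounded_by D2 (\<lambda>x. U b a x - v x a b)"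
proof -
  have "lipschitz (real (card S) * (1 * (B * C)) + Cv) (\<lambda>x. U b a x - v x a b)"
    unfolding U_def[abs_def] using assms B_ge C
    by (intro lipschitz_diff lipschitz_sum lipschitz_scale T_bound f_lipschitz v_lipschitz) auto
  moreover have "real (card S) * (B * C) \<le> Q * (B * C)"
    using card_S B_ge C by (intro mult_right_mono) auto
  ultimately show "lipschitz L2 (\<lambda>x. U b a x - v x a b)" by (elim lipschitz_mono) (simp add: L2_def)
  have "bounded_by (real (card S) * (1 * B) + 1) (\<lambda>x. U b a x - v x a b)"
    unfolding U_def[abs_def] using assms B_ge
    by (intro bounded_by_diff bounded_by_sum bounded_by_scale T_bound f_bounded v_bounded) auto
  moreover have "real (card S) * B \<le> Q * B"
    using card_S B_ge by (intro mult_right_mono) auto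
  ultimately show "bounded_by D2 (\<lambda>x. U b a x - v x a b)" by (elim bounded_by_mono) (simp add: D2_def)
qed

text \<open>\<open>v_close\<close> is uniform in the point, so arbitrary evaluation points
  \<open>s x\<close> are allowed, and the bound applies to the net and to its translates without any
  continuity of \<open>u\<close>.\<close>

lemma avg_close:
  assumes s: "\<And>x. x \<in> F \<Longrightarrow> s x \<in> carrier G"
  shows "nrm ({..<N} \<times> J) (\<lambda>q. (v (s (fst (snd q))) (snd (snd q)) (fst q) - u (s (fst (snd q))) (snd (snd q)) (fst q))
      / of_real (sqrt M)) \<le> \<kappa>1"
proof -
  have \<kappa>1: "\<kappa>1 \<ge> 0" using v_close[of "\<one>"] nrm_nonneg order_trans by blast
  have "(nrm ({..<N} \<times> J) (\<lambda>q. (v (s (fst (snd q))) (snd (snd q)) (fst q) - u (s (fst (snd q))) (snd (snd q)) (fst q))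
      / of_real (sqrt M)))\<^sup>2 = (\<Sum>b<N. \<Sum>x\<in>F. \<Sum>a<N. (cmod (v (s x) a b - u (s x) a b))\<^sup>2 / M)"
    unfolding nrm_power2 using M_pos
    by (simp add: sum.cartesian_product case_prod_unfold norm_divide power_divide)
  also have "\<dots> = (\<Sum>x\<in>F. \<Sum>b<N. \<Sum>a<N. (cmod (v (s x) a b - u (s x) a b))\<^sup>2 / M)"
    by (rule sum.swap)
  also have "\<dots> = (\<Sum>x\<in>F. (nrm ({..<N} \<times> {..<N}) (\<lambda>p. v (s x) (fst p) (snd p) - u (s x) (fst p) (snd p)))\<^sup>2 / M)"
    unfolding nrm_power2
    by (intro sum.cong refl, subst sum.swap)
      (simp add: sum.cartesian_product case_prod_unfold sum_divide_distrib)
  also have "\<dots> \<le> (\<Sum>x\<in>F. \<kappa>1\<^sup>2 / M)"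
    using M_pos s by (intro sum_mono divide_right_mono power_mono v_close) auto
  also have "\<dots> = \<kappa>1\<^sup>2" using M_pos by (simp add: M_def)
  finally show ?thesis using \<kappa>1 by (rule power2_le_imp_le)
qed

text \<open>\<open>u\<close> cannot be moved between \<open>F\<close> and its translate, but
  \<open>U - v\<close> is Lipschitz and can. On the net it has norm at most K +
  \<open>\<kappa>1\<close>; after translation a second \<open>\<kappa>1\<close> returns from
  \<open>v\<close> to \<open>u\<close>.\<close>

lemma dilation_error:
  assumes g: "g \<in> carrier G"
  shows "nrm ({..<N} \<times> J) (\<lambda>q. of_real (1 / sqrt M) * U (fst q) (snd (snd q)) (fst (snd q) \<otimes> g) - Z g (fst q) (snd q))
    \<le> K + 2 * \<kappa>1 + sqrt (2 * (real N)\<^sup>2 * D2 * L2 * \<delta>)"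
proof -
  define U' where "U' q = of_real (1 / sqrt M) * U (fst q) (snd (snd q)) (fst (snd q) \<otimes> g)" for q :: "nat \<times> 'a \<times> nat"
  define V' where "V' q = v (fst (snd q) \<otimes> g) (snd (snd q)) (fst q) / of_real (sqrt M)" for q :: "nat \<times> 'a \<times> nat"
  define Z' where "Z' q = Z g (fst q) (snd q)" for q
  have \<kappa>1: "\<kappa>1 \<ge> 0" using v_close[of "\<one>"] nrm_nonneg order_trans by blast
  have 1: "nrm ({..<N} \<times> J) (\<lambda>q. V' q - Z' q) \<le> \<kappa>1"
    using avg_close[of "\<lambda>x. x \<otimes> g"] g by (simp add: V'_def Z'_def Z_def diff_divide_distrib)
  define c where "c = 2 * real N * D2 * L2 * \<delta>"
  define W0 where "W0 q = (U (fst q) (snd (snd q)) (fst (snd q)) - v (fst (snd q)) (snd (snd q)) (fst q)) / of_real (sqrt M)"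
    for q :: "nat \<times> 'a \<times> nat"
  have W0: "nrm ({..<N} \<times> J) W0 \<le> K + \<kappa>1"
  proof -
    define X where "X q = (\<Sum>e\<in>S. T e (fst q) * e (snd q)) - w (fst q) (snd q)" for q
    define Y where "Y q = (v (fst (snd q)) (snd (snd q)) (fst q) - u (fst (snd q)) (snd (snd q)) (fst q))
      / of_real (sqrt M)" for q :: "nat \<times> 'a \<times> nat"
    have "nrm ({..<N} \<times> J) W0 = nrm ({..<N} \<times> J) (\<lambda>q. X q - Y q)"
    proof (rule nrm_cong)
      fix q assume q: "q \<in> {..<N} \<times> J"
      have "U (fst q) (snd (snd q)) (fst (snd q)) / of_real (sqrt M) = (\<Sum>e\<in>S. T e (fst q) * e (snd q))"
        unfolding U_def sum_divide_distrib using q M_pos f_on_F[of _ "snd q"] by (intro sum.cong) auto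
      thus "W0 q = X q - Y q" by (simp add: W0_def X_def Y_def w_def diff_divide_distrib)
    qed
    also have "\<dots> \<le> nrm ({..<N} \<times> J) X + nrm ({..<N} \<times> J) Y"
      using nrm_triangle[of "{..<N} \<times> J" X "\<lambda>q. - Y q"] by (simp add: nrm_def)
    also have "nrm ({..<N} \<times> J) Y \<le> \<kappa>1"
      using avg_close[of "\<lambda>x. x"] by (simp add: Y_def[abs_def])
    also have "nrm ({..<N} \<times> J) X \<le> K"
    proof (rule power2_le_imp_le)
      have "(nrm ({..<N} \<times> J) X)\<^sup>2 = (\<Sum>b<N. (nrm J (\<lambda>j. w b j - (\<Sum>e\<in>S. T e b * e j)))\<^sup>2)"
        unfolding nrm_Times[where I="{..<N}" and J=J] X_def fst_conv snd_conv by (subst nrm_diff_commute) simp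
      thus "(nrm ({..<N} \<times> J) X)\<^sup>2 \<le> K\<^sup>2" using tail_w by simp
    qed (rule K)
    finally show ?thesis by simp
  qed
  have "(nrm ({..<N} \<times> J) (\<lambda>q. U' q - V' q))\<^sup>2 \<le> (K + \<kappa>1)\<^sup>2 + real N * c"
  proof -
    have sc: "(nrm J (\<lambda>j. h j / of_real (sqrt M)))\<^sup>2 = (nrm J h)\<^sup>2 / M" for h
      using M_pos by (simp add: nrm_power2 norm_divide power_divide sum_divide_distrib)
    have "(nrm ({..<N} \<times> J) (\<lambda>q. U' q - V' q))\<^sup>2
        = (\<Sum>b<N. (nrm J (\<lambda>j. U b (snd j) (fst j \<otimes> g) - v (fst j \<otimes> g) (snd j) b))\<^sup>2 / M)"
      unfolding nrm_Times[where I="{..<N}" and J=J] sc[symmetric] by (simp add: U'_def V'_def diff_divide_distrib)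
    also have "\<dots> \<le> (\<Sum>b<N. ((nrm J (\<lambda>j. U b (snd j) (fst j) - v (fst j) (snd j) b))\<^sup>2 + real (card F) * c) / M)"
    proof (intro sum_mono divide_right_mono)
      fix b assume "b \<in> {..<N}"
      thus "(nrm J (\<lambda>j. U b (snd j) (fst j \<otimes> g) - v (fst j \<otimes> g) (snd j) b))\<^sup>2
        \<le> (nrm J (\<lambda>j. U b (snd j) (fst j) - v (fst j) (snd j) b))\<^sup>2 + real (card F) * c"
        unfolding c_def
        using nrm_translate[of \<delta> F g N L2 "\<lambda>a x. U b a x - v x a b" D2, OF F g U_minus_v] L2_ge D2_ge by simp
    qed (use M_pos in simp)
    also have "\<dots> = (\<Sum>b<N. (nrm J (\<lambda>j. U b (snd j) (fst j) - v (fst j) (snd j) b))\<^sup>2 / M) + real N * c"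
      using M_pos by (simp add: add_divide_distrib sum.distrib M_def[symmetric])
    also have "(\<Sum>b<N. (nrm J (\<lambda>j. U b (snd j) (fst j) - v (fst j) (snd j) b))\<^sup>2 / M) = (nrm ({..<N} \<times> J) W0)\<^sup>2"
      unfolding nrm_Times[where I="{..<N}" and J=J] sc[symmetric] by (simp add: W0_def)
    also have "\<dots> \<le> (K + \<kappa>1)\<^sup>2" using W0 by (intro power_mono) auto
    finally show ?thesis by simp
  qed
  hence "nrm ({..<N} \<times> J) (\<lambda>q. U' q - V' q) \<le> sqrt ((K + \<kappa>1)\<^sup>2 + real N * c)" by (rule real_le_rsqrt)
  also have "\<dots> \<le> (K + \<kappa>1) + sqrt (real N * c)"
    using K \<kappa>1 D2_ge L2_ge \<delta> by (intro sqrt_power2_add_le) (auto simp: c_def)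
  finally have "nrm ({..<N} \<times> J) (\<lambda>q. U' q - V' q) \<le> K + \<kappa>1 + sqrt (real N * c)" .
  hence "nrm ({..<N} \<times> J) (\<lambda>q. U' q - Z' q) \<le> K + \<kappa>1 + sqrt (real N * c) + \<kappa>1"
    using nrm_diff_triangle[of "{..<N} \<times> J" U' Z' V'] 1 by simp
  moreover have "real N * c = 2 * (real N)\<^sup>2 * D2 * L2 * \<delta>" by (simp add: c_def power2_eq_square)
  ultimately show ?thesis unfolding U'_def Z'_def by simp
qed

lemma compression_close:
  assumes g: "g \<in> carrier G"
  shows "nrm ({..<N} \<times> {..<N}) (\<lambda>p. (\<Sum>e'\<in>S. \<Sum>e\<in>S. cnj (T e' (fst p)) * \<sigma> g e' e * T e (snd p)) - u g (fst p) (snd p))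
    \<le> 2 * K + 2 * \<kappa>1 + \<kappa>2 + sqrt (2 * (real N)\<^sup>2 * D2 * L2 * \<delta>)"
proof -
  let ?NN = "{..<N} \<times> {..<N}"
  define Y where "Y b j = of_real (1 / sqrt M) * U b (snd j) (fst j \<otimes> g)" for b j
  \<comment> \<open>Three replacements lead from the compression of \<open>\<sigma> g\<close> to
    \<open>u g\<close>: the translated projection of \<open>w\<close> by the translate
    \<open>Z g\<close> of \<open>w\<close> itself (\<open>X1\<close>), the projection on the left by
    \<open>w\<close> (\<open>X2\<close>), and the average of u(x)^* u(x g) over the net by u(g)
    (\<open>X3\<close>).\<close>
  define X1 where "X1 p = (\<Sum>e\<in>S. cnj (T e (fst p)) * ip J e (\<lambda>j. Y (snd p) j - Z g (snd p) j))" for p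
  define q where "q a j = w a j - (\<Sum>e\<in>S. T e a * e j)" for a j
  define X2 where "X2 p = - ip J (q (fst p)) (Z g (snd p))" for p
  define X3 where "X3 p = ip J (w (fst p)) (Z g (snd p)) - u g (fst p) (snd p)" for p
  have Y: "Y b j = (\<Sum>e\<in>S. T e b * tr g e j)" for b j
    by (simp add: Y_def U_def tr_def sum_distrib_left mult_ac)
  have split: "(\<Sum>e'\<in>S. \<Sum>e\<in>S. cnj (T e' (fst p)) * \<sigma> g e' e * T e (snd p)) - u g (fst p) (snd p)
    = X1 p + X2 p + X3 p" for p
  proof -
    have "(\<Sum>e'\<in>S. \<Sum>e\<in>S. cnj (T e' (fst p)) * \<sigma> g e' e * T e (snd p)) = (\<Sum>e'\<in>S. cnj (T e' (fst p)) * ip J e' (Y (snd p)))"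
      unfolding Y[abs_def] ip_sum_right ip_scale_right \<sigma>_def by (simp add: sum_distrib_left mult_ac)
    also have "\<dots> = X1 p + (\<Sum>e\<in>S. cnj (T e (fst p)) * ip J e (Z g (snd p)))"
      by (simp add: X1_def ip_diff_right right_diff_distrib sum_subtractf)
    also have "(\<Sum>e\<in>S. cnj (T e (fst p)) * ip J e (Z g (snd p))) = X2 p + ip J (w (fst p)) (Z g (snd p))"
      by (simp add: X2_def q_def[abs_def] ip_diff_left ip_sum_left ip_scale_left)
    finally show ?thesis by (simp add: X3_def)
  qed
  have n1: "nrm ?NN X1 \<le> K + 2 * \<kappa>1 + sqrt (2 * (real N)\<^sup>2 * D2 * L2 * \<delta>)"
  proof -
    have "(nrm ?NN X1)\<^sup>2 = (\<Sum>b<N. \<Sum>a<N. (cmod (\<Sum>e\<in>S. cnj (T e a) * ip J e (\<lambda>j. Y b j - Z g b j)))\<^sup>2)"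
      unfolding nrm_power2 by (subst sum.swap) (simp add: sum.cartesian_product case_prod_unfold X1_def)
    also have "\<dots> \<le> (\<Sum>b<N. \<Sum>e\<in>S. (cmod (ip J e (\<lambda>j. Y b j - Z g b j)))\<^sup>2)"
      by (intro sum_mono T_adjoint_contraction)
    also have "\<dots> \<le> (\<Sum>b<N. (nrm J (\<lambda>j. Y b j - Z g b j))\<^sup>2)"
      using bessel_inequality[OF finS oS] by (intro sum_mono) simp
    also have "\<dots> = (nrm ({..<N} \<times> J) (\<lambda>q. Y (fst q) (snd q) - Z g (fst q) (snd q)))\<^sup>2"
      unfolding nrm_Times[where I="{..<N}" and J=J] by simp
    finally have "nrm ?NN X1 \<le> nrm ({..<N} \<times> J) (\<lambda>q. Y (fst q) (snd q) - Z g (fst q) (snd q))"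
      by (rule power2_le_imp_le) simp
    also have "\<dots> \<le> K + 2 * \<kappa>1 + sqrt (2 * (real N)\<^sup>2 * D2 * L2 * \<delta>)"
      unfolding Y_def by (rule dilation_error[OF g])
    finally show ?thesis .
  qed
  have n2: "nrm ?NN X2 \<le> K"
  proof (rule power2_le_imp_le)
    have "(nrm ?NN X2)\<^sup>2 = (\<Sum>a<N. \<Sum>b<N. (cmod (ip J (Z g b) (q a)))\<^sup>2)"
      unfolding nrm_power2
      by (simp add: sum.cartesian_product case_prod_unfold X2_def cmod_ip_commute)
    also have "\<dots> \<le> (\<Sum>a<N. (nrm J (q a))\<^sup>2)"
      by (intro sum_mono bessel_inequality oZ g) simp
    also have "\<dots> \<le> K\<^sup>2" unfolding q_def[abs_def] by (rule tail_w)
    finally show "(nrm ?NN X2)\<^sup>2 \<le> K\<^sup>2" .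
  qed (rule K)
  have n3: "nrm ?NN X3 \<le> \<kappa>2"
  proof -
    define H where "H x p = (\<Sum>c<N. cnj (u x c (fst p)) * u (x \<otimes> g) c (snd p)) - u g (fst p) (snd p)" for x p
    have MM: "of_real (sqrt M) * of_real (sqrt M) = (of_real M :: complex)"
      using M_pos by (simp flip: of_real_mult)
    have X3: "X3 p = of_real (1 / M) * (\<Sum>x\<in>F. H x p)" for p
    proof -
      have "ip J (w (fst p)) (Z g (snd p))
          = (\<Sum>j\<in>J. cnj (u (fst j) (snd j) (fst p)) * u (fst j \<otimes> g) (snd j) (snd p)) / of_real M"
        by (simp add: ip_def w_def Z_def MM flip: sum_divide_distrib)
      also have "(\<Sum>j\<in>J. cnj (u (fst j) (snd j) (fst p)) * u (fst j \<otimes> g) (snd j) (snd p))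
          = (\<Sum>x\<in>F. \<Sum>c<N. cnj (u x c (fst p)) * u (x \<otimes> g) c (snd p))"
        by (simp add: sum.cartesian_product case_prod_unfold)
      also have "\<dots> = (\<Sum>x\<in>F. H x p) + of_real M * u g (fst p) (snd p)"
        by (simp add: H_def sum_subtractf M_def)
      finally show ?thesis using M_pos by (simp add: X3_def add_divide_distrib)
    qed
    have "nrm ?NN X3 = nrm ?NN (\<lambda>p. of_real (1 / M) * (\<Sum>x\<in>F. H x p))"
      using X3 by (intro nrm_cong) blast
    also have "\<dots> = 1 / M * nrm ?NN (\<lambda>p. \<Sum>x\<in>F. H x p)"
      unfolding nrm_scale using M_pos by (simp add: norm_divide)
    also have "\<dots> \<le> 1 / M * (\<Sum>x\<in>F. nrm ?NN (H x))"
      using M_pos by (intro mult_left_mono nrm_sum) auto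
    also have "\<dots> \<le> 1 / M * (\<Sum>x\<in>F. \<kappa>2)"
      unfolding H_def using M_pos g by (intro mult_left_mono sum_mono u_mult) auto
    also have "\<dots> = \<kappa>2" using M_pos by (simp add: M_def)
    finally show ?thesis .
  qed
  have "nrm ?NN (\<lambda>p. X1 p + X2 p + X3 p) \<le> nrm ?NN X1 + nrm ?NN X2 + nrm ?NN X3"
    using nrm_triangle[of ?NN "\<lambda>p. X1 p + X2 p" X3] nrm_triangle[of ?NN X1 X2] by simp
  thus ?thesis unfolding split using n1 n2 n3 by linarith
qed

end

section \<open>Passage to the limit\<close>

context bi_invariant_group
begin

text \<open>An \<open>m\<close>-dimensional representation up to \<open>\<eta>\<close>, together with a contraction \<open>T\<close> through which
  it compresses to \<open>u\<close> up to \<open>\<kappa> + \<eta>\<close>. For fixed \<open>m\<close> and \<open>\<eta>\<close> these are closed conditions on the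
  entries of \<open>\<sigma>\<close> and \<open>T\<close>, and the bounds do not depend on \<open>\<eta>\<close>.\<close>
definition near_dilation ::
  "nat \<Rightarrow> ('a \<Rightarrow> nat \<Rightarrow> nat \<Rightarrow> complex) \<Rightarrow> real \<Rightarrow> real \<Rightarrow> real \<Rightarrow> real \<Rightarrow> real \<Rightarrow> nat \<Rightarrow>
    ('a \<Rightarrow> nat \<Rightarrow> nat \<Rightarrow> complex) \<Rightarrow> (nat \<Rightarrow> nat \<Rightarrow> complex) \<Rightarrow> bool" where
  "near_dilation N u K \<kappa> R \<Lambda> \<eta> m \<sigma> T \<longleftrightarrow>
    (\<forall>g i j. cmod (\<sigma> g i j) \<le> R) \<and> (\<forall>i b. cmod (T i b) \<le> 1) \<and>
    (\<forall>i j g h. i < m \<longrightarrow> j < m \<longrightarrow> g \<in> carrier G \<longrightarrow> h \<in> carrier G \<longrightarrow>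
      cmod (\<sigma> g i j - \<sigma> h i j) \<le> \<Lambda> * d g h) \<and>
    (\<forall>i j. i < m \<longrightarrow> j < m \<longrightarrow> \<sigma> \<one> i j = of_bool (i = j)) \<and>
    (\<forall>i j g h. i < m \<longrightarrow> j < m \<longrightarrow> g \<in> carrier G \<longrightarrow> h \<in> carrier G \<longrightarrow>
      cmod (\<sigma> (h \<otimes> g) i j - (\<Sum>k<m. \<sigma> h i k * \<sigma> g k j)) \<le> \<eta>) \<and>
    (\<forall>i j g. i < m \<longrightarrow> j < m \<longrightarrow> g \<in> carrier G \<longrightarrow>
      cmod ((\<Sum>k<m. cnj (\<sigma> g k i) * \<sigma> g k j) - of_bool (i = j)) \<le> \<eta>) \<and>
    (\<forall>z. (\<Sum>i<m. (cmod (\<Sum>b<N. T i b * z b))\<^sup>2) \<le> (\<Sum>b<N. (cmod (z b))\<^sup>2)) \<and>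
    real N - K\<^sup>2 \<le> (\<Sum>i<m. \<Sum>b<N. (cmod (T i b))\<^sup>2) \<and>
    (\<forall>g. g \<in> carrier G \<longrightarrow> nrm ({..<N} \<times> {..<N})
      (\<lambda>p. (\<Sum>i<m. \<Sum>j<m. cnj (T i (fst p)) * \<sigma> g i j * T j (snd p)) - u g (fst p) (snd p)) \<le> \<kappa> + \<eta>)"

lemma near_dilation_mono:
  assumes "near_dilation N u K \<kappa> R \<Lambda> \<eta> m \<sigma> T" "\<eta> \<le> \<eta>'"
  shows "near_dilation N u K \<kappa> R \<Lambda> \<eta>' m \<sigma> T"
  using assms unfolding near_dilation_def
  by (elim conjE, intro conjI) (assumption | meson order_trans add_left_mono)+

lemma near_dilation_limit:
  assumes "\<And>\<eta>. \<eta> > 0 \<Longrightarrow> near_dilation N u K \<kappa> R \<Lambda> \<eta> m \<sigma> T"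
  shows "near_dilation N u K \<kappa> R \<Lambda> 0 m \<sigma> T"
proof -
  have le0: "x \<le> 0" if "\<And>\<eta>. \<eta> > 0 \<Longrightarrow> x \<le> \<eta>" for x :: real
    using that field_le_epsilon[of x 0] by simp
  have le\<kappa>: "x \<le> \<kappa> + 0" if "\<And>\<eta>. \<eta> > 0 \<Longrightarrow> x \<le> \<kappa> + \<eta>" for x :: real
    using that field_le_epsilon[of x "\<kappa> + 0"] by simp
  have one: "near_dilation N u K \<kappa> R \<Lambda> 1 m \<sigma> T" using assms by simp
  have mult: "\<forall>i j g h. i < m \<longrightarrow> j < m \<longrightarrow> g \<in> carrier G \<longrightarrow> h \<in> carrier G \<longrightarrow>
      cmod (\<sigma> (h \<otimes> g) i j - (\<Sum>k<m. \<sigma> h i k * \<sigma> g k j)) \<le> 0"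
    by (intro allI impI, rule le0) (use assms in \<open>simp add: near_dilation_def\<close>)
  have unit: "\<forall>i j g. i < m \<longrightarrow> j < m \<longrightarrow> g \<in> carrier G \<longrightarrow>
      cmod ((\<Sum>k<m. cnj (\<sigma> g k i) * \<sigma> g k j) - of_bool (i = j)) \<le> 0"
    by (intro allI impI, rule le0) (use assms in \<open>simp add: near_dilation_def\<close>)
  have comp: "\<forall>g. g \<in> carrier G \<longrightarrow> nrm ({..<N} \<times> {..<N})
      (\<lambda>p. (\<Sum>i<m. \<Sum>j<m. cnj (T i (fst p)) * \<sigma> g i j * T j (snd p)) - u g (fst p) (snd p)) \<le> \<kappa> + 0"
    by (intro allI impI, rule le\<kappa>) (use assms in \<open>simp add: near_dilation_def\<close>)
  show ?thesis
    using one mult unit comp unfolding near_dilation_def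
    by - (elim conjE, intro conjI; assumption)
qed

lemma closed_Collect_imp_const:
  "closed {s. Q s} \<Longrightarrow> closed {s. P \<longrightarrow> Q s}"
  by (cases P) auto

text \<open>\<open>\<sigma>\<close> and \<open>T\<close> are packed into one point of a product
  space, with \<open>None\<close> marking the entries of \<open>T\<close>. For fixed group elements
  each condition involves finitely many coordinates, so even the uniform ones are intersections of
  closed sets.\<close>

lemma closed_near_dilation:
  "closed {s :: 'a option \<times> nat \<times> nat \<Rightarrow> complex.
    near_dilation N u K \<kappa> R \<Lambda> \<eta> m (\<lambda>g i j. s (Some g, i, j)) (\<lambda>i b. s (None, i, b))}"
  unfolding near_dilation_def nrm_def L2_set_def
  by (intro closed_Collect_conj closed_Collect_all closed_Collect_imp_const closed_Collect_le closed_Collect_eq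
      continuous_intros continuous_on_product_coordinates)

text \<open>Only finitely many dimensions are admissible, so by monotonicity in
  \<open>\<eta>\<close> one of them serves every \<open>\<eta>\<close>. For that dimension the
  solution sets are nested nonempty closed subsets of a compact product of discs.\<close>

lemma near_dilation_compactness:
  assumes ex: "\<And>\<eta>. \<eta> > 0 \<Longrightarrow> \<exists>m \<sigma> T. real N - K\<^sup>2 \<le> real m \<and> real m \<le> real N + K\<^sup>2 \<and> near_dilation N u K \<kappa> R \<Lambda> \<eta> m \<sigma> T"
  shows "\<exists>m \<sigma> T. real N - K\<^sup>2 \<le> real m \<and> real m \<le> real N + K\<^sup>2 \<and> near_dilation N u K \<kappa> R \<Lambda> 0 m \<sigma> T"
proof -
  define I where "I = {m. real N - K\<^sup>2 \<le> real m \<and> real m \<le> real N + K\<^sup>2}"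
  have "I \<subseteq> {..nat \<lfloor>real N + K\<^sup>2\<rfloor>}"
  proof
    fix m assume "m \<in> I"
    hence "m \<le> nat \<lfloor>real N + K\<^sup>2\<rfloor>" unfolding I_def by (intro le_nat_floor) blast
    thus "m \<in> {..nat \<lfloor>real N + K\<^sup>2\<rfloor>}" by (rule atMost_iff[THEN iffD2])
  qed
  hence finI: "finite I" by (rule finite_subset) simp
  have "\<exists>m\<in>I. \<forall>\<eta>>0. \<exists>\<sigma> T. near_dilation N u K \<kappa> R \<Lambda> \<eta> m \<sigma> T"
  proof (rule ccontr)
    assume "\<not> ?thesis"
    hence "\<forall>m\<in>I. \<exists>\<eta>>0. \<forall>\<sigma> T. \<not> near_dilation N u K \<kappa> R \<Lambda> \<eta> m \<sigma> T" by blast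
    then obtain h where h: "\<And>m. m \<in> I \<Longrightarrow> h m > 0" "\<And>m \<sigma> T. m \<in> I \<Longrightarrow> \<not> near_dilation N u K \<kappa> R \<Lambda> (h m) m \<sigma> T"
      by metis
    \<comment> \<open>The element 1 keeps the minimum defined if \<open>I\<close> is empty.\<close>
    define \<eta> where "\<eta> = Min (insert 1 (h ` I))"
    have "\<eta> > 0" using finI h(1) by (simp add: \<eta>_def)
    then obtain m \<sigma> T where m: "m \<in> I" "near_dilation N u K \<kappa> R \<Lambda> \<eta> m \<sigma> T"
      unfolding I_def using ex by blast
    have "\<eta> \<le> h m" using finI m(1) by (simp add: \<eta>_def)
    hence "near_dilation N u K \<kappa> R \<Lambda> (h m) m \<sigma> T" using m(2) near_dilation_mono by blast
    thus False using h(2) m(1) by blast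
  qed
  then obtain m where m: "m \<in> I" "\<And>\<eta>. \<eta> > 0 \<Longrightarrow> \<exists>\<sigma> T. near_dilation N u K \<kappa> R \<Lambda> \<eta> m \<sigma> T" by blast
  define Z where "Z \<eta> = {s :: 'a option \<times> nat \<times> nat \<Rightarrow> complex.
    near_dilation N u K \<kappa> R \<Lambda> \<eta> m (\<lambda>g i j. s (Some g, i, j)) (\<lambda>i b. s (None, i, b))}" for \<eta>
  define P :: "('a option \<times> nat \<times> nat \<Rightarrow> complex) set" where "P = PiE UNIV (\<lambda>_. cball 0 (max R 1))"
  have "compactin (product_topology (\<lambda>_. euclidean) UNIV) P"
    unfolding P_def by (subst compactin_PiE) auto
  hence "compact P" by (simp add: euclidean_product_topology)
  hence "P \<inter> (\<Inter>\<eta>\<in>{0<..}. Z \<eta>) \<noteq> {}"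
  proof (rule compact_imp_fip_image)
    show "closed (Z \<eta>)" for \<eta> unfolding Z_def by (rule closed_near_dilation)
    fix I' :: "real set" assume I': "finite I'" "I' \<subseteq> {0<..}"
    define \<eta> where "\<eta> = Min (insert 1 I')"
    have "\<eta> > 0" using I' by (auto simp: \<eta>_def)
    then obtain \<sigma> T where nd: "near_dilation N u K \<kappa> R \<Lambda> \<eta> m \<sigma> T" using m(2) by blast
    define s where "s = (\<lambda>(o', i, j). case o' of None \<Rightarrow> T i j | Some g \<Rightarrow> \<sigma> g i j)"
    have "cmod (s p) \<le> max R 1" for p
      using nd by (auto simp: near_dilation_def s_def le_max_iff_disj split: option.splits prod.splits)
    hence "s \<in> P" by (auto simp: P_def)
    moreover have "s \<in> Z \<eta>'" if "\<eta>' \<in> I'" for \<eta>'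
    proof -
      have "\<eta> \<le> \<eta>'" using that I' by (simp add: \<eta>_def)
      hence "near_dilation N u K \<kappa> R \<Lambda> \<eta>' m \<sigma> T" using nd near_dilation_mono by blast
      thus ?thesis by (simp add: Z_def s_def)
    qed
    ultimately show "P \<inter> (\<Inter>\<eta>\<in>I'. Z \<eta>) \<noteq> {}" by blast
  qed
  then obtain s where "\<And>\<eta>. \<eta> > 0 \<Longrightarrow> s \<in> Z \<eta>" by blast
  hence "near_dilation N u K \<kappa> R \<Lambda> 0 m (\<lambda>g i j. s (Some g, i, j)) (\<lambda>i b. s (None, i, b))"
    by (intro near_dilation_limit) (simp add: Z_def)
  thus ?thesis using m(1) unfolding I_def by blast
qed

text \<open>The three conditions are the errors of \<open>\<sigma>_mult\<close>,
  \<open>\<sigma>_unitary\<close> and \<open>compression_close\<close>, with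
  \<open>c1 * \<delta>\<close> in the role of \<open>\<tau>\<close>.\<close>

lemma small_parameter:
  fixes c1 c2 c3 c4 \<eta> :: real
  assumes "\<eta> > 0"
  shows "\<exists>\<delta>>0. c1 * \<delta> + sqrt (c2 * \<delta>) \<le> \<eta> \<and> (c1 * \<delta>)\<^sup>2 + c3 * \<delta> \<le> \<eta> \<and> sqrt (c4 * \<delta>) \<le> \<eta>"
proof -
  have lim: "((\<lambda>\<delta>. c1 * \<delta> + sqrt (c2 * \<delta>)) \<longlongrightarrow> 0) (at_right 0)"
    "((\<lambda>\<delta>. (c1 * \<delta>)\<^sup>2 + c3 * \<delta>) \<longlongrightarrow> 0) (at_right 0)" "((\<lambda>\<delta>. sqrt (c4 * \<delta>)) \<longlongrightarrow> 0) (at_right 0)"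
    by (auto intro!: tendsto_eq_intros)
  have "\<forall>\<^sub>F \<delta> in at_right 0. c1 * \<delta> + sqrt (c2 * \<delta>) < \<eta> \<and> (c1 * \<delta>)\<^sup>2 + c3 * \<delta> < \<eta> \<and> sqrt (c4 * \<delta>) < \<eta> \<and> \<delta> > 0"
    using lim[THEN order_tendstoD(2), OF assms] eventually_at_right_less[of "0::real"]
    by (intro eventually_conj)
  hence "\<exists>\<delta>. c1 * \<delta> + sqrt (c2 * \<delta>) < \<eta> \<and> (c1 * \<delta>)\<^sup>2 + c3 * \<delta> < \<eta> \<and> sqrt (c4 * \<delta>) < \<eta> \<and> \<delta> > 0"
    by (rule eventually_happens'[rotated]) simp
  thus ?thesis by (meson less_imp_le)
qed

text \<open>The rank bound \<open>Q\<close> and the gap \<open>\<gamma>\<close> depend on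
  \<open>N\<close> and \<open>\<kappa>3\<close> only; then \<open>\<delta>\<close> is chosen from
  \<open>\<eta>\<close> and the constants, then the net. The cut \<open>\<theta>\<close> may vary
  with the net, but none of the bounds involves it.\<close>

lemma near_dilation_exists:
  fixes N :: nat and \<psi> u v :: "'a \<Rightarrow> nat \<Rightarrow> nat \<Rightarrow> complex"
  assumes N: "N > 0"
    and \<psi>_bounded: "\<And>a b. a < N \<Longrightarrow> b < N \<Longrightarrow> bounded_by 1 (\<lambda>x. \<psi> x a b)"
    and \<psi>_lipschitz: "\<And>a b. a < N \<Longrightarrow> b < N \<Longrightarrow> lipschitz C (\<lambda>x. \<psi> x a b)"
    and \<psi>_hermitian: "\<And>x a b. x \<in> carrier G \<Longrightarrow> a < N \<Longrightarrow> b < N \<Longrightarrow> \<psi> (inv x) b a = cnj (\<psi> x a b)"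
    and C: "C \<ge> 0"
    and u_unitary: "\<And>x b c. x \<in> carrier G \<Longrightarrow> b < N \<Longrightarrow> c < N \<Longrightarrow>
      (\<Sum>a<N. cnj (u x a b) * u x a c) = of_bool (b = c)"
    and v_bounded: "\<And>a b. a < N \<Longrightarrow> b < N \<Longrightarrow> bounded_by 1 (\<lambda>x. v x a b)"
    and v_lipschitz: "\<And>a b. a < N \<Longrightarrow> b < N \<Longrightarrow> lipschitz Cv (\<lambda>x. v x a b)"
    and Cv: "Cv \<ge> 0"
    and v_close: "\<And>x. x \<in> carrier G \<Longrightarrow>
      nrm ({..<N} \<times> {..<N}) (\<lambda>p. v x (fst p) (snd p) - u x (fst p) (snd p)) \<le> \<kappa>1"
    and u_mult: "\<And>x g. x \<in> carrier G \<Longrightarrow> g \<in> carrier G \<Longrightarrow>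
      nrm ({..<N} \<times> {..<N}) (\<lambda>p. (\<Sum>c<N. cnj (u x c (fst p)) * u (x \<otimes> g) c (snd p)) - u g (fst p) (snd p)) \<le> \<kappa>2"
    and \<psi>_close: "\<And>x y. x \<in> carrier G \<Longrightarrow> y \<in> carrier G \<Longrightarrow>
      nrm ({..<N} \<times> {..<N}) (\<lambda>p. \<psi> (x \<otimes> inv y) (fst p) (snd p) - (\<Sum>c<N. u x (fst p) c * cnj (u y (snd p) c))) \<le> \<kappa>3"
    and \<eta>: "\<eta> > 0"
  shows "\<exists>m \<sigma> T. real N - (4 * \<kappa>3)\<^sup>2 \<le> real m \<and> real m \<le> real N + (4 * \<kappa>3)\<^sup>2 \<and>
    near_dilation N u (4 * \<kappa>3) (8 * \<kappa>3 + 2 * \<kappa>1 + \<kappa>2) (sqrt (real N) * (4 * sqrt (real N)))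
      (sqrt (real N) * (4 * sqrt (real N) * C)) \<eta> m \<sigma> T"
proof -
  have \<kappa>3: "\<kappa>3 \<ge> 0" using \<psi>_close[of "\<one>" "\<one>"] nrm_nonneg order_trans by blast
  \<comment> \<open>\<open>spectral_projection_bounds\<close> at squared distance
    \<open>\<kappa>3\<^sup>2\<close> allows 16 times that much, which is the square of 4 *
    \<open>\<kappa>3\<close>; this is where \<open>K\<close> comes from.\<close>
  define Q where "Q = real N + (4 * \<kappa>3)\<^sup>2"
  define n where "n = nat \<lfloor>Q\<rfloor>"
  define \<gamma> where "\<gamma> = 1 / (2 * (real n + 1))"
  have \<gamma>: "\<gamma> > 0" by (simp add: \<gamma>_def)
  define B where "B = 4 * sqrt (real N)"
  define D1 where "D1 = B + Q * (sqrt (real N) * B) * B"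
  define D2 where "D2 = Q * B + 1"
  define L2 where "L2 = Q * (B * C) + Cv"
  define c1 where "c1 = sqrt (real N) * (2 * real N * B * (B * C)) / \<gamma>"
  obtain \<delta> where \<delta>: "\<delta> > 0" "c1 * \<delta> + sqrt (2 * real N * D1 * (D1 * C) * \<delta>) \<le> \<eta>"
    "(c1 * \<delta>)\<^sup>2 + 2 * real N * B * (B * C) * \<delta> \<le> \<eta>" "sqrt (2 * (real N)\<^sup>2 * D2 * L2 * \<delta>) \<le> \<eta>"
    using small_parameter[OF \<eta>] by blast
  obtain F where F: "nearly_invariant \<delta> F"
    using nearly_invariant_net[OF \<delta>(1)] unfolding nearly_invariant_def by blast
  have finF: "finite F" and F_sub: "\<And>x. x \<in> F \<Longrightarrow> x \<in> carrier G" and F_ne: "F \<noteq> {}"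
    using F by (auto simp: nearly_invariant_def)
  define M where "M = real (card F)"
  have M: "M > 0" using finF F_ne by (simp add: M_def card_gt_0_iff)
  define J where "J = F \<times> {..<N}"
  have finJ: "finite J" using finF by (simp add: J_def)
  define A where "A j k = \<psi> (fst j \<otimes> inv (fst k)) (snd j) (snd k) / of_nat (card F)" for j k
  have herm: "hermitian_on J A"
    unfolding J_def A_def[abs_def] using F_sub \<psi>_hermitian by (intro hermitian_convolution) auto
  obtain E l where E: "orthonormal_basis J E"
    and eig: "\<And>e j. e \<in> E \<Longrightarrow> j \<in> J \<Longrightarrow> mv J A e j = complex_of_real (l e) * e j"
    using hermitian_eigenbasis[OF finJ herm] by blast
  have finE: "finite E" using E by (simp add: orthonormal_basis_def)
  define w where "w b j = u (fst j) (snd j) b / of_real (sqrt M)" for b and j :: "'a \<times> nat"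
  have MM: "of_real (sqrt M) * of_real (sqrt M) = (of_real M :: complex)"
    using M by (simp flip: of_real_mult)
  have ow: "orthonormal J {..<N} w"
    unfolding J_def w_def[abs_def] M_def using F_sub u_unitary by (intro orthonormal_columns finF F_ne) simp
  \<comment> \<open>Averaged over all pairs of net points, \<open>\<psi>_close\<close> says that the
    convolution matrix is near the projection onto the columns \<open>w\<close>; the M^2 pairs
    cancel the normalisation.\<close>
  have close: "(\<Sum>j\<in>J. \<Sum>k\<in>J. (cmod (A j k - (\<Sum>b<N. w b j * cnj (w b k))))\<^sup>2) \<le> \<kappa>3\<^sup>2"
  proof -
    define D where "D x y a b = \<psi> (x \<otimes> inv y) a b - (\<Sum>c<N. u x a c * cnj (u y b c))" for x y a b
    have AD: "A j k - (\<Sum>b<N. w b j * cnj (w b k)) = D (fst j) (fst k) (snd j) (snd k) / of_real M" for j k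
    proof -
      have "(\<Sum>b<N. w b j * cnj (w b k)) = (\<Sum>c<N. u (fst j) (snd j) c * cnj (u (fst k) (snd k) c)) / of_real M"
        by (simp add: w_def MM sum_divide_distrib)
      thus ?thesis by (simp add: A_def D_def M_def diff_divide_distrib)
    qed
    have "(\<Sum>j\<in>J. \<Sum>k\<in>J. (cmod (A j k - (\<Sum>b<N. w b j * cnj (w b k))))\<^sup>2)
        = (\<Sum>j\<in>J. \<Sum>k\<in>J. (cmod (D (fst j) (fst k) (snd j) (snd k)))\<^sup>2 / M\<^sup>2)"
      unfolding AD using M by (simp add: norm_divide power_divide)
    also have "\<dots> = (\<Sum>x\<in>F. \<Sum>a<N. \<Sum>y\<in>F. \<Sum>b<N. (cmod (D x y a b))\<^sup>2 / M\<^sup>2)"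
    proof -
      have sumJ: "(\<Sum>j\<in>J. h (fst j) (snd j)) = (\<Sum>x\<in>F. \<Sum>a<N. h x a)" for h :: "'a \<Rightarrow> nat \<Rightarrow> real"
        by (simp add: J_def sum.cartesian_product case_prod_unfold)
      show ?thesis
        unfolding sumJ[of "\<lambda>y b. (cmod (D _ y _ b))\<^sup>2 / M\<^sup>2"]
        by (rule sumJ[of "\<lambda>x a. \<Sum>y\<in>F. \<Sum>b<N. (cmod (D x y a b))\<^sup>2 / M\<^sup>2"])
    qed
    also have "\<dots> = (\<Sum>x\<in>F. \<Sum>y\<in>F. \<Sum>a<N. \<Sum>b<N. (cmod (D x y a b))\<^sup>2 / M\<^sup>2)"
      by (intro sum.cong refl sum.swap)
    also have "\<dots> = (\<Sum>x\<in>F. \<Sum>y\<in>F. (nrm ({..<N} \<times> {..<N}) (\<lambda>p. D x y (fst p) (snd p)))\<^sup>2 / M\<^sup>2)"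
      unfolding nrm_power2 by (simp add: sum.cartesian_product case_prod_unfold sum_divide_distrib)
    also have "\<dots> \<le> (\<Sum>x\<in>F. \<Sum>y\<in>F. \<kappa>3\<^sup>2 / M\<^sup>2)"
      unfolding D_def using M by (intro sum_mono divide_right_mono power_mono \<psi>_close F_sub) auto
    also have "\<dots> = \<kappa>3\<^sup>2" using M by (simp add: M_def power2_eq_square)
    finally show ?thesis .
  qed
  have bounds: "real (card {e\<in>E. l e > \<theta>}) \<le> real N + 16 * \<kappa>3\<^sup>2"
      "real (card {e\<in>E. l e > \<theta>}) \<ge> real N - 16 * \<kappa>3\<^sup>2"
      "(\<Sum>e\<in>{e\<in>E. l e > \<theta>}. \<Sum>b<N. (cmod (ip J (w b) e))\<^sup>2) \<ge> real N - 16 * \<kappa>3\<^sup>2"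
      "(\<Sum>e\<in>{e\<in>E. \<not> l e > \<theta>}. \<Sum>b<N. (cmod (ip J (w b) e))\<^sup>2) \<le> 16 * \<kappa>3\<^sup>2"
    if "1/4 \<le> \<theta>" "\<theta> \<le> 3/4" for \<theta>
    using spectral_projection_bounds[OF finJ E _ finite_lessThan ow close that] eig by simp_all
  \<comment> \<open>A first count at the lowest cut 1/4 produces the gap; the bounds are then used
    again at the cut \<open>\<theta>\<close> found in it.\<close>
  have "real (card {e\<in>E. l e > 1/4}) \<le> Q"
    using bounds(1)[of "1/4"] by (simp add: Q_def power_mult_distrib)
  hence "card {e\<in>E. l e > 1/4} \<le> n" unfolding n_def by (rule le_nat_floor)
  then obtain \<theta> where \<theta>: "1/4 \<le> \<theta>" "\<theta> \<le> 3/4" and gap: "\<And>e. e \<in> E \<Longrightarrow> l e \<le> \<theta> \<or> l e > \<theta> + \<gamma>"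
    using spectral_gap[OF finE _ \<gamma>_def] by blast
  have cardQ: "real (card {e\<in>E. l e > \<theta>}) \<le> Q" and cardL: "real (card {e\<in>E. l e > \<theta>}) \<ge> real N - (4 * \<kappa>3)\<^sup>2"
    and mass: "(\<Sum>e\<in>{e\<in>E. l e > \<theta>}. \<Sum>b<N. (cmod (ip J (w b) e))\<^sup>2) \<ge> real N - (4 * \<kappa>3)\<^sup>2"
    and tail: "(\<Sum>e\<in>{e\<in>E. \<not> l e > \<theta>}. \<Sum>b<N. (cmod (ip J (w b) e))\<^sup>2) \<le> (4 * \<kappa>3)\<^sup>2"
    using bounds[OF \<theta>] by (simp_all add: Q_def power_mult_distrib)
  interpret dm: discrete_model G d N \<psi> C F \<delta> E l \<theta> \<gamma> Q
    using N \<psi>_bounded \<psi>_lipschitz \<psi>_hermitian C F \<delta>(1) E eig \<theta>(1) \<gamma> gap cardQ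
    unfolding J_def A_def[abs_def] by unfold_locales auto
  interpret um: unitary_model G d N \<psi> C F \<delta> E l \<theta> \<gamma> Q u v Cv "4 * \<kappa>3" \<kappa>1 \<kappa>2
    using u_unitary v_bounded v_lipschitz v_close u_mult tail Cv \<kappa>3
    unfolding J_def w_def[abs_def] M_def by unfold_locales (auto simp: dm.S'_def dm.M_def)
  have params: "dm.B = B" "dm.D1 = D1" "dm.\<tau> = c1 * \<delta>" "um.D2 = D2" "um.L2 = L2"
    by (simp_all add: dm.B_def B_def dm.D1_def D1_def dm.\<tau>_def c1_def um.D2_def D2_def um.L2_def L2_def)
  define m where "m = card dm.S"
  have "\<exists>h. bij_betw h {..<m} dm.S"
    using finite_same_card_bij[of "{..<m}" dm.S] dm.finS by (simp add: m_def)
  then obtain h where h: "bij_betw h {..<m} dm.S" by blast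
  have hS: "h i \<in> dm.S" if "i < m" for i using h that by (auto simp: bij_betw_def)
  have h_inj: "h i = h j \<longleftrightarrow> i = j" if "i < m" "j < m" for i j
    using h that by (auto simp: bij_betw_def inj_on_def)
  note re = sum.reindex_bij_betw[OF h]
  \<comment> \<open>Zero outside the relevant indices, because the bounds in
    \<open>near_dilation\<close> range over all arguments, as compactness requires. \<open>T\<close>
    is padded likewise.\<close>
  define \<sigma> where "\<sigma> g i j = (if g \<in> carrier G \<and> i < m \<and> j < m then dm.\<sigma> g (h i) (h j) else 0)" for g i j
  define T where "T i b = (if i < m \<and> b < N then um.T (h i) b else 0)" for i b
  have "near_dilation N u (4 * \<kappa>3) (8 * \<kappa>3 + 2 * \<kappa>1 + \<kappa>2) (sqrt (real N) * (4 * sqrt (real N)))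
      (sqrt (real N) * (4 * sqrt (real N) * C)) \<eta> m \<sigma> T"
    unfolding near_dilation_def
  proof (intro conjI allI impI)
    fix g i j
    show "cmod (\<sigma> g i j) \<le> sqrt (real N) * (4 * sqrt (real N))"
      using dm.\<sigma>_bound[OF hS hS, of i j g] by (auto simp: \<sigma>_def params B_def)
  next
    fix i b show "cmod (T i b) \<le> 1" using um.T_bound[OF hS, of i b] by (auto simp: T_def)
  next
    fix i j g h' assume "i < m" "j < m" "g \<in> carrier G" "h' \<in> carrier G"
    thus "cmod (\<sigma> g i j - \<sigma> h' i j) \<le> sqrt (real N) * (4 * sqrt (real N) * C) * d g h'"
      using dm.\<sigma>_lipschitz[OF hS hS, of i j] by (simp add: \<sigma>_def params B_def lipschitz_def)
  next
    fix i j assume "i < m" "j < m"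
    thus "\<sigma> \<one> i j = of_bool (i = j)" using dm.\<sigma>_one[OF hS hS, of i j] h_inj by (simp add: \<sigma>_def)
  next
    fix i j g h' assume ij: "i < m" "j < m" and gh: "g \<in> carrier G" "h' \<in> carrier G"
    have "(\<Sum>k<m. \<sigma> h' i k * \<sigma> g k j) = (\<Sum>k\<in>dm.S. dm.\<sigma> h' (h i) k * dm.\<sigma> g k (h j))"
      unfolding re[symmetric] using ij gh by (intro sum.cong) (auto simp: \<sigma>_def)
    thus "cmod (\<sigma> (h' \<otimes> g) i j - (\<Sum>k<m. \<sigma> h' i k * \<sigma> g k j)) \<le> \<eta>"
      using dm.\<sigma>_mult[OF hS hS, of i j h' g] ij gh \<delta>(2) by (simp add: params) (simp add: \<sigma>_def)
  next
    fix i j g assume ij: "i < m" "j < m" and g: "g \<in> carrier G"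
    have "(\<Sum>k<m. cnj (\<sigma> g k i) * \<sigma> g k j) = (\<Sum>k\<in>dm.S. cnj (dm.\<sigma> g k (h i)) * dm.\<sigma> g k (h j))"
      unfolding re[symmetric] using ij g by (intro sum.cong) (auto simp: \<sigma>_def)
    moreover have "cmod ((\<Sum>k\<in>dm.S. cnj (dm.\<sigma> g k (h i)) * dm.\<sigma> g k (h j)) - of_bool (h i = h j)) \<le> \<eta>"
      using dm.\<sigma>_unitary[OF hS[OF ij(1)] hS[OF ij(2)] g] \<delta>(3) unfolding params by (rule order_trans)
    ultimately show "cmod ((\<Sum>k<m. cnj (\<sigma> g k i) * \<sigma> g k j) - of_bool (i = j)) \<le> \<eta>"
      using h_inj[OF ij] by simp
  next
    fix z :: "nat \<Rightarrow> complex"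
    have "(\<Sum>i<m. (cmod (\<Sum>b<N. T i b * z b))\<^sup>2) = (\<Sum>e\<in>dm.S. (cmod (\<Sum>b<N. um.T e b * z b))\<^sup>2)"
      unfolding re[symmetric] by (intro sum.cong) (auto simp: T_def)
    thus "(\<Sum>i<m. (cmod (\<Sum>b<N. T i b * z b))\<^sup>2) \<le> (\<Sum>b<N. (cmod (z b))\<^sup>2)"
      using um.T_contraction[of z] by simp
  next
    have "(\<Sum>i<m. \<Sum>b<N. (cmod (T i b))\<^sup>2) = (\<Sum>e\<in>dm.S. \<Sum>b<N. (cmod (um.T e b))\<^sup>2)"
      unfolding re[symmetric] by (intro sum.cong) (auto simp: T_def)
    also have "\<dots> = (\<Sum>e\<in>{e\<in>E. l e > \<theta>}. \<Sum>b<N. (cmod (ip J (w b) e))\<^sup>2)"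
      unfolding dm.S_def um.T_def cmod_ip_commute[of _ _ "um.w _"]
      by (simp add: J_def um.w_def[abs_def] w_def[abs_def] dm.M_def M_def)
    finally show "real N - (4 * \<kappa>3)\<^sup>2 \<le> (\<Sum>i<m. \<Sum>b<N. (cmod (T i b))\<^sup>2)" using mass by simp
  next
    fix g assume g: "g \<in> carrier G"
    let ?NN = "{..<N} \<times> {..<N}"
    have "nrm ?NN (\<lambda>p. (\<Sum>i<m. \<Sum>j<m. cnj (T i (fst p)) * \<sigma> g i j * T j (snd p)) - u g (fst p) (snd p))
      = nrm ?NN (\<lambda>p. (\<Sum>e'\<in>dm.S. \<Sum>e\<in>dm.S. cnj (um.T e' (fst p)) * dm.\<sigma> g e' e * um.T e (snd p)) - u g (fst p) (snd p))"
    proof (rule nrm_cong)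
      fix p assume p: "p \<in> ?NN"
      have "(\<Sum>i<m. \<Sum>j<m. cnj (T i (fst p)) * \<sigma> g i j * T j (snd p))
          = (\<Sum>e'\<in>dm.S. \<Sum>e\<in>dm.S. cnj (um.T e' (fst p)) * dm.\<sigma> g e' e * um.T e (snd p))"
        unfolding re[symmetric] using p g by (intro sum.cong refl) (auto simp: \<sigma>_def T_def)
      thus "(\<Sum>i<m. \<Sum>j<m. cnj (T i (fst p)) * \<sigma> g i j * T j (snd p)) - u g (fst p) (snd p)
        = (\<Sum>e'\<in>dm.S. \<Sum>e\<in>dm.S. cnj (um.T e' (fst p)) * dm.\<sigma> g e' e * um.T e (snd p)) - u g (fst p) (snd p)"
        by simp
    qed
    also have "\<dots> \<le> 2 * (4 * \<kappa>3) + 2 * \<kappa>1 + \<kappa>2 + sqrt (2 * (real N)\<^sup>2 * D2 * L2 * \<delta>)"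
      using um.compression_close[OF g] unfolding params .
    also have "\<dots> \<le> 8 * \<kappa>3 + 2 * \<kappa>1 + \<kappa>2 + \<eta>" using \<delta>(4) by simp
    finally show "nrm ?NN (\<lambda>p. (\<Sum>i<m. \<Sum>j<m. cnj (T i (fst p)) * \<sigma> g i j * T j (snd p)) - u g (fst p) (snd p))
      \<le> 8 * \<kappa>3 + 2 * \<kappa>1 + \<kappa>2 + \<eta>" .
  qed
  moreover have "real N - (4 * \<kappa>3)\<^sup>2 \<le> real m" "real m \<le> real N + (4 * \<kappa>3)\<^sup>2"
    using cardQ cardL by (simp_all add: m_def dm.S_def Q_def)
  ultimately show ?thesis by blast
qed

end

section \<open>Dilations by unitary matrices\<close>

lemma ip_orthonormal_sum:
  assumes "finite I" "orthonormal J I e"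
  shows "ip J (\<lambda>j. \<Sum>i\<in>I. a i * e i j) (\<lambda>j. \<Sum>i\<in>I. b i * e i j) = ip I a b"
proof -
  have "ip J (\<lambda>j. \<Sum>i\<in>I. a i * e i j) (\<lambda>j. \<Sum>i\<in>I. b i * e i j)
      = (\<Sum>i\<in>I. cnj (a i) * (\<Sum>k\<in>I. b k * of_bool (i = k)))"
    unfolding ip_sum_left ip_sum_right ip_scale_left ip_scale_right using assms(2)
    by (auto simp: orthonormal_def sum_distrib_left intro!: sum.cong)
  also have "\<dots> = ip I a b"
    using assms(1) by (simp add: ip_def of_bool_def if_distrib[of "\<lambda>x. _ * x"] cong: if_cong)
  finally show ?thesis .
qed

text \<open>|T^* y|^2 = <T T^* y, y> is at most |T^* y| |y| by Cauchy--Schwarz and the contraction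
  property.\<close>

lemma adjoint_contraction:
  assumes contr: "\<And>z. nrm J (\<lambda>j. \<Sum>b\<in>I. z b * t b j) \<le> nrm I z"
  shows "nrm I (\<lambda>b. ip J (t b) y) \<le> nrm J y"
proof -
  define z where "z b = ip J (t b) y" for b
  have "ip I z z = ip J (\<lambda>j. \<Sum>b\<in>I. z b * t b j) y"
    by (simp add: ip_sum_left ip_scale_left) (simp add: ip_def z_def)
  hence "complex_of_real ((nrm I z)\<^sup>2) = ip J (\<lambda>j. \<Sum>b\<in>I. z b * t b j) y" by (simp add: ip_self)
  hence "cmod (complex_of_real ((nrm I z)\<^sup>2)) \<le> nrm J (\<lambda>j. \<Sum>b\<in>I. z b * t b j) * nrm J y"
    using cauchy_schwarz by metis
  also have "\<dots> \<le> nrm I z * nrm J y" using contr by (intro mult_right_mono) auto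
  finally have "nrm I z * nrm I z \<le> nrm I z * nrm J y" by (simp add: power2_eq_square norm_mult)
  hence "nrm I z \<le> nrm J y"
    by (cases "nrm I z = 0") (auto simp: less_le dest: mult_left_le_imp_le)
  thus ?thesis by (simp add: z_def[abs_def])
qed

text \<open>V^* R V - T^* R T = (V - T)^* R V + T^* R (V - T). The columns of R V are orthonormal,
  so Bessel bounds the first term; in the second, T^* is a contraction and R an isometry. Each costs
  \<open>X\<close>.\<close>

lemma compression_perturbation:
  fixes r :: "nat \<Rightarrow> nat \<Rightarrow> complex" and V T :: "nat \<Rightarrow> nat \<Rightarrow> complex"
  assumes r: "orthonormal {..<m} {..<m} r" and V: "orthonormal {..<m} {..<N} V"
    and T: "\<And>z. nrm {..<m} (\<lambda>i. \<Sum>b<N. z b * T b i) \<le> nrm {..<N} z"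
    and X: "(\<Sum>b<N. (nrm {..<m} (\<lambda>i. V b i - T b i))\<^sup>2) \<le> X\<^sup>2" "X \<ge> 0"
  defines "R \<equiv> \<lambda>x i. \<Sum>j<m. x j * r j i"
  shows "nrm ({..<N} \<times> {..<N}) (\<lambda>p. ip {..<m} (V (fst p)) (R (V (snd p)))
    - ip {..<m} (T (fst p)) (R (T (snd p)))) \<le> 2 * X"
proof -
  let ?NN = "{..<N} \<times> {..<N}"
  have R_diff: "R (\<lambda>j. x j - y j) = (\<lambda>i. R x i - R y i)" for x y
    by (simp add: R_def left_diff_distrib sum_subtractf)
  have R_nrm: "nrm {..<m} (R x) = nrm {..<m} x" for x
  proof -
    have "complex_of_real ((nrm {..<m} (R x))\<^sup>2) = complex_of_real ((nrm {..<m} x)\<^sup>2)"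
      unfolding ip_self[symmetric] R_def by (rule ip_orthonormal_sum[OF finite_lessThan r])
    thus ?thesis unfolding of_real_eq_iff by simp
  qed
  have RV: "orthonormal {..<m} {..<N} (\<lambda>b. R (V b))"
    using V unfolding orthonormal_def R_def ip_orthonormal_sum[OF finite_lessThan r] .
  define X1 where "X1 p = ip {..<m} (\<lambda>i. V (fst p) i - T (fst p) i) (R (V (snd p)))" for p
  define X2 where "X2 p = ip {..<m} (T (fst p)) (R (\<lambda>i. V (snd p) i - T (snd p) i))" for p
  have n1: "nrm ?NN X1 \<le> X"
  proof (rule power2_le_imp_le)
    have "(nrm ?NN X1)\<^sup>2 = (\<Sum>a<N. \<Sum>b<N. (cmod (ip {..<m} (R (V b)) (\<lambda>i. V a i - T a i)))\<^sup>2)"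
      unfolding nrm_power2 X1_def cmod_ip_commute[of _ "\<lambda>i. V _ i - T _ i"]
      by (simp add: sum.cartesian_product case_prod_unfold)
    also have "\<dots> \<le> (\<Sum>a<N. (nrm {..<m} (\<lambda>i. V a i - T a i))\<^sup>2)"
      by (intro sum_mono bessel_inequality RV) simp
    finally show "(nrm ?NN X1)\<^sup>2 \<le> X\<^sup>2" using X(1) by linarith
  qed (rule X(2))
  have n2: "nrm ?NN X2 \<le> X"
  proof (rule power2_le_imp_le)
    have "(nrm ?NN X2)\<^sup>2 = (\<Sum>b<N. (nrm {..<N} (\<lambda>a. ip {..<m} (T a) (R (\<lambda>i. V b i - T b i))))\<^sup>2)"
      by (subst nrm_swap) (simp add: nrm_Times X2_def)
    also have "\<dots> \<le> (\<Sum>b<N. (nrm {..<m} (R (\<lambda>i. V b i - T b i)))\<^sup>2)"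
      by (intro sum_mono power_mono adjoint_contraction T) auto
    finally show "(nrm ?NN X2)\<^sup>2 \<le> X\<^sup>2" using X(1) unfolding R_nrm by linarith
  qed (rule X(2))
  have "ip {..<m} (V (fst p)) (R (V (snd p))) - ip {..<m} (T (fst p)) (R (T (snd p))) = X1 p + X2 p" for p
    by (simp add: X1_def X2_def R_diff ip_diff_left ip_diff_right)
  thus ?thesis using nrm_triangle[of ?NN X1 X2] n1 n2 by simp
qed

section \<open>Translation between matrices with the normalised norm and functions on index
  sets\<close>

lemma mat_adjoint_mult_index:
  fixes A B :: "complex mat"
  assumes "A \<in> carrier_mat k n" "B \<in> carrier_mat k n'" "i < n" "j < n'"
  shows "(mat_adjoint A * B) $$ (i, j) = (\<Sum>c<k. cnj (A $$ (c, i)) * B $$ (c, j))"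
  using assms by (simp add: scalar_prod_def mat_adjoint_index atLeast0LessThan)

lemma mult_mat_adjoint_index:
  fixes A B :: "complex mat"
  assumes "A \<in> carrier_mat n k" "B \<in> carrier_mat n' k" "i < n" "j < n'"
  shows "(A * mat_adjoint B) $$ (i, j) = (\<Sum>c<k. A $$ (i, c) * cnj (B $$ (j, c)))"
  using assms by (simp add: scalar_prod_def mat_adjoint_index atLeast0LessThan)

lemma mat_adjoint_carrier [simp]: "A \<in> carrier_mat n k \<Longrightarrow> mat_adjoint A \<in> carrier_mat k n"
  by (intro carrier_matI) simp_all

lemma hs_norm_nrm:
  assumes "X \<in> carrier_mat N N"
  shows "hs_norm N X = nrm ({..<N} \<times> {..<N}) (\<lambda>p. X $$ p) / sqrt (real N)"
proof -
  have "(\<Sum>j<N. \<Sum>i<N. (cmod (X $$ (i, j)))\<^sup>2) = (nrm ({..<N} \<times> {..<N}) (\<lambda>p. X $$ p))\<^sup>2"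
    unfolding nrm_Times unfolding nrm_power2 by (rule sum.swap)
  thus ?thesis using assms by (simp add: hs_norm_entries real_sqrt_divide)
qed

lemma hs_norm_le_iff:
  assumes "X \<in> carrier_mat N N" "N > 0" "\<And>p. p \<in> {..<N} \<times> {..<N} \<Longrightarrow> X $$ p = f p"
  shows "hs_norm N X \<le> c \<longleftrightarrow> nrm ({..<N} \<times> {..<N}) f \<le> c * sqrt (real N)"
proof -
  have "nrm ({..<N} \<times> {..<N}) (\<lambda>p. X $$ p) = nrm ({..<N} \<times> {..<N}) f" using assms(3) by (rule nrm_cong)
  thus ?thesis using assms by (simp add: hs_norm_nrm pos_divide_le_eq)
qed

lemma hs_norm_triangle:
  assumes "X \<in> carrier_mat N N" "Y \<in> carrier_mat N N" "Z \<in> carrier_mat N N"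
    and "hs_norm N (X - Y) \<le> a" "hs_norm N (Y - Z) \<le> b"
  shows "hs_norm N (X - Z) \<le> a + b"
  using Metric_space.triangle[OF Metric_space_hs_dist assms(1-3)] assms by (simp add: hs_dist_def)

lemma hs_norm_minus_commute:
  "X \<in> carrier_mat N N \<Longrightarrow> Y \<in> carrier_mat N N \<Longrightarrow> hs_norm N (X - Y) = hs_norm N (Y - X)"
  using Metric_space.commute[OF Metric_space_hs_dist, of N X Y] by (simp add: hs_dist_def)

lemma hs_norm_unitary_left:
  assumes "U \<in> carrier_mat N N" "mat_adjoint U * U = 1\<^sub>m N" "X \<in> carrier_mat N N"
  shows "hs_norm N (U * X) = hs_norm N X"
proof -
  have "mat_adjoint (U * X) * (U * X) = (mat_adjoint X * mat_adjoint U) * (U * X)"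
    using assms by (simp add: mat_adjoint_mult[of _ N N _ N])
  also have "\<dots> = mat_adjoint X * (mat_adjoint U * (U * X))"
    using assms by (simp add: assoc_mult_mat[of _ N N _ N _ N])
  also have "mat_adjoint U * (U * X) = X"
    using assms by (simp add: assoc_mult_mat[symmetric, of _ N N _ N _ N])
  finally show ?thesis by (simp add: hs_norm_def)
qed

lemma carrier_unitary_group:
  "U \<in> carrier (unitary_group N) \<longleftrightarrow> U \<in> carrier_mat N N \<and> mat_adjoint U * U = 1\<^sub>m N \<and> U * mat_adjoint U = 1\<^sub>m N"
  by (simp add: unitary_group_def)

lemma unitary_groupI:
  assumes "U \<in> carrier_mat N N" "mat_adjoint U * U = 1\<^sub>m N"
  shows "U \<in> carrier (unitary_group N)"
  using assms mat_mult_left_right_inverse[of "mat_adjoint U" N U] by (simp add: carrier_unitary_group)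

lemma unitary_adjoint_cancel:
  assumes "U \<in> carrier (unitary_group N)" "X \<in> carrier_mat N N"
  shows "mat_adjoint U * (U * X) = X"
  using assms by (simp add: carrier_unitary_group assoc_mult_mat[symmetric, of _ N N _ N _ N])

lemma unitary_entry_bound:
  assumes "U \<in> carrier (unitary_group N)" "a < N" "b < N"
  shows "cmod (U $$ (a, b)) \<le> 1"
proof -
  have U: "U \<in> carrier_mat N N" "mat_adjoint U * U = 1\<^sub>m N" using assms by (auto simp: carrier_unitary_group)
  have "(\<Sum>c<N. cnj (U $$ (c, b)) * U $$ (c, b)) = 1"
    using mat_adjoint_mult_index[OF U(1) U(1) assms(3,3)] U(2) assms(3) by simp
  hence "complex_of_real (\<Sum>c<N. (cmod (U $$ (c, b)))\<^sup>2) = of_real 1" by (simp add: cnj_mult_self)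
  hence "(\<Sum>c<N. (cmod (U $$ (c, b)))\<^sup>2) = 1" unfolding of_real_eq_iff .
  moreover have "(cmod (U $$ (a, b)))\<^sup>2 \<le> (\<Sum>c<N. (cmod (U $$ (c, b)))\<^sup>2)"
    using assms(2) by (intro member_le_sum) auto
  ultimately have "(cmod (U $$ (a, b)))\<^sup>2 \<le> 1\<^sup>2" by simp
  thus ?thesis by (rule power2_le_imp_le) simp
qed

lemma isometry_matI:
  assumes V: "V \<in> carrier_mat m N" and o: "orthonormal {..<m} {..<N} (\<lambda>b i. V $$ (i, b))"
  shows "isometry_mat N m V"
  unfolding isometry_mat_def
proof (intro conjI ballI V)
  fix v :: "complex vec" assume v: "v \<in> carrier_vec N"
  have en: "euclidean_norm x = nrm {..<k} (\<lambda>i. x $ i)" if "x \<in> carrier_vec k" for x k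
  proof -
    have "x \<bullet>c x = complex_of_real ((nrm {..<k} (\<lambda>i. x $ i))\<^sup>2)"
      using that by (simp add: scalar_prod_def nrm_power2 cnj_mult_self atLeast0LessThan)
    thus ?thesis by (simp add: euclidean_norm_def)
  qed
  have "nrm {..<m} (\<lambda>i. (V *\<^sub>v v) $ i) = nrm {..<m} (\<lambda>i. \<Sum>b<N. v $ b * V $$ (i, b))"
    using V v by (intro nrm_cong) (simp add: scalar_prod_def atLeast0LessThan mult.commute)
  also have "\<dots> = nrm {..<N} (\<lambda>b. v $ b)"
  proof -
    have "(nrm {..<m} (\<lambda>i. \<Sum>b<N. v $ b * V $$ (i, b)))\<^sup>2 = (nrm {..<N} (\<lambda>b. v $ b))\<^sup>2"
      unfolding nrm_orthonormal_sum[OF finite_lessThan o] by (simp add: nrm_power2)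
    thus ?thesis by simp
  qed
  finally show "euclidean_norm (V *\<^sub>v v) = euclidean_norm v"
    using en[of "V *\<^sub>v v" m] en[OF v] V v by simp
qed

section \<open>Partitions of unity and the exact dilation\<close>

context bi_invariant_group
begin

text \<open>Hat functions of radius \<open>r\<close> around a net of radius \<open>r / 2\<close>,
  divided by their sum \<open>W\<close>. The smaller radius of the net makes some hat at least
  \<open>r / 2\<close> at every point, so \<open>W\<close> is bounded away from 0 and the quotient
  stays Lipschitz.\<close>

lemma lipschitz_partition_of_unity:
  assumes r: "r > 0"
  shows "\<exists>P c C. finite P \<and> P \<subseteq> carrier G \<and> C \<ge> 0 \<and>
    (\<forall>p\<in>P. \<forall>x\<in>carrier G. 0 \<le> c p x \<and> (c p x \<noteq> 0 \<longrightarrow> d p x \<le> r)) \<and>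
    (\<forall>x\<in>carrier G. (\<Sum>p\<in>P. c p x) = (1::real)) \<and>
    (\<forall>p\<in>P. \<forall>x\<in>carrier G. \<forall>y\<in>carrier G. \<bar>c p x - c p y\<bar> \<le> C * d x y)"
proof -
  obtain P where P: "finite P" "P \<subseteq> carrier G" "\<And>x. x \<in> carrier G \<Longrightarrow> \<exists>p\<in>P. d p x < r / 2"
    using finite_net[of "r / 2"] r by auto
  define w where "w p x = max 0 (r - d p x)" for p x
  define W where "W x = (\<Sum>p\<in>P. w p x)" for x
  define c where "c p x = w p x / W x" for p x
  define C where "C = (real (card P) + 1) / (r / 2)"
  have w0: "0 \<le> w p x" for p x by (simp add: w_def)
  have wW: "w p x \<le> W x" if "p \<in> P" for p x
    unfolding W_def using that P(1) w0 by (intro member_le_sum) auto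
  have Wr: "r / 2 \<le> W x" if x: "x \<in> carrier G" for x
  proof -
    obtain p where p: "p \<in> P" "d p x < r / 2" using P(3)[OF x] by blast
    have "r / 2 \<le> r - d p x" using p(2) by simp
    hence "r / 2 \<le> w p x" by (simp add: w_def le_max_iff_disj)
    thus ?thesis using wW[OF p(1), of x] by linarith
  qed
  have w_lip: "\<bar>w p x - w p y\<bar> \<le> d x y" if "p \<in> P" "x \<in> carrier G" "y \<in> carrier G" for p x y
  proof -
    have "p \<in> carrier G" using that P(2) by blast
    hence "\<bar>d p x - d p y\<bar> \<le> d x y"
      using that triangle[of p x y] triangle[of p y x] commute[of x y] by linarith
    thus ?thesis unfolding w_def by linarith
  qed
  have W_lip: "\<bar>W x - W y\<bar> \<le> real (card P) * d x y" if "x \<in> carrier G" "y \<in> carrier G" for x y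
  proof -
    have "\<bar>W x - W y\<bar> \<le> (\<Sum>p\<in>P. \<bar>w p x - w p y\<bar>)"
      unfolding W_def sum_subtractf[symmetric] by (rule sum_abs)
    also have "\<dots> \<le> (\<Sum>p\<in>P. d x y)" using w_lip that by (intro sum_mono)
    finally show ?thesis by simp
  qed
  have "\<bar>c p x - c p y\<bar> \<le> C * d x y" if p: "p \<in> P" and x: "x \<in> carrier G" and y: "y \<in> carrier G" for p x y
  proof -
    have Wp: "W x > 0" "W y > 0" using Wr[OF x] Wr[OF y] r by linarith+
    \<comment> \<open>Arranged so that the only factor not bounded by 1 or by the Lipschitz
      constants of the hats and of \<open>W\<close> is the denominator \<open>W y\<close>, at least
      \<open>r / 2\<close>.\<close>
    have "c p x - c p y = (w p x / W x * (W y - W x) + (w p x - w p y)) / W y"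
      using Wp by (simp add: c_def field_simps)
    hence "\<bar>c p x - c p y\<bar> = \<bar>w p x / W x * (W y - W x) + (w p x - w p y)\<bar> / W y" using Wp by simp
    also have "\<dots> \<le> (real (card P) * d x y + d x y) / W y"
    proof (intro divide_right_mono)
      have "\<bar>w p x / W x * (W y - W x)\<bar> \<le> 1 * (real (card P) * d x y)"
        unfolding abs_mult using w0[of p x] wW[OF p, of x] Wp W_lip[OF y x] commute[of x y]
        by (intro mult_mono) auto
      thus "\<bar>w p x / W x * (W y - W x) + (w p x - w p y)\<bar> \<le> real (card P) * d x y + d x y"
        using w_lip[OF p x y] by linarith
    qed (use Wp in simp)
    also have "\<dots> \<le> (real (card P) * d x y + d x y) / (r / 2)"
      using Wr[OF y] r Wp by (intro divide_left_mono) auto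
    also have "\<dots> = C * d x y" by (simp add: C_def algebra_simps add_divide_distrib)
    finally show ?thesis .
  qed
  moreover have "(\<Sum>p\<in>P. c p x) = 1" if "x \<in> carrier G" for x
  proof -
    have "W x > 0" using Wr[OF that] r by linarith
    thus ?thesis by (simp add: c_def W_def flip: sum_divide_distrib)
  qed
  moreover have "0 \<le> c p x \<and> (c p x \<noteq> 0 \<longrightarrow> d p x \<le> r)" if "p \<in> P" "x \<in> carrier G" for p x
  proof
    show "0 \<le> c p x" using w0 by (simp add: c_def W_def sum_nonneg)
    show "c p x \<noteq> 0 \<longrightarrow> d p x \<le> r" by (auto simp: c_def w_def max_def split: if_splits)
  qed
  moreover have "C \<ge> 0" using r by (simp add: C_def)
  ultimately show ?thesis using P(1,2) by (intro exI[of _ P] exI[of _ c] exI[of _ C]) simp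
qed

text \<open>At \<open>\<eta> = 0\<close> the matrices \<open>\<sigma> g\<close> form a unitary
  representation, which is made larger by trivial summands on the coordinates that
  \<open>nearby_isometry\<close> adds. \<open>compression_perturbation\<close> then moves the
  compression from \<open>T\<close> to the isometry \<open>V\<close>.\<close>

lemma exact_dilation:
  fixes u :: "'a \<Rightarrow> nat \<Rightarrow> nat \<Rightarrow> complex"
  assumes nd: "near_dilation N u K \<kappa> R \<Lambda> 0 m \<sigma> T" and K: "K \<ge> 0" and N: "N > 0"
  shows "\<exists>m' \<rho> V. N \<le> m' \<and> real m' \<le> m + 2 * K\<^sup>2 \<and> \<rho> \<in> hom G (unitary_group m') \<and>
    (\<exists>C. \<forall>g\<in>carrier G. \<forall>h\<in>carrier G. hs_dist m' (\<rho> g) (\<rho> h) \<le> C * d g h) \<and>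
    isometry_mat N m' V \<and>
    (\<forall>g\<in>carrier G. nrm ({..<N} \<times> {..<N}) (\<lambda>p. u g (fst p) (snd p) - (mat_adjoint V * \<rho> g * V) $$ p) \<le> \<kappa> + 4 * K)"
proof -
  have \<sigma>_lip: "\<And>i j g h. i < m \<Longrightarrow> j < m \<Longrightarrow> g \<in> carrier G \<Longrightarrow> h \<in> carrier G \<Longrightarrow>
      cmod (\<sigma> g i j - \<sigma> h i j) \<le> \<Lambda> * d g h"
    and \<sigma>_mult: "\<And>i j g h. i < m \<Longrightarrow> j < m \<Longrightarrow> g \<in> carrier G \<Longrightarrow> h \<in> carrier G \<Longrightarrow>
      \<sigma> (h \<otimes> g) i j = (\<Sum>k<m. \<sigma> h i k * \<sigma> g k j)"
    and \<sigma>_unit: "\<And>i j g. i < m \<Longrightarrow> j < m \<Longrightarrow> g \<in> carrier G \<Longrightarrow>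
      (\<Sum>k<m. cnj (\<sigma> g k i) * \<sigma> g k j) = of_bool (i = j)"
    and contr: "\<And>z. (\<Sum>i<m. (cmod (\<Sum>b<N. T i b * z b))\<^sup>2) \<le> (\<Sum>b<N. (cmod (z b))\<^sup>2)"
    and mass: "real N - K\<^sup>2 \<le> (\<Sum>i<m. \<Sum>b<N. (cmod (T i b))\<^sup>2)"
    and compress: "\<And>g. g \<in> carrier G \<Longrightarrow> nrm ({..<N} \<times> {..<N})
      (\<lambda>p. (\<Sum>i<m. \<Sum>j<m. cnj (T i (fst p)) * \<sigma> g i j * T j (snd p)) - u g (fst p) (snd p)) \<le> \<kappa>"
    using nd by (simp_all add: near_dilation_def)
  obtain m' V where m': "m \<le> m'" "N \<le> m'" "real m' \<le> m + 2 * K\<^sup>2"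
    and oV: "orthonormal {..<m'} {..<N} (\<lambda>b i. V i b)"
    and VT: "(\<Sum>b<N. (nrm {..<m'} (\<lambda>i. V i b - (if i < m then T i b else 0)))\<^sup>2) \<le> 3 * K\<^sup>2"
    using nearby_isometry[OF contr mass] by blast
  define T' where "T' b i = (if i < m then T i b else 0)" for b i
  \<comment> \<open>The identity on the coordinates from \<open>m\<close> to \<open>m' - 1\<close>,
    and no entries mixing them with the first \<open>m\<close>.\<close>
  define r where "r g i j = (if i < m \<and> j < m then \<sigma> g i j else of_bool (i = j))" for g i j
  define \<rho> where "\<rho> g = mat m' m' (\<lambda>(i, j). r g i j)" for g
  define Vm where "Vm = mat m' N (\<lambda>(i, b). V i b)"
  have sub: "{..<m} \<subseteq> {..<m'}" using m' by auto
  have r_sum: "(\<Sum>k<m'. x k * r g k j) = (if j < m then \<Sum>k<m. x k * \<sigma> g k j else x j)"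
    if "j < m'" for x :: "nat \<Rightarrow> complex" and g j
  proof (cases "j < m")
    case True
    have "(\<Sum>k<m'. x k * r g k j) = (\<Sum>k<m. x k * r g k j)"
      using True by (intro sum.mono_neutral_right sub) (auto simp: r_def)
    also have "\<dots> = (\<Sum>k<m. x k * \<sigma> g k j)" using True by (intro sum.cong) (auto simp: r_def)
    finally show ?thesis using True by simp
  next
    case False
    hence "(\<Sum>k<m'. x k * r g k j) = (\<Sum>k<m'. if k = j then x j else 0)"
      by (intro sum.cong) (auto simp: r_def)
    thus ?thesis using False that by simp
  qed
  have r_mult: "(\<Sum>k<m'. r h i k * r g k j) = r (h \<otimes> g) i j"
    if "i < m'" "j < m'" "g \<in> carrier G" "h \<in> carrier G" for i j g h
  proof (cases "i < m \<and> j < m")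
    case True
    thus ?thesis using that unfolding r_sum[OF that(2)] by (simp add: r_def \<sigma>_mult)
  next
    case False
    thus ?thesis unfolding r_sum[OF that(2)] by (auto simp: r_def)
  qed
  have r_unit: "(\<Sum>k<m'. cnj (r g k i) * r g k j) = of_bool (i = j)"
    if "i < m'" "j < m'" "g \<in> carrier G" for i j g
  proof (cases "i < m \<and> j < m")
    case True
    thus ?thesis using that unfolding r_sum[OF that(2)] by (simp add: r_def \<sigma>_unit)
  next
    case False
    thus ?thesis unfolding r_sum[OF that(2)] by (auto simp: r_def)
  qed
  have \<rho>_carrier: "\<rho> g \<in> carrier_mat m' m'" for g by (simp add: \<rho>_def)
  have Vm: "Vm \<in> carrier_mat m' N" by (simp add: Vm_def)
  have \<rho>_unitary: "\<rho> g \<in> carrier (unitary_group m')" if g: "g \<in> carrier G" for g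
  proof (rule unitary_groupI[OF \<rho>_carrier], rule eq_matI)
    fix i j assume "i < dim_row (1\<^sub>m m' :: complex mat)" "j < dim_col (1\<^sub>m m' :: complex mat)"
    hence ij: "i < m'" "j < m'" by simp_all
    have "(mat_adjoint (\<rho> g) * \<rho> g) $$ (i, j) = (\<Sum>k<m'. cnj (r g k i) * r g k j)"
      using mat_adjoint_mult_index[OF \<rho>_carrier \<rho>_carrier ij] ij by (simp add: \<rho>_def)
    thus "(mat_adjoint (\<rho> g) * \<rho> g) $$ (i, j) = 1\<^sub>m m' $$ (i, j)" using r_unit[OF ij g] ij by simp
  qed (use \<rho>_carrier in auto)
  have "\<rho> \<in> hom G (unitary_group m')"
  proof (rule homI)
    fix h g assume gh: "h \<in> carrier G" "g \<in> carrier G"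
    have "\<rho> (h \<otimes> g) = \<rho> h * \<rho> g"
    proof (rule eq_matI)
      fix i j assume "i < dim_row (\<rho> h * \<rho> g)" "j < dim_col (\<rho> h * \<rho> g)"
      hence ij: "i < m'" "j < m'" by (simp_all add: \<rho>_def)
      thus "\<rho> (h \<otimes> g) $$ (i, j) = (\<rho> h * \<rho> g) $$ (i, j)"
        using r_mult[OF ij gh(2,1)] by (simp add: \<rho>_def scalar_prod_def atLeast0LessThan)
    qed (simp_all add: \<rho>_def)
    thus "\<rho> (h \<otimes> g) = \<rho> h \<otimes>\<^bsub>unitary_group m'\<^esub> \<rho> g" by (simp add: unitary_group_def)
  qed (rule \<rho>_unitary)
  moreover have "\<exists>C. \<forall>g\<in>carrier G. \<forall>h\<in>carrier G. hs_dist m' (\<rho> g) (\<rho> h) \<le> C * d g h"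
  proof (intro exI ballI)
    fix g h assume gh: "g \<in> carrier G" "h \<in> carrier G"
    have m'0: "m' > 0" using m'(2) N by simp
    have "nrm ({..<m'} \<times> {..<m'}) (\<lambda>p. r g (fst p) (snd p) - r h (fst p) (snd p))
        \<le> (\<Sum>p\<in>{..<m'} \<times> {..<m'}. cmod (r g (fst p) (snd p) - r h (fst p) (snd p)))"
      unfolding nrm_def by (rule L2_set_le_sum) simp
    also have "\<dots> \<le> (\<Sum>p\<in>{..<m'} \<times> {..<m'}. \<bar>\<Lambda>\<bar> * d g h)"
    proof (rule sum_mono)
      fix p
      show "cmod (r g (fst p) (snd p) - r h (fst p) (snd p)) \<le> \<bar>\<Lambda>\<bar> * d g h"
      proof (cases "fst p < m \<and> snd p < m")
        case True
        have "cmod (\<sigma> g (fst p) (snd p) - \<sigma> h (fst p) (snd p)) \<le> \<Lambda> * d g h" using True gh by (intro \<sigma>_lip) auto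
        also have "\<dots> \<le> \<bar>\<Lambda>\<bar> * d g h" by (intro mult_right_mono) auto
        finally show ?thesis using True by (simp add: r_def)
      qed (auto simp: r_def)
    qed
    \<comment> \<open>The constant is very crude and grows with the dimension; it serves only to
      make \<open>\<rho>\<close> continuous.\<close>
    also have "\<dots> = (real m' * real m' * \<bar>\<Lambda>\<bar>) / sqrt (real m') * d g h * sqrt (real m')"
      using m'0 by (simp add: card_cartesian_product)
    finally have "hs_norm m' (\<rho> g - \<rho> h) \<le> (real m' * real m' * \<bar>\<Lambda>\<bar>) / sqrt (real m') * d g h"
      by (subst hs_norm_le_iff[OF _ m'0, of _ "\<lambda>p. r g (fst p) (snd p) - r h (fst p) (snd p)"])
        (auto simp: \<rho>_def)
    thus "hs_dist m' (\<rho> g) (\<rho> h) \<le> (real m' * real m' * \<bar>\<Lambda>\<bar>) / sqrt (real m') * d g h"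
      using \<rho>_carrier by (simp add: hs_dist_def)
  qed
  moreover have "isometry_mat N m' Vm"
  proof (rule isometry_matI[OF Vm])
    have "ip {..<m'} (\<lambda>i. Vm $$ (i, b)) (\<lambda>i. Vm $$ (i, c)) = ip {..<m'} (\<lambda>i. V i b) (\<lambda>i. V i c)"
      if "b < N" "c < N" for b c using that by (intro ip_cong) (auto simp: Vm_def)
    thus "orthonormal {..<m'} {..<N} (\<lambda>b i. Vm $$ (i, b))" using oV by (simp add: orthonormal_def)
  qed
  moreover have "nrm ({..<N} \<times> {..<N}) (\<lambda>p. u g (fst p) (snd p) - (mat_adjoint Vm * \<rho> g * Vm) $$ p) \<le> \<kappa> + 4 * K"
    if g: "g \<in> carrier G" for g
  proof -
    let ?NN = "{..<N} \<times> {..<N}"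
    define R where "R x i = (\<Sum>j<m'. x j * r g i j)" for x i
    have oR: "orthonormal {..<m'} {..<m'} (\<lambda>j i. r g i j)"
      using r_unit[OF _ _ g] by (simp add: orthonormal_def ip_def)
    have T'c: "nrm {..<m'} (\<lambda>i. \<Sum>b<N. z b * T' b i) \<le> nrm {..<N} z" for z
    proof (rule power2_le_imp_le)
      have "(nrm {..<m'} (\<lambda>i. \<Sum>b<N. z b * T' b i))\<^sup>2 = (\<Sum>i<m. (cmod (\<Sum>b<N. T i b * z b))\<^sup>2)"
        unfolding nrm_power2 by (intro sum.mono_neutral_cong_right sub) (auto simp: T'_def mult.commute)
      thus "(nrm {..<m'} (\<lambda>i. \<Sum>b<N. z b * T' b i))\<^sup>2 \<le> (nrm {..<N} z)\<^sup>2"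
        using contr[of z] by (simp add: nrm_power2)
    qed simp
    \<comment> \<open>The root of 3 is rounded up to 2; doubling in
      \<open>compression_perturbation\<close> gives the 4 K of the statement.\<close>
    have "3 * K\<^sup>2 \<le> (2 * K)\<^sup>2" by (simp add: power_mult_distrib)
    hence VT2: "(\<Sum>b<N. (nrm {..<m'} (\<lambda>i. V i b - T' b i))\<^sup>2) \<le> (2 * K)\<^sup>2"
      using VT unfolding T'_def by linarith
    have 1: "nrm ?NN (\<lambda>p. ip {..<m'} (\<lambda>i. V i (fst p)) (R (\<lambda>i. V i (snd p))) - ip {..<m'} (T' (fst p)) (R (T' (snd p)))) \<le> 2 * (2 * K)"
      unfolding R_def
      by (rule compression_perturbation[OF oR oV T'c VT2]) (use K in simp)
    have "ip {..<m'} (T' (fst p)) (R (T' (snd p))) = (\<Sum>i<m. \<Sum>j<m. cnj (T i (fst p)) * \<sigma> g i j * T j (snd p))" for p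
    proof -
      have "R (T' (snd p)) i = (\<Sum>j<m. \<sigma> g i j * T j (snd p))" if "i < m" for i
        unfolding R_def using that by (intro sum.mono_neutral_cong_right sub) (auto simp: T'_def r_def)
      hence "ip {..<m'} (T' (fst p)) (R (T' (snd p))) = (\<Sum>i<m. cnj (T i (fst p)) * (\<Sum>j<m. \<sigma> g i j * T j (snd p)))"
        unfolding ip_def by (intro sum.mono_neutral_cong_right sub) (auto simp: T'_def)
      thus ?thesis by (simp add: sum_distrib_left mult.assoc)
    qed
    hence 2: "nrm ?NN (\<lambda>p. ip {..<m'} (T' (fst p)) (R (T' (snd p))) - u g (fst p) (snd p)) \<le> \<kappa>"
      using compress[OF g] by simp
    have 3: "(mat_adjoint Vm * \<rho> g * Vm) $$ p = ip {..<m'} (\<lambda>i. V i (fst p)) (R (\<lambda>i. V i (snd p)))" if p: "p \<in> ?NN" for p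
    proof -
      have ab: "fst p < N" "snd p < N" using p by auto
      have "mat_adjoint Vm * \<rho> g * Vm = mat_adjoint Vm * (\<rho> g * Vm)"
        using Vm \<rho>_carrier by (intro assoc_mult_mat[of _ N m' _ m' _ N]) auto
      hence "(mat_adjoint Vm * \<rho> g * Vm) $$ p = (mat_adjoint Vm * (\<rho> g * Vm)) $$ (fst p, snd p)" by simp
      also have "\<dots> = (\<Sum>i<m'. cnj (Vm $$ (i, fst p)) * (\<rho> g * Vm) $$ (i, snd p))"
        by (rule mat_adjoint_mult_index[OF Vm mult_carrier_mat[OF \<rho>_carrier Vm] ab])
      also have "\<dots> = (\<Sum>i<m'. cnj (V i (fst p)) * R (\<lambda>i. V i (snd p)) i)"
        using ab by (intro sum.cong refl)
          (auto simp: Vm_def \<rho>_def R_def scalar_prod_def atLeast0LessThan mult.commute)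
      finally show ?thesis by (simp add: ip_def)
    qed
    have "nrm ?NN (\<lambda>p. u g (fst p) (snd p) - (mat_adjoint Vm * \<rho> g * Vm) $$ p)
        = nrm ?NN (\<lambda>p. ip {..<m'} (\<lambda>i. V i (fst p)) (R (\<lambda>i. V i (snd p))) - u g (fst p) (snd p))"
      by (subst nrm_diff_commute) (intro nrm_cong, simp add: 3)
    also have "\<dots> \<le> 2 * (2 * K) + \<kappa>"
      by (rule order_trans[OF nrm_diff_triangle add_mono[OF 1 2]])
    finally show ?thesis by simp
  qed
  ultimately show ?thesis using m' by blast
qed

end

section \<open>The quantitative theorem for one group, and the sequence\<close>

lemma minus_mat_index:
  "Y \<in> carrier_mat n k \<Longrightarrow> p \<in> {..<n} \<times> {..<k} \<Longrightarrow> (X - Y) $$ p = X $$ p - Y $$ p"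
  by (cases p) auto

context bi_invariant_group
begin

lemma lipschitz_inv:
  assumes "lipschitz C h"
  shows "lipschitz C (\<lambda>x. h (inv x))"
  unfolding lipschitz_def
proof (intro ballI)
  fix x y assume xy: "x \<in> carrier G" "y \<in> carrier G"
  hence "cmod (h (inv x) - h (inv y)) \<le> C * d (inv x) (inv y)" using assms by (simp add: lipschitz_def)
  thus "cmod (h (inv x) - h (inv y)) \<le> C * d x y" using xy by (simp add: inv_invariant)
qed

lemma lipschitz_imp_continuous:
  assumes "\<rho> \<in> carrier G \<rightarrow> carrier (unitary_group m)"
    and "\<And>g h. g \<in> carrier G \<Longrightarrow> h \<in> carrier G \<Longrightarrow> hs_dist m (\<rho> g) (\<rho> h) \<le> C * d g h"
  shows "continuous_map mtopology (unitary_topology m) \<rho>"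
  unfolding unitary_topology_def metric_continuous_map[OF Metric_space_unitary]
proof (intro conjI ballI allI impI)
  show "\<rho> ` carrier G \<subseteq> carrier (unitary_group m)" using assms(1) by auto
  fix a and e :: real assume a: "a \<in> carrier G" and e: "e > 0"
  have "hs_dist m (\<rho> a) (\<rho> x) < e" if "x \<in> carrier G" "d a x < e / (\<bar>C\<bar> + 1)" for x
  proof -
    have "hs_dist m (\<rho> a) (\<rho> x) \<le> C * d a x" using a that assms(2) by simp
    also have "\<dots> \<le> (\<bar>C\<bar> + 1) * d a x" by (intro mult_right_mono) auto
    also have "\<dots> < (\<bar>C\<bar> + 1) * (e / (\<bar>C\<bar> + 1))" using that by (intro mult_strict_left_mono) auto
    finally show ?thesis by simp
  qed
  thus "\<exists>\<delta>>0. \<forall>x. x \<in> carrier G \<and> d a x < \<delta> \<longrightarrow> hs_dist m (\<rho> a) (\<rho> x) < e"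
    using e by (intro exI[of _ "e / (\<bar>C\<bar> + 1)"]) auto
qed

text \<open>\<open>v x\<close> is a convex combination of values of \<open>u\<close> at points
  within \<open>r\<close> of \<open>x\<close>, which preserves the entry bound and keeps it within
  \<open>\<kappa>\<close> of \<open>u x\<close>. Its regularity comes from the weights alone, so
  \<open>u\<close> may be arbitrarily irregular at small scale.\<close>

lemma lipschitz_smoothing:
  fixes u :: "'a \<Rightarrow> nat \<Rightarrow> nat \<Rightarrow> complex"
  assumes r: "r > 0" and bound: "\<And>x a b. x \<in> carrier G \<Longrightarrow> a < N \<Longrightarrow> b < N \<Longrightarrow> cmod (u x a b) \<le> 1"
    and near: "\<And>x y. x \<in> carrier G \<Longrightarrow> y \<in> carrier G \<Longrightarrow> d x y \<le> r \<Longrightarrow>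
      nrm ({..<N} \<times> {..<N}) (\<lambda>p. u x (fst p) (snd p) - u y (fst p) (snd p)) \<le> \<kappa>"
  shows "\<exists>v C. C \<ge> 0 \<and> (\<forall>a<N. \<forall>b<N. bounded_by 1 (\<lambda>x. v x a b) \<and> lipschitz C (\<lambda>x. v x a b)) \<and>
    (\<forall>x\<in>carrier G. nrm ({..<N} \<times> {..<N}) (\<lambda>p. v x (fst p) (snd p) - u x (fst p) (snd p)) \<le> \<kappa>)"
proof -
  obtain P c C0 where P: "finite P" "P \<subseteq> carrier G" and C0: "C0 \<ge> 0"
    and c01: "\<forall>p\<in>P. \<forall>x\<in>carrier G. 0 \<le> c p x \<and> (c p x \<noteq> 0 \<longrightarrow> d p x \<le> r)"
    and sum1: "\<forall>x\<in>carrier G. (\<Sum>p\<in>P. c p x) = (1::real)"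
    and lip: "\<forall>p\<in>P. \<forall>x\<in>carrier G. \<forall>y\<in>carrier G. \<bar>c p x - c p y\<bar> \<le> C0 * d x y"
    using lipschitz_partition_of_unity[OF r] by blast
  have c: "0 \<le> c p x" "c p x \<noteq> 0 \<Longrightarrow> d p x \<le> r" if "p \<in> P" "x \<in> carrier G" for p x
    using c01 that by simp_all
  note c1 = sum1[rule_format] and c_lip = lip[rule_format]
  have P_G: "p \<in> carrier G" if "p \<in> P" for p using P(2) that by blast
  define v where "v x a b = (\<Sum>p\<in>P. u p a b * of_real (c p x))" for x a b
  have "bounded_by 1 (\<lambda>x. v x a b)" if "a < N" "b < N" for a b
    unfolding bounded_by_def
  proof
    fix x assume x: "x \<in> carrier G"
    have "cmod (v x a b) \<le> (\<Sum>p\<in>P. c p x)"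
      unfolding v_def
    proof (rule sum_norm_le)
      fix p assume p: "p \<in> P"
      have "cmod (u p a b) * c p x \<le> 1 * c p x"
        using bound[OF P_G[OF p] that] c(1)[OF p x] by (rule mult_right_mono)
      thus "cmod (u p a b * of_real (c p x)) \<le> c p x" using c(1)[OF p x] by (simp add: norm_mult)
    qed
    thus "cmod (v x a b) \<le> 1" using c1[OF x] by simp
  qed
  moreover have "lipschitz (real (card P) * (1 * C0)) (\<lambda>x. v x a b)" if "a < N" "b < N" for a b
    unfolding v_def[abs_def]
  proof (intro lipschitz_sum lipschitz_scale)
    fix p assume p: "p \<in> P"
    show "lipschitz C0 (\<lambda>x. complex_of_real (c p x))"
      using c_lip[OF p] by (simp add: lipschitz_def flip: of_real_diff)
    show "cmod (u p a b) \<le> 1" using bound[OF P_G[OF p] that] .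
  qed (rule C0)
  moreover have "nrm ({..<N} \<times> {..<N}) (\<lambda>q. v x (fst q) (snd q) - u x (fst q) (snd q)) \<le> \<kappa>"
    if x: "x \<in> carrier G" for x
  proof -
    have "v x a b - u x a b = (\<Sum>p\<in>P. of_real (c p x) * (u p a b - u x a b))" for a b
    proof -
      have "(\<Sum>p\<in>P. complex_of_real (c p x)) = 1"
        using arg_cong[OF c1[OF x], of complex_of_real] by simp
      hence "(\<Sum>p\<in>P. of_real (c p x) * u x a b) = u x a b" by (simp flip: sum_distrib_right)
      moreover have "(\<Sum>p\<in>P. of_real (c p x) * (u p a b - u x a b)) = v x a b - (\<Sum>p\<in>P. of_real (c p x) * u x a b)"
        unfolding v_def right_diff_distrib sum_subtractf by (simp add: mult.commute)
      ultimately show ?thesis by simp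
    qed
    hence "nrm ({..<N} \<times> {..<N}) (\<lambda>q. v x (fst q) (snd q) - u x (fst q) (snd q))
        = nrm ({..<N} \<times> {..<N}) (\<lambda>q. \<Sum>p\<in>P. of_real (c p x) * (u p (fst q) (snd q) - u x (fst q) (snd q)))"
      by simp
    also have "\<dots> \<le> (\<Sum>p\<in>P. nrm ({..<N} \<times> {..<N}) (\<lambda>q. of_real (c p x) * (u p (fst q) (snd q) - u x (fst q) (snd q))))"
      by (rule nrm_sum)
    also have "\<dots> \<le> (\<Sum>p\<in>P. c p x * \<kappa>)"
    proof (rule sum_mono)
      fix p assume p: "p \<in> P"
      show "nrm ({..<N} \<times> {..<N}) (\<lambda>q. of_real (c p x) * (u p (fst q) (snd q) - u x (fst q) (snd q))) \<le> c p x * \<kappa>"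
      proof (cases "c p x = 0")
        case True
        thus ?thesis unfolding nrm_scale by simp
      next
        case False
        have "c p x * nrm ({..<N} \<times> {..<N}) (\<lambda>q. u p (fst q) (snd q) - u x (fst q) (snd q)) \<le> c p x * \<kappa>"
          using c[OF p x] False by (intro mult_left_mono near P_G p x) auto
        thus ?thesis unfolding nrm_scale using c(1)[OF p x] by simp
      qed
    qed
    also have "\<dots> = \<kappa>" using c1[OF x] by (simp flip: sum_distrib_right)
    finally show ?thesis .
  qed
  ultimately show ?thesis
    using C0 by (intro exI[of _ v] exI[of _ "real (card P) * (1 * C0)"]) simp
qed

text \<open>All bounds are linear or quadratic in \<open>\<epsilon>\<close> and free of
  \<open>L\<close>, which only determines the radius of the smoothing. This uniformity is what lets
  the group change along the sequence.\<close>

lemma approximate_representation_dilation: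
  assumes N: "N > 0" and \<phi>: "\<And>x. x \<in> carrier G \<Longrightarrow> \<phi> x \<in> carrier (unitary_group N)"
    and \<epsilon>: "\<epsilon> > 0" and L: "L \<ge> 0"
    and rep: "eps_representation G N \<epsilon> \<phi>" and lip: "quasi_Lipschitz G d N L \<epsilon> \<phi>"
  shows "\<exists>m \<rho> V. N \<le> m \<and> real m \<le> real N * (1 + 1200 * \<epsilon>\<^sup>2) \<and> \<rho> \<in> hom G (unitary_group m) \<and>
    continuous_map mtopology (unitary_topology m) \<rho> \<and> isometry_mat N m V \<and>
    (\<forall>g\<in>carrier G. hs_norm N (\<phi> g - mat_adjoint V * \<rho> g * V) \<le> 125 * \<epsilon>)"
proof -
  let ?NN = "{..<N} \<times> {..<N}"
  \<comment> \<open>Converts the normalised norm \<open>hs_norm N\<close> into the unnormalised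
    \<open>nrm\<close>, in which the preceding lemmas are stated.\<close>
  define s where "s = sqrt (real N)"
  have s: "s > 0" "s\<^sup>2 = real N" using N by (simp_all add: s_def)
  have \<phi>c: "\<phi> x \<in> carrier_mat N N" and \<phi>u: "mat_adjoint (\<phi> x) * \<phi> x = 1\<^sub>m N" "\<phi> x * mat_adjoint (\<phi> x) = 1\<^sub>m N"
    if "x \<in> carrier G" for x using \<phi>[OF that] by (simp_all add: carrier_unitary_group)
  note \<phi>a = mat_adjoint_carrier[OF \<phi>c]
  define u where "u x a b = \<phi> x $$ (a, b)" for x a b
  have mult: "hs_norm N (\<phi> (x \<otimes> g) - \<phi> x * \<phi> g) \<le> \<epsilon>" if "x \<in> carrier G" "g \<in> carrier G" for x g
  proof -
    have "hs_dist N (\<phi> (x \<otimes> g)) (\<phi> x * \<phi> g) \<le> \<epsilon>" using rep that by (simp add: eps_representation_def)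
    moreover have "\<phi> (x \<otimes> g) \<in> carrier_mat N N" using that by (intro \<phi>c) simp
    moreover have "\<phi> x * \<phi> g \<in> carrier_mat N N"
      by (rule mult_carrier_mat[OF \<phi>c[OF that(1)] \<phi>c[OF that(2)]])
    ultimately show ?thesis by (simp add: hs_dist_def)
  qed
  \<comment> \<open>The defect of multiplicativity is multiplied by the unitary
    \<open>mat_adjoint (\<phi> x)\<close>, which preserves the norm. The choice x = g = 1 bounds the
    distance of \<open>\<phi> \<one>\<close> from the identity, and g = x^-1 enters the comparison
    of \<open>\<phi> (inv x)\<close> with the adjoint.\<close>
  have comp: "hs_norm N (mat_adjoint (\<phi> x) * \<phi> (x \<otimes> g) - \<phi> g) \<le> \<epsilon>" if x: "x \<in> carrier G" and g: "g \<in> carrier G" for x g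
  proof -
    have xg: "x \<otimes> g \<in> carrier G" using x g by simp
    have pm: "\<phi> x * \<phi> g \<in> carrier_mat N N" by (rule mult_carrier_mat[OF \<phi>c[OF x] \<phi>c[OF g]])
    have "mat_adjoint (\<phi> x) * \<phi> (x \<otimes> g) - \<phi> g = mat_adjoint (\<phi> x) * \<phi> (x \<otimes> g) - mat_adjoint (\<phi> x) * (\<phi> x * \<phi> g)"
      using unitary_adjoint_cancel[OF \<phi>[OF x] \<phi>c[OF g]] by simp
    also have "\<dots> = mat_adjoint (\<phi> x) * (\<phi> (x \<otimes> g) - \<phi> x * \<phi> g)"
      using mult_minus_distrib_mat[OF \<phi>a[OF x] \<phi>c[OF xg] pm] by simp
    also have "hs_norm N \<dots> = hs_norm N (\<phi> (x \<otimes> g) - \<phi> x * \<phi> g)"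
      using \<phi>u[OF x] \<phi>a[OF x] minus_carrier_mat[OF pm] by (intro hs_norm_unitary_left) (simp_all add: mat_adjoint_adjoint)
    finally show ?thesis using mult[OF x g] by simp
  qed
  have one: "hs_norm N (1\<^sub>m N - \<phi> \<one>) \<le> \<epsilon>"
    using comp[OF one_closed one_closed] \<phi>u(1)[OF one_closed] by simp
  have inv_close: "hs_norm N (\<phi> (inv x) - mat_adjoint (\<phi> x)) \<le> \<epsilon> + \<epsilon>" if x: "x \<in> carrier G" for x
  proof -
    have p: "mat_adjoint (\<phi> x) * \<phi> \<one> \<in> carrier_mat N N"
      by (rule mult_carrier_mat[OF \<phi>a[OF x] \<phi>c[OF one_closed]])
    have ix: "inv x \<in> carrier G" using x by simp
    have 1: "hs_norm N (\<phi> (inv x) - mat_adjoint (\<phi> x) * \<phi> \<one>) \<le> \<epsilon>"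
      using comp[OF x ix] x hs_norm_minus_commute[OF p \<phi>c[OF ix]] by simp
    have "mat_adjoint (\<phi> x) - mat_adjoint (\<phi> x) * \<phi> \<one> = mat_adjoint (\<phi> x) * (1\<^sub>m N - \<phi> \<one>)"
      using mult_minus_distrib_mat[OF \<phi>a[OF x] one_carrier_mat \<phi>c[OF one_closed]] right_mult_one_mat[OF \<phi>a[OF x]] by simp
    also have "hs_norm N \<dots> = hs_norm N (1\<^sub>m N - \<phi> \<one>)"
      using \<phi>u[OF x] \<phi>a[OF x] minus_carrier_mat[OF \<phi>c[OF one_closed]]
      by (intro hs_norm_unitary_left) (simp_all add: mat_adjoint_adjoint)
    finally have 2: "hs_norm N (mat_adjoint (\<phi> x) * \<phi> \<one> - mat_adjoint (\<phi> x)) \<le> \<epsilon>"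
      using one hs_norm_minus_commute[OF p \<phi>a[OF x]] by simp
    show ?thesis by (rule hs_norm_triangle[OF \<phi>c[OF ix] p \<phi>a[OF x] 1 2])
  qed
  have quot: "hs_norm N (\<phi> (x \<otimes> inv y) - \<phi> x * mat_adjoint (\<phi> y)) \<le> \<epsilon> + (\<epsilon> + \<epsilon>)"
    if x: "x \<in> carrier G" and y: "y \<in> carrier G" for x y
  proof -
    have iy: "inv y \<in> carrier G" and xy: "x \<otimes> inv y \<in> carrier G" using x y by simp_all
    have p: "\<phi> x * \<phi> (inv y) \<in> carrier_mat N N" "\<phi> x * mat_adjoint (\<phi> y) \<in> carrier_mat N N"
      using mult_carrier_mat[OF \<phi>c[OF x] \<phi>c[OF iy]] mult_carrier_mat[OF \<phi>c[OF x] \<phi>a[OF y]] by simp_all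
    have "\<phi> x * \<phi> (inv y) - \<phi> x * mat_adjoint (\<phi> y) = \<phi> x * (\<phi> (inv y) - mat_adjoint (\<phi> y))"
      using mult_minus_distrib_mat[OF \<phi>c[OF x] \<phi>c[OF iy] \<phi>a[OF y]] by simp
    also have "hs_norm N \<dots> = hs_norm N (\<phi> (inv y) - mat_adjoint (\<phi> y))"
      by (rule hs_norm_unitary_left[OF \<phi>c[OF x] \<phi>u(1)[OF x] minus_carrier_mat[OF \<phi>a[OF y]]])
    finally have "hs_norm N (\<phi> x * \<phi> (inv y) - \<phi> x * mat_adjoint (\<phi> y)) \<le> \<epsilon> + \<epsilon>" using inv_close[OF y] by simp
    thus ?thesis by (rule hs_norm_triangle[OF \<phi>c[OF xy] p mult[OF x iy]])
  qed
  \<comment> \<open>At distance up to \<open>r\<close> the Lipschitz term is at most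
    \<open>\<epsilon>\<close>, so the quasi-Lipschitz bound is 2 * \<open>\<epsilon>\<close>;
    \<open>L + 1\<close> avoids division by zero.\<close>
  define r where "r = \<epsilon> / (L + 1)"
  have r: "r > 0" using \<epsilon> L by (simp add: r_def)
  have "L * r \<le> \<epsilon>" using \<epsilon> L by (simp add: r_def field_simps)
  have near: "nrm ?NN (\<lambda>p. u x (fst p) (snd p) - u y (fst p) (snd p)) \<le> 2 * \<epsilon> * s"
    if x: "x \<in> carrier G" and y: "y \<in> carrier G" and xy: "d x y \<le> r" for x y
  proof -
    have "hs_norm N (\<phi> x - \<phi> y) \<le> L * d x y + \<epsilon>"
    proof -
      have "hs_dist N (\<phi> x) (\<phi> y) \<le> L * d x y + \<epsilon>" using lip x y by (simp add: quasi_Lipschitz_def)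
      thus ?thesis using \<phi>c[OF x] \<phi>c[OF y] by (simp add: hs_dist_def)
    qed
    also have "L * d x y \<le> L * r" using xy L by (rule mult_left_mono)
    finally have "hs_norm N (\<phi> x - \<phi> y) \<le> 2 * \<epsilon>" using \<open>L * r \<le> \<epsilon>\<close> by simp
    thus ?thesis
      unfolding s_def
      by (subst (asm) hs_norm_le_iff[OF minus_carrier_mat[OF \<phi>c[OF y]] N, of _ "\<lambda>p. u x (fst p) (snd p) - u y (fst p) (snd p)"])
        (simp_all add: minus_mat_index[OF \<phi>c[OF y]] u_def)
  qed
  have ub: "cmod (u x a b) \<le> 1" if "x \<in> carrier G" "a < N" "b < N" for x a b
    unfolding u_def by (rule unitary_entry_bound[OF \<phi>[OF that(1)] that(2,3)])
  obtain v C where C: "C \<ge> 0"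
    and v1: "\<forall>a<N. \<forall>b<N. bounded_by 1 (\<lambda>x. v x a b) \<and> lipschitz C (\<lambda>x. v x a b)"
    and v2: "\<forall>x\<in>carrier G. nrm ?NN (\<lambda>p. v x (fst p) (snd p) - u x (fst p) (snd p)) \<le> 2 * \<epsilon> * s"
    using lipschitz_smoothing[of r N u "2 * \<epsilon> * s", OF r ub near] by blast
  have vb: "bounded_by 1 (\<lambda>x. v x a b)" and vl: "lipschitz C (\<lambda>x. v x a b)" if "a < N" "b < N" for a b
    using v1 that by simp_all
  note vc = v2[rule_format]
  define t where "t x y a b = (\<Sum>c<N. u x a c * cnj (u y b c))" for x y a b
  \<comment> \<open>5 = 2 + 3: smoothing error, then the three uses of approximate multiplicativity
    in \<open>quot\<close>.\<close>
  have v_quot: "nrm ?NN (\<lambda>p. v (x \<otimes> inv y) (fst p) (snd p) - t x y (fst p) (snd p)) \<le> 5 * \<epsilon> * s"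
    if x: "x \<in> carrier G" and y: "y \<in> carrier G" for x y
  proof -
    have xy: "x \<otimes> inv y \<in> carrier G" using x y by simp
    have q: "\<phi> x * mat_adjoint (\<phi> y) \<in> carrier_mat N N" by (rule mult_carrier_mat[OF \<phi>c[OF x] \<phi>a[OF y]])
    have "nrm ?NN (\<lambda>p. u (x \<otimes> inv y) (fst p) (snd p) - t x y (fst p) (snd p)) \<le> (\<epsilon> + (\<epsilon> + \<epsilon>)) * sqrt (real N)"
    proof (subst hs_norm_le_iff[OF minus_carrier_mat[OF q] N, symmetric])
      fix p assume p: "p \<in> ?NN"
      hence "(\<phi> x * mat_adjoint (\<phi> y)) $$ (fst p, snd p) = t x y (fst p) (snd p)"
        unfolding t_def u_def by (intro mult_mat_adjoint_index[OF \<phi>c[OF x] \<phi>c[OF y]]) auto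
      thus "(\<phi> (x \<otimes> inv y) - \<phi> x * mat_adjoint (\<phi> y)) $$ p = u (x \<otimes> inv y) (fst p) (snd p) - t x y (fst p) (snd p)"
        unfolding minus_mat_index[OF q p] by (simp add: u_def)
    qed (rule quot[OF x y])
    thus ?thesis
      using nrm_diff_triangle[of ?NN "\<lambda>p. v (x \<otimes> inv y) (fst p) (snd p)" "\<lambda>p. t x y (fst p) (snd p)"
          "\<lambda>p. u (x \<otimes> inv y) (fst p) (snd p)"] vc[OF xy]
      unfolding s_def[symmetric] by (simp add: algebra_simps)
  qed
  \<comment> \<open>Symmetrisation makes the convolution matrix Hermitian. The error is not
    increased, as the target changes into its adjoint when \<open>x\<close> and \<open>y\<close> are
    exchanged.\<close>
  define \<psi> where "\<psi> x a b = 1/2 * (v x a b + cnj (v (inv x) b a))" for x a b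
  have \<psi>b: "bounded_by 1 (\<lambda>x. \<psi> x a b)" if "a < N" "b < N" for a b
    unfolding bounded_by_def
  proof
    fix x assume x: "x \<in> carrier G"
    have "cmod (v x a b) \<le> 1" "cmod (cnj (v (inv x) b a)) \<le> 1"
      using vb[OF that] vb[OF that(2,1)] x by (simp_all add: bounded_by_def)
    hence "cmod (v x a b + cnj (v (inv x) b a)) \<le> 2"
      using norm_triangle_ineq[of "v x a b" "cnj (v (inv x) b a)"] by linarith
    thus "cmod (\<psi> x a b) \<le> 1" by (simp add: \<psi>_def norm_mult)
  qed
  have \<psi>l: "lipschitz C (\<lambda>x. \<psi> x a b)" if "a < N" "b < N" for a b
  proof -
    have "lipschitz (1/2 * (C + C)) (\<lambda>x. \<psi> x a b)"
      unfolding \<psi>_def using that C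
      by (intro lipschitz_scale lipschitz_add lipschitz_cnj lipschitz_inv[of C "\<lambda>x. v x b a"] vl) auto
    thus ?thesis by simp
  qed
  have \<psi>h: "\<psi> (inv x) b a = cnj (\<psi> x a b)" if "x \<in> carrier G" for x a b
    using that by (simp add: \<psi>_def add.commute)
  have \<psi>c: "nrm ?NN (\<lambda>p. \<psi> (x \<otimes> inv y) (fst p) (snd p) - (\<Sum>c<N. u x (fst p) c * cnj (u y (snd p) c))) \<le> 5 * \<epsilon> * s"
    if x: "x \<in> carrier G" and y: "y \<in> carrier G" for x y
  proof -
    define X1 where "X1 p = v (x \<otimes> inv y) (fst p) (snd p) - t x y (fst p) (snd p)" for p
    define X2 where "X2 p = cnj (v (y \<otimes> inv x) (snd p) (fst p)) - t x y (fst p) (snd p)" for p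
    have n1: "nrm ?NN X1 \<le> 5 * \<epsilon> * s" unfolding X1_def by (rule v_quot[OF x y])
    have "cmod (X2 p) = cmod (v (y \<otimes> inv x) (snd p) (fst p) - t y x (snd p) (fst p))" for p
    proof -
      have "X2 p = cnj (v (y \<otimes> inv x) (snd p) (fst p) - t y x (snd p) (fst p))"
        by (simp add: X2_def t_def mult.commute)
      thus ?thesis by (simp only: complex_mod_cnj)
    qed
    hence "nrm ?NN X2 = nrm ?NN (\<lambda>p. v (y \<otimes> inv x) (snd p) (fst p) - t y x (snd p) (fst p))"
      unfolding nrm_def by simp
    also have "\<dots> = nrm ?NN (\<lambda>p. v (y \<otimes> inv x) (fst p) (snd p) - t y x (fst p) (snd p))"
      by (subst nrm_swap) simp
    finally have n2: "nrm ?NN X2 \<le> 5 * \<epsilon> * s" using v_quot[OF y x] by simp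
    have "inv (x \<otimes> inv y) = y \<otimes> inv x" using x y by (simp add: inv_mult_group)
    hence "\<psi> (x \<otimes> inv y) (fst p) (snd p) - (\<Sum>c<N. u x (fst p) c * cnj (u y (snd p) c)) = 1/2 * (X1 p + X2 p)" for p
      by (simp add: \<psi>_def X1_def X2_def t_def algebra_simps)
    hence "nrm ?NN (\<lambda>p. \<psi> (x \<otimes> inv y) (fst p) (snd p) - (\<Sum>c<N. u x (fst p) c * cnj (u y (snd p) c)))
        = 1/2 * nrm ?NN (\<lambda>p. X1 p + X2 p)"
      by (simp only: nrm_scale) simp
    thus ?thesis using nrm_triangle[of ?NN X1 X2] n1 n2 by simp
  qed
  have uu: "(\<Sum>a<N. cnj (u x a b) * u x a c) = of_bool (b = c)" if "x \<in> carrier G" "b < N" "c < N" for x b c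
    unfolding u_def mat_adjoint_mult_index[OF \<phi>c[OF that(1)] \<phi>c[OF that(1)] that(2,3), symmetric]
      \<phi>u(1)[OF that(1)] using that by simp
  have um: "nrm ?NN (\<lambda>p. (\<Sum>c<N. cnj (u x c (fst p)) * u (x \<otimes> g) c (snd p)) - u g (fst p) (snd p)) \<le> \<epsilon> * s"
    if x: "x \<in> carrier G" and g: "g \<in> carrier G" for x g
    unfolding s_def
  proof (subst hs_norm_le_iff[OF minus_carrier_mat[OF \<phi>c[OF g]] N, symmetric])
    fix p assume p: "p \<in> ?NN"
    have xg: "x \<otimes> g \<in> carrier G" using x g by simp
    have "(mat_adjoint (\<phi> x) * \<phi> (x \<otimes> g)) $$ (fst p, snd p) = (\<Sum>c<N. cnj (u x c (fst p)) * u (x \<otimes> g) c (snd p))"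
      unfolding u_def using p by (intro mat_adjoint_mult_index[OF \<phi>c[OF x] \<phi>c[OF xg]]) auto
    thus "(mat_adjoint (\<phi> x) * \<phi> (x \<otimes> g) - \<phi> g) $$ p
      = (\<Sum>c<N. cnj (u x c (fst p)) * u (x \<otimes> g) c (snd p)) - u g (fst p) (snd p)"
      unfolding minus_mat_index[OF \<phi>c[OF g] p] by (simp add: u_def)
  qed (rule comp[OF x g])
  \<comment> \<open>Here \<open>\<kappa>3\<close>, \<open>\<kappa>1\<close>,
    \<open>\<kappa>2\<close> are 5, 2 and 1 times \<open>\<epsilon> * s\<close>. The spectral
    subspace adds at most K^2 dimensions and the isometry 2 K^2 more, in total 1200 *
    \<open>\<epsilon>\<^sup>2\<close> * N; \<open>\<kappa>\<close> + 4 K is 45 + 80 = 125 times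
    \<open>\<epsilon> * s\<close>.\<close>
  define K where "K = 4 * (5 * \<epsilon> * s)"
  define \<kappa> where "\<kappa> = 8 * (5 * \<epsilon> * s) + 2 * (2 * \<epsilon> * s) + \<epsilon> * s"
  have K: "K \<ge> 0" "K\<^sup>2 = 400 * \<epsilon>\<^sup>2 * real N" using s \<epsilon> by (simp_all add: K_def power_mult_distrib)
  have "\<exists>m \<sigma> T. real N - K\<^sup>2 \<le> real m \<and> real m \<le> real N + K\<^sup>2 \<and>
    near_dilation N u K \<kappa> (sqrt (real N) * (4 * sqrt (real N))) (sqrt (real N) * (4 * sqrt (real N) * C)) 0 m \<sigma> T"
    unfolding K_def \<kappa>_def
    by (rule near_dilation_compactness, rule near_dilation_exists[OF N \<psi>b \<psi>l \<psi>h C uu vb vl C vc um \<psi>c])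
  then obtain m \<sigma> T where m: "real m \<le> real N + K\<^sup>2"
    and nd: "near_dilation N u K \<kappa> (sqrt (real N) * (4 * sqrt (real N))) (sqrt (real N) * (4 * sqrt (real N) * C)) 0 m \<sigma> T"
    by blast
  obtain m' \<rho> V C' where m': "N \<le> m'" "real m' \<le> m + 2 * K\<^sup>2" and \<rho>: "\<rho> \<in> hom G (unitary_group m')"
    and \<rho>l: "\<And>g h. g \<in> carrier G \<Longrightarrow> h \<in> carrier G \<Longrightarrow> hs_dist m' (\<rho> g) (\<rho> h) \<le> C' * d g h"
    and V: "isometry_mat N m' V"
    and close: "\<And>g. g \<in> carrier G \<Longrightarrow> nrm ?NN (\<lambda>p. u g (fst p) (snd p) - (mat_adjoint V * \<rho> g * V) $$ p) \<le> \<kappa> + 4 * K"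
    using exact_dilation[OF nd K(1) N] by blast
  have "real m' \<le> real N * (1 + 1200 * \<epsilon>\<^sup>2)" using m m' K(2) by (simp add: algebra_simps)
  moreover have "continuous_map mtopology (unitary_topology m') \<rho>"
    using \<rho> \<rho>l by (intro lipschitz_imp_continuous) (auto simp: hom_def)
  moreover have "hs_norm N (\<phi> g - mat_adjoint V * \<rho> g * V) \<le> 125 * \<epsilon>" if g: "g \<in> carrier G" for g
  proof -
    have Vc: "V \<in> carrier_mat m' N" using V by (simp add: isometry_mat_def)
    have "\<rho> g \<in> carrier (unitary_group m')" using \<rho> g by (auto simp: hom_def)
    hence \<rho>c: "\<rho> g \<in> carrier_mat m' m'" by (simp add: carrier_unitary_group)
    have W: "mat_adjoint V * \<rho> g * V \<in> carrier_mat N N"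
      by (rule mult_carrier_mat[OF mult_carrier_mat[OF mat_adjoint_carrier[OF Vc] \<rho>c] Vc])
    have "\<kappa> + 4 * K = 125 * \<epsilon> * sqrt (real N)" by (simp add: \<kappa>_def K_def s_def)
    thus ?thesis
      using close[OF g] W \<phi>c[OF g]
      by (subst hs_norm_le_iff[OF minus_carrier_mat[OF W] N, of _ "\<lambda>p. u g (fst p) (snd p) - (mat_adjoint V * \<rho> g * V) $$ p"])
        (simp_all add: minus_mat_index[OF W] u_def del: index_mult_mat)
  qed
  ultimately show ?thesis using m'(1) \<rho> V by blast
qed

end

theorem corollary2p6:
  fixes K :: "nat \<Rightarrow> 'a monoid"
    and T :: "nat \<Rightarrow> 'a topology"
    and d :: "nat \<Rightarrow> 'a \<Rightarrow> 'a \<Rightarrow> real"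
    and N :: "nat \<Rightarrow> nat"
    and \<phi> :: "nat \<Rightarrow> 'a \<Rightarrow> complex mat"
    and \<epsilon> L :: "nat \<Rightarrow> real"
  assumes "\<And>n. compact_metrizable_group (K n) (T n)"
    and "\<And>n. compatible_metric (T n) (d n)"
    and "\<And>n. bi_invariant (K n) (d n)"
    and "\<And>n. N n > 0"
    and "filterlim N at_top sequentially"
    and "\<And>n. \<phi> n \<in> carrier (K n) \<rightarrow> carrier (unitary_group (N n))"
    and "\<epsilon> \<longlonglongrightarrow> 0"
    and "\<And>n. L n \<ge> 0"
    and "\<And>n. eps_representation (K n) (N n) (\<epsilon> n) (\<phi> n)"
    and "\<And>n. quasi_Lipschitz (K n) (d n) (N n) (L n) (\<epsilon> n) (\<phi> n)"
  shows "\<exists>(n\<^sub>0 :: nat) (m :: nat \<Rightarrow> nat) (\<rho> :: nat \<Rightarrow> 'a \<Rightarrow> complex mat) (V :: nat \<Rightarrow> complex mat).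
    (\<forall>n\<ge>n\<^sub>0.
       m n \<ge> N n \<and>
       \<rho> n \<in> hom (K n) (unitary_group (m n)) \<and>
       continuous_map (T n) (unitary_topology (m n)) (\<rho> n) \<and>
       isometry_mat (N n) (m n) (V n)) \<and>
    (\<lambda>n. real (m n) / real (N n)) \<longlonglongrightarrow> 1 \<and>
    (\<lambda>n. SUP g\<in>carrier (K n).
       hs_norm (N n) (\<phi> n g - mat_adjoint (V n) * \<rho> n g * V n)) \<longlonglongrightarrow> 0"
proof -
  \<comment> \<open>The quantitative theorem needs a positive error, for the smoothing radius,
    whereas \<open>\<epsilon> n\<close> may be 0; a null sequence is added.\<close>
  define e where "e n = \<epsilon> n + 1 / (real n + 1)" for n
  have ne: "\<one>\<^bsub>K n\<^esub> \<in> carrier (K n)" for n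
  proof -
    interpret compact_metrizable_group "K n" "T n" by (rule assms(1))
    show ?thesis by simp
  qed
  have "\<exists>m \<rho> V. N n \<le> m \<and> real m \<le> real (N n) * (1 + 1200 * (e n)\<^sup>2) \<and> \<rho> \<in> hom (K n) (unitary_group m) \<and>
    continuous_map (T n) (unitary_topology m) \<rho> \<and> isometry_mat (N n) m V \<and>
    (\<forall>g\<in>carrier (K n). hs_norm (N n) (\<phi> n g - mat_adjoint V * \<rho> g * V) \<le> 125 * e n)" for n
  proof -
    interpret compact_metrizable_group "K n" "T n" by (rule assms(1))
    have ms: "Metric_space (carrier (K n)) (d n)" and top: "Metric_space.mtopology (carrier (K n)) (d n) = T n"
      using assms(2)[of n] topspace_carrier by (simp_all add: compatible_metric_def)
    interpret bi_invariant_group "K n" "d n"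
    proof (intro bi_invariant_group.intro bi_invariant_group_axioms.intro)
      show "Metric_space (carrier (K n)) (d n)" by (rule ms)
      show "compact_space (Metric_space.mtopology (carrier (K n)) (d n))" unfolding top by (rule compact)
    qed (use assms(3)[of n] is_group in \<open>simp_all add: bi_invariant_def\<close>)
    \<comment> \<open>A distance lies below \<open>\<epsilon> n\<close>, so
      \<open>\<epsilon> n\<close> is nonnegative.\<close>
    have "0 \<le> hs_dist (N n) (\<phi> n (\<one>\<^bsub>K n\<^esub> \<otimes>\<^bsub>K n\<^esub> \<one>\<^bsub>K n\<^esub>)) (\<phi> n \<one>\<^bsub>K n\<^esub> * \<phi> n \<one>\<^bsub>K n\<^esub>)"
      by (rule Metric_space.nonneg[OF Metric_space_hs_dist])
    also have "\<dots> \<le> \<epsilon> n" using assms(9)[of n] ne[of n] unfolding eps_representation_def by blast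
    finally have "0 \<le> \<epsilon> n" .
    hence e: "e n > 0" "\<epsilon> n \<le> e n" by (simp_all add: e_def add_nonneg_pos)
    have "eps_representation (K n) (N n) (e n) (\<phi> n)"
      using assms(9)[of n] e(2) unfolding eps_representation_def by (meson order_trans)
    moreover have "quasi_Lipschitz (K n) (d n) (N n) (L n) (e n) (\<phi> n)"
      using assms(10)[of n] e(2) unfolding quasi_Lipschitz_def by (meson add_left_mono order_trans)
    ultimately show ?thesis
      using approximate_representation_dilation[OF assms(4) _ e(1) assms(8)] assms(6)[of n] unfolding top by blast
  qed
  then obtain m \<rho> V where m: "\<And>n. N n \<le> m n" "\<And>n. real (m n) \<le> real (N n) * (1 + 1200 * (e n)\<^sup>2)"
    and hom: "\<And>n. \<rho> n \<in> hom (K n) (unitary_group (m n))"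
    and cont: "\<And>n. continuous_map (T n) (unitary_topology (m n)) (\<rho> n)"
    and iso: "\<And>n. isometry_mat (N n) (m n) (V n)"
    and close: "\<And>n g. g \<in> carrier (K n) \<Longrightarrow> hs_norm (N n) (\<phi> n g - mat_adjoint (V n) * \<rho> n g * V n) \<le> 125 * e n"
    by metis
  have "(\<lambda>n. 1 / (real n + 1)) \<longlonglongrightarrow> 0"
    using LIMSEQ_inverse_real_of_nat by (simp add: inverse_eq_divide add.commute)
  hence e0: "e \<longlonglongrightarrow> 0" unfolding e_def[abs_def] using tendsto_add[OF assms(7)] by simp
  have "(\<lambda>n. real (m n) / real (N n)) \<longlonglongrightarrow> 1"
  proof (rule real_tendsto_sandwich)
    show "\<forall>\<^sub>F n in sequentially. 1 \<le> real (m n) / real (N n)"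
      using m(1) assms(4) by (simp add: pos_le_divide_eq)
    show "\<forall>\<^sub>F n in sequentially. real (m n) / real (N n) \<le> 1 + 1200 * (e n)\<^sup>2"
      using m(2) assms(4) by (simp add: pos_divide_le_eq mult.commute)
    show "(\<lambda>n. 1 + 1200 * (e n)\<^sup>2) \<longlonglongrightarrow> 1" using e0 by (auto intro!: tendsto_eq_intros)
  qed simp
  moreover have "(\<lambda>n. SUP g\<in>carrier (K n). hs_norm (N n) (\<phi> n g - mat_adjoint (V n) * \<rho> n g * V n)) \<longlonglongrightarrow> 0"
  proof (rule real_tendsto_sandwich)
    \<comment> \<open>The supremum of reals is meaningful only for bounded nonempty families; the
      unit element provides the second.\<close>
    have bdd: "bdd_above ((\<lambda>g. hs_norm (N n) (\<phi> n g - mat_adjoint (V n) * \<rho> n g * V n)) ` carrier (K n))" for n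
      using close by (intro bdd_aboveI2)
    have "0 \<le> hs_norm (N n) X" for n X
      by (simp add: hs_norm_entries sum_nonneg)
    hence "0 \<le> (SUP g\<in>carrier (K n). hs_norm (N n) (\<phi> n g - mat_adjoint (V n) * \<rho> n g * V n))" for n
      using cSUP_upper2[OF bdd ne] by simp
    thus "\<forall>\<^sub>F n in sequentially. 0 \<le> (SUP g\<in>carrier (K n). hs_norm (N n) (\<phi> n g - mat_adjoint (V n) * \<rho> n g * V n))"
      by simp
    show "\<forall>\<^sub>F n in sequentially. (SUP g\<in>carrier (K n). hs_norm (N n) (\<phi> n g - mat_adjoint (V n) * \<rho> n g * V n)) \<le> 125 * e n"
      using close ne by (intro always_eventually allI cSUP_least) blast+
    show "(\<lambda>n. 125 * e n) \<longlonglongrightarrow> 0" using tendsto_mult_right_zero[OF e0] by simp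
  qed simp
  ultimately show ?thesis using m(1) hom cont iso by blast
qed

end
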